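(* Let $e_{12},e_{13},e_{23},e_{14},e_{24},e_{34}$ be the basis of $H^1(vP_4^+;\mathbb{C})=\mathbb{C}^6$ specified in the context, and let $x_{ij}$ be the corresponding coordinate functions. The resonance variety $\mathcal{R}^1_1(vP_4^+)$ is the irreducible, $4$-dimensional subvariety of degree $6$ inside $\mathbb{C}^6$ defined by the equations $$x_{12}x_{24}(x_{13}+x_{23})+x_{13}x_{34}(x_{12}-x_{23})-x_{24}x_{34}(x_{12}+x_{13})=0,$$ $$x_{12}x_{23}(x_{14}+x_{24})+x_{12}x_{34}(x_{23}-x_{14})+x_{14}x_{34}(x_{23}+x_{24})=0,$$ $$x_{13}x_{23}(x_{14}+x_{24})+x_{14}x_{24}(x_{13}+x_{23})+x_{34}(x_{13}x_{23}-x_{14}x_{24})=0,$$ $$x_{12}(x_{13}x_{14}-x_{23}x_{24})+x_{34}(x_{13}x_{23}-x_{14}x_{24})=0.$$ The resonance variety $\mathcal{R}^1_2(vP_4^+)$ consists of the $13$ lines in $\mathbb{C}^6$ spanned by the vectors $e_{12}$, $e_{13}$, $e_{23}$, $e_{14}$, $e_{24}$, $e_{34}$, $e_{12}-e_{13}+e_{23}$, $e_{12}-e_{14}+e_{24}$, $e_{13}-e_{14}+e_{34}$, $e_{23}-e_{24}+e_{34}$, $e_{13}-e_{23}-e_{14}+e_{24}$, $e_{12}+e_{23}-e_{14}+e_{34}$, $e_{12}-e_{13}+e_{24}-e_{34}$. Finally, $\mathcal{R}^1_d(vP_4^+)=\{0\}$ if $3\le d\le6$, and $\mathcal{R}^1_d(vP_4^+)=\emptyset$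 if $d\ge7$.
   Context: The group $vP_4^+$ has generators $x_{ij}$ ($1\le i<j\le4$) and relations $x_{ij}x_{ik}x_{jk}=x_{jk}x_{ik}x_{ij}$ for $i<j<k$, and $x_{ij}x_{kl}=x_{kl}x_{ij}$ for $i,j,k,l$ distinct, $i<j$, $k<l$. Its cohomology algebra $A=H^*(vP_4^+;\mathbb{C})$ is the graded-commutative algebra with degree $1$ generators $e_{ij}$, $1\le i<j\le4$, and relations $e_{ij}(e_{ik}-e_{jk})=0$ and $(e_{ij}-e_{ik})e_{jk}=0$ for $i<j<k$; the $e_{ij}$ form the basis of $H^1(vP_4^+;\mathbb{C})$ referred to in the claim. For $a\in A^1$ let $(A,a)$ be the cochain complex with differentials $A^i\to A^{i+1}$, $u\mapsto a\cdot u$. Then $\mathcal{R}^1_d(vP_4^+)=\{a\in A^1\mid\dim H^1(A,a)\ge d\}$. The degree of a homogeneous subvariety (cone) of $\mathbb{C}^6$ is the degree of the corresponding projective variety. *)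

theory Defs
  imports
    "HOL-Analysis.Analysis"
    "HOL-Library.Poly_Mapping"
    "HOL-Library.Extended_Nat"
    "HOL-Computational_Algebra.Polynomial"
begin

section \<open>Dimension of a quotient vector space\<close>

text \<open>For subspaces \<open>B \<subseteq> Z\<close> of a vector space with scalar multiplication \<open>sc\<close>: the residue classes
  modulo \<open>B\<close> of the elements of \<open>S\<close> are pairwise distinct and form a basis of \<open>Z / B\<close>.\<close>

definition quotient_basis ::
  "('a::field \<Rightarrow> 'b::ab_group_add \<Rightarrow> 'b) \<Rightarrow> 'b set \<Rightarrow> 'b set \<Rightarrow> 'b set \<Rightarrow> bool" where
  "quotient_basis sc Z B S \<longleftrightarrow>
     S \<subseteq> Z \<and>
     (\<forall>F c. finite F \<and> F \<subseteq> S \<and> (\<Sum>s\<in>F. sc (c s) s) \<in> B \<longrightarrow> (\<forall>s\<in>F. c s = 0)) \<and>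
     Z \<subseteq> {u + b |u b. u \<in> module.span sc S \<and> b \<in> B}"

text \<open>An infinite-dimensional quotient gets the value \<open>0\<close>, as with \<^const>\<open>vector_space.dim\<close>.\<close>

definition dim_quotient ::
  "('a::field \<Rightarrow> 'b::ab_group_add \<Rightarrow> 'b) \<Rightarrow> 'b set \<Rightarrow> 'b set \<Rightarrow> nat" where
  "dim_quotient sc Z B = card (SOME S. quotient_basis sc Z B S)"

text \<open>The \<open>\<complex>\<close>-algebra structure of a monoid algebra.\<close>

definition scale_pm :: "complex \<Rightarrow> ('k::monoid_add \<Rightarrow>\<^sub>0 complex) \<Rightarrow> ('k \<Rightarrow>\<^sub>0 complex)" where
  "scale_pm c p = Poly_Mapping.single 0 c * p"

interpretation pm: vector_space scale_pm
  by standard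
    (simp_all add: scale_pm_def algebra_simps single_add mult_single
       flip: mult.assoc)


section \<open>Affine varieties in \<open>\<complex>\<^sup>n\<close>\<close>

type_synonym 'v mpoly = "('v \<Rightarrow>\<^sub>0 nat) \<Rightarrow>\<^sub>0 complex"

definition mpoly_eval :: "'v mpoly \<Rightarrow> complex ^ 'v \<Rightarrow> complex" where
  "mpoly_eval p x =
     (\<Sum>m\<in>Poly_Mapping.keys p. Poly_Mapping.lookup p m *
        (\<Prod>i\<in>UNIV. (x $ i) ^ Poly_Mapping.lookup m i))"

definition zariski_closed :: "(complex ^ 'v) set \<Rightarrow> bool" where
  "zariski_closed V \<longleftrightarrow> (\<exists>P. V = {x. \<forall>p\<in>P. mpoly_eval p x = 0})"

definition irreducible_variety :: "(complex ^ 'v) set \<Rightarrow> bool" where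
  "irreducible_variety V \<longleftrightarrow>
     zariski_closed V \<and> V \<noteq> {} \<and>
     (\<forall>A B. zariski_closed A \<and> zariski_closed B \<and> V = A \<union> B \<longrightarrow> V = A \<or> V = B)"

text \<open>Krull dimension: the supremum of the lengths \<open>n\<close> of chains
  \<open>Z 0 \<subset> Z 1 \<subset> \<dots> \<subset> Z n\<close> of irreducible closed subsets.\<close>

definition variety_dim :: "(complex ^ 'v) set \<Rightarrow> enat" where
  "variety_dim V =
     (SUP n \<in> {n. \<exists>Z. (\<forall>i\<le>n. irreducible_variety (Z i) \<and> Z i \<subseteq> V) \<and> (\<forall>i<n. Z i \<subset> Z (Suc i))}.
        enat n)"

definition vanishing_ideal :: "(complex ^ 'v) set \<Rightarrow> 'v mpoly set" where
  "vanishing_ideal V = {p. \<forall>x\<in>V. mpoly_eval p x = 0}"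

definition homogeneous_part :: "nat \<Rightarrow> 'v::finite mpoly set" where
  "homogeneous_part n =
     {p. \<forall>m\<in>Poly_Mapping.keys p. (\<Sum>i\<in>UNIV. Poly_Mapping.lookup m i) = n}"

text \<open>For a cone \<open>V\<close> the vanishing ideal is homogeneous, and it is the ideal of the projective
  variety \<open>\<P>(V)\<close>. The following are therefore the Hilbert function and the Hilbert polynomial of
  (the homogeneous coordinate ring of) \<open>\<P>(V)\<close>.\<close>

definition hilbert_function :: "(complex ^ 'v) set \<Rightarrow> nat \<Rightarrow> nat" where
  "hilbert_function V n =
     dim_quotient scale_pm (homogeneous_part n) (homogeneous_part n \<inter> vanishing_ideal V)"

definition hilbert_polynomial :: "(complex ^ 'v) set \<Rightarrow> rat poly" where
  "hilbert_polynomial V =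
     (THE P. \<forall>\<^sub>F n in sequentially. poly P (of_nat n) = of_nat (hilbert_function V n))"

text \<open>The degree of a projective variety is \<open>r!\<close> times the leading coefficient of its Hilbert
  polynomial, where \<open>r\<close> is its dimension, which is the degree of the Hilbert polynomial.\<close>

definition cone_degree :: "(complex ^ 'v) set \<Rightarrow> rat" where
  "cone_degree V = fact (degree (hilbert_polynomial V)) * lead_coeff (hilbert_polynomial V)"


section \<open>Free associative algebras and two-sided ideals\<close>

datatype 'g word = Word (letters: "'g list")

instantiation word :: (type) monoid_add
begin

definition zero_word :: "'a word" where
  "zero_word = Word []"

definition plus_word :: "'a word \<Rightarrow> 'a word \<Rightarrow> 'a word" where
  "plus_word v w = Word (letters v @ letters w)"

instance
  by standard (simp_all add: zero_word_def plus_word_def)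

end

text \<open>The free associative \<open>\<complex>\<close>-algebra is the monoid algebra of the free monoid.\<close>

type_synonym 'g free_algebra = "'g word \<Rightarrow>\<^sub>0 complex"

definition free_gen :: "'g \<Rightarrow> 'g free_algebra" where
  "free_gen g = Poly_Mapping.single (Word [g]) 1"

definition free_part :: "nat \<Rightarrow> 'g free_algebra set" where
  "free_part k = {p. \<forall>w\<in>Poly_Mapping.keys p. length (letters w) = k}"

inductive_set two_sided_ideal :: "'a::ring_1 set \<Rightarrow> 'a set" for R where
  zero: "0 \<in> two_sided_ideal R"
| base: "r \<in> R \<Longrightarrow> r \<in> two_sided_ideal R"
| add: "p \<in> two_sided_ideal R \<Longrightarrow> q \<in> two_sided_ideal R \<Longrightarrow> p + q \<in> two_sided_ideal R"
| left: "p \<in> two_sided_ideal R \<Longrightarrow> a * p \<in> two_sided_ideal R"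
| right: "p \<in> two_sided_ideal R \<Longrightarrow> p * a \<in> two_sided_ideal R"

lemma two_sided_ideal_uminus:
  "p \<in> two_sided_ideal R \<Longrightarrow> - p \<in> two_sided_ideal R"
  using two_sided_ideal.left[of p R "-1"] by simp

lemma two_sided_ideal_diff:
  "p \<in> two_sided_ideal R \<Longrightarrow> q \<in> two_sided_ideal R \<Longrightarrow> p - q \<in> two_sided_ideal R"
  using two_sided_ideal.add[of p R "- q"] two_sided_ideal_uminus[of q R] by simp


section \<open>The cohomology algebra of \<open>vP\<^sub>4\<^sup>+\<close>\<close>

datatype edge = E12 | E13 | E23 | E14 | E24 | E34

lemma UNIV_edge: "(UNIV :: edge set) = {E12, E13, E23, E14, E24, E34}"
  using edge.exhaust by blast

instance edge :: finite
  by standard (simp add: UNIV_edge)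

text \<open>The first set of relations makes the quotient graded-commutative: for \<open>g = h\<close> it contains
  \<open>2 e\<^sub>g\<^sup>2\<close>.\<close>

definition vP4_relations :: "edge free_algebra set" where
  "vP4_relations =
     {free_gen g * free_gen h + free_gen h * free_gen g |g h. True} \<union>
     (\<Union>(ij, ik, jk) \<in> {(E12, E13, E23), (E12, E14, E24), (E13, E14, E34), (E23, E24, E34)}.
        {free_gen ij * (free_gen ik - free_gen jk), (free_gen ij - free_gen ik) * free_gen jk})"

lemma keys_two_sided_ideal_vP4:
  assumes "p \<in> two_sided_ideal vP4_relations" and "w \<in> Poly_Mapping.keys p"
  shows "2 \<le> length (letters w)"
  using assms
proof (induction arbitrary: w)
  case zero
  then show ?case by simp
next
  case (base r)
  have two: "2 \<le> length (letters v)"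
    if "v \<in> Poly_Mapping.keys (free_gen g * free_gen h)" for v and g h :: edge
    using that by (simp add: free_gen_def mult_single plus_word_def)
  have sums: "Poly_Mapping.keys (p + q) \<subseteq> Poly_Mapping.keys p \<union> Poly_Mapping.keys q"
    "Poly_Mapping.keys (p - q) \<subseteq> Poly_Mapping.keys p \<union> Poly_Mapping.keys q"
    for p q :: "edge free_algebra"
    using keys_add[of p q] keys_diff[of p q] by auto
  from base consider
      (comm) g h where "r = free_gen g * free_gen h + free_gen h * free_gen g"
    | (left) f g h where "r = free_gen f * free_gen g - free_gen f * free_gen h"
    | (right) f g h where "r = free_gen f * free_gen h - free_gen g * free_gen h"
    unfolding vP4_relations_def by (auto simp only: right_diff_distrib left_diff_distrib)
  then show ?case
  proof cases
    case comm
    then show ?thesis using base(2) sums(1) two by blast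
  next
    case left
    then show ?thesis using base(2) sums(2) two by blast
  next
    case right
    then show ?thesis using base(2) sums(2) two by blast
  qed
next
  case (add p q)
  then show ?case using keys_add[of p q] by blast
next
  case (left p a)
  then show ?case using keys_mult[of a p] by (fastforce simp: plus_word_def)
next
  case (right p a)
  then show ?case using keys_mult[of p a] by (fastforce simp: plus_word_def)
qed

quotient_type vP4_cohomology = "edge free_algebra" /
  "\<lambda>p q. p - q \<in> two_sided_ideal vP4_relations"
proof (rule equivpI)
  show "reflp (\<lambda>p q :: edge free_algebra. p - q \<in> two_sided_ideal vP4_relations)"
    by (rule reflpI) (simp add: two_sided_ideal.zero)
  show "symp (\<lambda>p q :: edge free_algebra. p - q \<in> two_sided_ideal vP4_relations)"
    by (rule sympI) (drule two_sided_ideal_uminus, simp)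
  show "transp (\<lambda>p q :: edge free_algebra. p - q \<in> two_sided_ideal vP4_relations)"
    by (rule transpI) (drule (1) two_sided_ideal.add, simp)
qed

instantiation vP4_cohomology :: ring_1
begin

lift_definition zero_vP4_cohomology :: vP4_cohomology is 0 .

lift_definition one_vP4_cohomology :: vP4_cohomology is 1 .

lift_definition plus_vP4_cohomology :: "vP4_cohomology \<Rightarrow> vP4_cohomology \<Rightarrow> vP4_cohomology" is "(+)"
  by (simp only: add_diff_add two_sided_ideal.add)

lift_definition uminus_vP4_cohomology :: "vP4_cohomology \<Rightarrow> vP4_cohomology" is uminus
  by (simp only: minus_diff_minus two_sided_ideal_uminus)

lift_definition minus_vP4_cohomology :: "vP4_cohomology \<Rightarrow> vP4_cohomology \<Rightarrow> vP4_cohomology" is "(-)"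
proof -
  fix p p' q q' :: "edge free_algebra"
  assume "p - p' \<in> two_sided_ideal vP4_relations" "q - q' \<in> two_sided_ideal vP4_relations"
  then have "(p - p') - (q - q') \<in> two_sided_ideal vP4_relations"
    by (rule two_sided_ideal_diff)
  then show "(p - q) - (p' - q') \<in> two_sided_ideal vP4_relations"
    by (simp add: algebra_simps)
qed

lift_definition times_vP4_cohomology :: "vP4_cohomology \<Rightarrow> vP4_cohomology \<Rightarrow> vP4_cohomology" is "(*)"
proof -
  fix p p' q q' :: "edge free_algebra"
  assume "p - p' \<in> two_sided_ideal vP4_relations" "q - q' \<in> two_sided_ideal vP4_relations"
  then have "(p - p') * q + p' * (q - q') \<in> two_sided_ideal vP4_relations"
    by (intro two_sided_ideal.add two_sided_ideal.left two_sided_ideal.right)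
  then show "p * q - p' * q' \<in> two_sided_ideal vP4_relations"
    by (simp add: algebra_simps)
qed

instance
proof
  show "(0 :: vP4_cohomology) \<noteq> 1"
  proof (transfer, rule notI)
    assume "0 - 1 \<in> two_sided_ideal vP4_relations"
    from two_sided_ideal_uminus[OF this] have "1 \<in> two_sided_ideal vP4_relations"
      by simp
    from keys_two_sided_ideal_vP4[OF this, of 0] show False
      by (simp add: zero_word_def)
  qed
qed (transfer; simp add: algebra_simps two_sided_ideal.zero)+

end

lemma scale_pm_in_ideal:
  "p \<in> two_sided_ideal R \<Longrightarrow> scale_pm c p \<in> two_sided_ideal R"
  by (simp add: scale_pm_def two_sided_ideal.left)

lift_definition scale_vP4 :: "complex \<Rightarrow> vP4_cohomology \<Rightarrow> vP4_cohomology" is scale_pm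
  by (simp add: scale_pm_in_ideal flip: pm.scale_right_diff_distrib)

interpretation vP4: vector_space scale_vP4
  by standard
    (transfer; simp add: algebra_simps pm.scale_right_distrib pm.scale_left_distrib two_sided_ideal.zero)+

definition vP4_part :: "nat \<Rightarrow> vP4_cohomology set" where
  "vP4_part k = abs_vP4_cohomology ` free_part k"

definition vP4_gen :: "edge \<Rightarrow> vP4_cohomology" where
  "vP4_gen g = abs_vP4_cohomology (free_gen g)"

definition vP4_class :: "complex ^ edge \<Rightarrow> vP4_cohomology" where
  "vP4_class x = (\<Sum>g\<in>UNIV. scale_vP4 (x $ g) (vP4_gen g))"


lemma vP4_class_eq:
  "vP4_class x = abs_vP4_cohomology (\<Sum>g\<in>UNIV. scale_pm (x $ g) (free_gen g))"
proof -
  have "abs_vP4_cohomology (\<Sum>g\<in>A. f g) = (\<Sum>g\<in>A. abs_vP4_cohomology (f g))"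
    if "finite A" for A :: "edge set" and f
    using that
    by (induction A rule: finite_induct)
      (simp_all add: zero_vP4_cohomology.abs_eq flip: plus_vP4_cohomology.abs_eq)
  then show ?thesis
    by (simp add: vP4_class_def vP4_gen_def scale_vP4.abs_eq)
qed

text \<open>The generators are a basis of the degree \<open>1\<close> part, so \<open>vP4_class\<close> identifies
  \<open>\<complex>\<^sup>6\<close> with \<open>H\<^sup>1\<close>.\<close>

lemma bij_betw_vP4_class: "bij_betw vP4_class UNIV (vP4_part 1)"
proof -
  let ?f = "\<lambda>x :: complex ^ edge. \<Sum>g\<in>UNIV. scale_pm (x $ g) (free_gen g)"
  have f_sum: "?f x = (\<Sum>g\<in>UNIV. Poly_Mapping.single (Word [g]) (x $ g))" for x
    by (simp add: scale_pm_def free_gen_def mult_single plus_word_def zero_word_def)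
  have lookup_f: "Poly_Mapping.lookup (?f x) w =
      (case letters w of [g] \<Rightarrow> x $ g | _ \<Rightarrow> 0)" for x w
  proof (cases w)
    case (Word l)
    show ?thesis
      unfolding f_sum lookup_sum lookup_single
      by (simp add: Word when_def split: list.split)
  qed
  have "inj vP4_class"
  proof (rule injI)
    fix x y assume "vP4_class x = vP4_class y"
    then have *: "?f x - ?f y \<in> two_sided_ideal vP4_relations"
      by (simp add: vP4_class_eq vP4_cohomology.abs_eq_iff)
    have "x $ g = y $ g" for g
    proof (rule ccontr)
      assume "x $ g \<noteq> y $ g"
      then have "Word [g] \<in> Poly_Mapping.keys (?f x - ?f y)"
        by (simp add: in_keys_iff lookup_minus lookup_f)
      from keys_two_sided_ideal_vP4[OF * this] show False by simp
    qed
    then show "x = y" by (simp add: vec_eq_iff)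
  qed
  moreover have "range vP4_class = vP4_part 1"
  proof
    show "range vP4_class \<subseteq> vP4_part 1"
      by (auto simp: vP4_class_eq vP4_part_def free_part_def in_keys_iff lookup_f
          split: list.splits intro!: imageI)
    show "vP4_part 1 \<subseteq> range vP4_class"
    proof
      fix a assume "a \<in> vP4_part 1"
      then obtain p where a: "a = abs_vP4_cohomology p"
        and p: "\<forall>w\<in>Poly_Mapping.keys p. length (letters w) = 1"
        by (auto simp: vP4_part_def free_part_def)
      have "p = ?f (\<chi> g. Poly_Mapping.lookup p (Word [g]))"
      proof (rule poly_mapping_eqI)
        fix w :: "edge word"
        obtain l where w: "w = Word l" by (cases w)
        show "Poly_Mapping.lookup p w =
            Poly_Mapping.lookup (?f (\<chi> g. Poly_Mapping.lookup p (Word [g]))) w"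
        proof (cases "length l = 1")
          case True
          then obtain g where "l = [g]"
            by (auto simp: length_Suc_conv)
          then show ?thesis
            by (simp only: lookup_f w word.sel list.case) simp
        next
          case False
          then have "Poly_Mapping.lookup p w = 0"
            using p w by (metis in_keys_iff word.sel)
          then show ?thesis
            using False by (simp only: lookup_f w word.sel) (auto split: list.split)
        qed
      qed
      then have "a = vP4_class (\<chi> g. Poly_Mapping.lookup p (Word [g]))"
        by (simp add: vP4_class_eq a)
      then show "a \<in> range vP4_class" by blast
    qed
  qed
  ultimately show ?thesis by (simp add: bij_betw_def)
qed


section \<open>Resonance varieties\<close>

definition aomoto_cocycles :: "nat \<Rightarrow> vP4_cohomology \<Rightarrow> vP4_cohomology set" where
  "aomoto_cocycles i a = {u \<in> vP4_part i. a * u = 0}"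

definition aomoto_coboundaries :: "nat \<Rightarrow> vP4_cohomology \<Rightarrow> vP4_cohomology set" where
  "aomoto_coboundaries i a = (case i of 0 \<Rightarrow> {0} | Suc j \<Rightarrow> (*) a ` vP4_part j)"

definition aomoto_betti :: "nat \<Rightarrow> vP4_cohomology \<Rightarrow> nat" where
  "aomoto_betti i a =
     dim_quotient scale_vP4 (aomoto_cocycles i a) (aomoto_coboundaries i a)"

definition resonance :: "nat \<Rightarrow> nat \<Rightarrow> vP4_cohomology set" where
  "resonance i d = {a \<in> vP4_part 1. d \<le> aomoto_betti i a}"

definition resonance_coords :: "nat \<Rightarrow> nat \<Rightarrow> (complex ^ edge) set" where
  "resonance_coords i d = {x. vP4_class x \<in> resonance i d}"

abbreviation unit_vec :: "edge \<Rightarrow> complex ^ edge" where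
  "unit_vec g \<equiv> axis g 1"

end

theory Submission
  imports Defs
begin

text \<open>Write \<open>(a, b, c, d, u, v) = (x\<^sub>1\<^sub>2, x\<^sub>1\<^sub>3, x\<^sub>2\<^sub>4, x\<^sub>3\<^sub>4, x\<^sub>2\<^sub>3, x\<^sub>1\<^sub>4)\<close>. Over the open set
  \<open>(ac - bd)(ab - cd) \<noteq> 0\<close> the cubic cone is the graph \<open>u = R / (ac - bd)\<close>, \<open>v = R / (ab - cd)\<close> with
  \<open>R = acd + bcd - abc - abd\<close>. The leading monomials of the four cubics are \<open>uac\<close>, \<open>vua\<close>, \<open>vub\<close>,
  \<open>vab\<close>; the monomials divisible by none of them span the coordinate ring, and comparing poles along
  \<open>ab = cd\<close>, along \<open>ac = bd\<close> and along \<open>b = -c\<close> shows that they are linearly independent already on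
  the graph. Hence a polynomial that vanishes on the graph vanishes on the cone, which is therefore
  irreducible, and counting standard monomials gives the Hilbert function
  \<open>n\<^sup>3 + 2 n\<^sup>2 + 2 n + 1\<close>. Its growth also bounds the dimension, because a chain of irreducible closed
  sets produces algebraically independent functions.

  In degree \<open>2\<close> the algebra has dimension \<open>7\<close>, so \<open>x y = 0\<close> amounts to seven bilinear equations. The
  product of any of the cubics in \<open>x\<close> with any \<open>2 \<times> 2\<close> minor of \<open>(x, y)\<close> lies in the ideal generated
  by them; conversely a solution \<open>y\<close> is written down according to which of the pairs \<open>(a, d)\<close>,
  \<open>(b, c)\<close>, \<open>(u, v)\<close> vanish.\<close>

section \<open>Dimension of quotients\<close>

text \<open>The obstacle is that irreducibility, dimension and degree are defined through the points
  of the cone and not through an ideal with given generators. That the four cubics generate a prime,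
  or even a radical, ideal is not known beforehand, nor that rewriting by their leading monomials is
  confluent. Independence of the standard monomials on the graph settles all of this at once:
  rewriting only has to span. Irreducibility then needs only polynomial curves inside the cone that
  join points of the graph, because the polynomials in one variable form a domain.

  The pairs \<open>(a, d)\<close>, \<open>(b, c)\<close>, \<open>(u, v)\<close> are the pairs of
  disjoint edges. Up to sign, their products are basis elements of degree 2 shared by no other
  product of generators, so three of the seven equations are 2 by 2 minors of \<open>(x, y)\<close>;
  the other four come from the triangles. The thirteen lines show the same pattern: six edges, four
  triangles, and three 4-cycles, which are the complements of the disjoint pairs.\<close>

context vector_space
begin

text \<open>In a vanishing combination over \<open>S \<union> C\<close> the part over
  \<open>C\<close> lies in \<open>B\<close>, hence so does the part over \<open>S\<close>; its
  coefficients vanish by the definition of a quotient basis, and then those over \<open>C\<close>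
  vanish too.\<close>

lemma quotient_basis_union_independent:
  assumes "subspace B" and S: "quotient_basis scale Z B S"
    and C: "C \<subseteq> B" "independent C"
  shows "S \<inter> B = {}" "independent (S \<union> C)"
proof -
  have indep: "c s = 0" if "finite F" "F \<subseteq> S" "(\<Sum>s\<in>F. scale (c s) s) \<in> B" "s \<in> F" for F c s
    using S that unfolding quotient_basis_def by blast
  show disj: "S \<inter> B = {}"
    using indep[of "{s}" "\<lambda>_. 1" s for s] by auto
  have "u w = 0" if T: "finite T" "T \<subseteq> S \<union> C" "(\<Sum>v\<in>T. scale (u v) v) = 0" "w \<in> T" for T u w
  proof -
    have split: "(\<Sum>v\<in>T \<inter> S. scale (u v) v) + (\<Sum>v\<in>T - S. scale (u v) v) = 0"
      using T(1,3) sum.Int_Diff[of T "\<lambda>v. scale (u v) v" S] by simp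
    have TC: "T - S \<subseteq> C" using T(2) by blast
    have "(\<Sum>v\<in>T - S. scale (u v) v) \<in> B"
      using TC C(1) \<open>subspace B\<close> by (intro subspace_sum subspace_scale) auto
    then have "(\<Sum>v\<in>T \<inter> S. scale (u v) v) \<in> B"
      using split \<open>subspace B\<close> subspace_neg by (metis add_eq_0_iff2)
    then have z: "u v = 0" if "v \<in> T \<inter> S" for v
      using indep[of "T \<inter> S" u v] T(1) that by auto
    with split have "(\<Sum>v\<in>T - S. scale (u v) v) = 0" by simp
    then have "u v = 0" if "v \<in> T - S" for v
      using C(2) TC T(1) that unfolding dependent_explicit by blast
    with z T(4) show ?thesis by blast
  qed
  then show "independent (S \<union> C)"
    unfolding dependent_explicit by blast
qed

text \<open>Together with a basis of \<open>B\<close>, a quotient basis is a basis of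
  \<open>Z\<close>. All quotient bases therefore have the same size, and the choice by
  \<open>SOME\<close> in \<open>dim_quotient\<close> does no harm.\<close>

lemma quotient_basis_card:
  assumes "subspace Z" "subspace B" "B \<subseteq> Z" "finite T" "Z \<subseteq> span T"
    and S: "quotient_basis scale Z B S"
  shows "card S = dim Z - dim B"
proof -
  obtain C where C: "C \<subseteq> B" "independent C" "B \<subseteq> span C" "card C = dim B"
    using basis_exists by blast
  note SC = quotient_basis_union_independent[OF \<open>subspace B\<close> S C(1,2)]
  have SZ: "S \<union> C \<subseteq> Z"
    using S C(1) \<open>B \<subseteq> Z\<close> by (auto simp: quotient_basis_def)
  have fin: "finite (S \<union> C)"
    using independent_span_bound[OF \<open>finite T\<close> SC(2)] SZ \<open>Z \<subseteq> span T\<close> by blast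
  have "Z \<subseteq> span (S \<union> C)"
  proof
    fix z assume "z \<in> Z"
    then obtain u b where "z = u + b" "u \<in> span S" "b \<in> B"
      using S unfolding quotient_basis_def by blast
    then show "z \<in> span (S \<union> C)"
      using C(3) span_mono[of S "S \<union> C"] span_mono[of C "S \<union> C"] span_add by blast
  qed
  from dim_unique[OF SZ this SC(2) refl] have "dim Z = card S + card C"
    using fin SC(1) C(1) by (subst (asm) card_Un_disjoint) auto
  with C(4) show ?thesis by simp
qed

lemma quotient_basis_exists:
  assumes "subspace Z" "subspace B" "B \<subseteq> Z"
  shows "\<exists>S. quotient_basis scale Z B S"
proof -
  obtain C where C: "C \<subseteq> B" "independent C" "B \<subseteq> span C"
    by (rule basis_exists[of B])
  obtain D where D: "C \<subseteq> D" "D \<subseteq> Z" "independent D" "Z \<subseteq> span D"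
    using maximal_independent_subset_extend[of C Z] C(1,2) \<open>B \<subseteq> Z\<close> by (metis subset_trans)
  have "quotient_basis scale Z B (D - C)"
    unfolding quotient_basis_def
  proof (intro conjI allI impI)
    show "D - C \<subseteq> Z" using D by blast
    show "Z \<subseteq> {u + b |u b. u \<in> span (D - C) \<and> b \<in> B}"
    proof
      fix z assume "z \<in> Z"
      then have "z \<in> span ((D - C) \<union> C)" using D by (simp add: Un_absorb2 subset_iff)
      then obtain u b where "z = u + b" "u \<in> span (D - C)" "b \<in> span C"
        unfolding span_Un by blast
      moreover have "span C \<subseteq> B" using C(1) \<open>subspace B\<close> by (simp add: span_minimal)
      ultimately show "z \<in> {u + b |u b. u \<in> span (D - C) \<and> b \<in> B}" by blast
    qed
  next
    fix F c
    assume F: "finite F \<and> F \<subseteq> D - C \<and> (\<Sum>s\<in>F. scale (c s) s) \<in> B"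
    then have "(\<Sum>s\<in>F. scale (c s) s) \<in> span C" using C(3) by blast
    then obtain T r where T: "finite T" "T \<subseteq> C" "(\<Sum>s\<in>F. scale (c s) s) = (\<Sum>a\<in>T. scale (r a) a)"
      unfolding span_explicit by blast
    \<comment> \<open>The equality of a combination over \<open>F\<close> with one over
      \<open>T\<close> is turned into a single vanishing combination over the disjoint union, all of
      it inside the independent set \<open>D\<close>.\<close>
    define u where "u s = (if s \<in> F then c s else - r s)" for s
    have FT: "F \<inter> T = {}" using F T(2) by blast
    have "(\<Sum>s\<in>F \<union> T. scale (u s) s) = (\<Sum>s\<in>F. scale (u s) s) + (\<Sum>s\<in>T. scale (u s) s)"
      using F T(1) FT by (intro sum.union_disjoint) auto
    also have "(\<Sum>s\<in>F. scale (u s) s) = (\<Sum>s\<in>F. scale (c s) s)" by (simp add: u_def)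
    also have "(\<Sum>s\<in>T. scale (u s) s) = (\<Sum>s\<in>T. - (scale (r s) s))"
      using FT by (intro sum.cong) (auto simp: u_def)
    finally have "(\<Sum>s\<in>F \<union> T. scale (u s) s) = 0"
      using T(3) by (simp add: sum_negf)
    moreover have "finite (F \<union> T)" "F \<union> T \<subseteq> D" using F T D by auto
    ultimately have "\<forall>s\<in>F \<union> T. u s = 0"
      using D(3) unfolding dependent_explicit by blast
    then show "\<forall>s\<in>F. c s = 0" by (metis UnI1 u_def)
  qed
  then show ?thesis ..
qed

lemma dim_quotient_eq:
  assumes "subspace Z" "subspace B" "B \<subseteq> Z" "finite T" "Z \<subseteq> span T"
  shows "dim_quotient scale Z B = dim Z - dim B"
  unfolding dim_quotient_def
  by (rule quotient_basis_card[OF assms]) (rule someI_ex[OF quotient_basis_exists[OF assms(1-3)]])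

end

section \<open>Evaluation of polynomials and irreducibility\<close>

definition monomial_eval :: "('v::finite \<Rightarrow>\<^sub>0 nat) \<Rightarrow> complex ^ 'v \<Rightarrow> complex" where
  "monomial_eval m x = (\<Prod>i\<in>UNIV. (x $ i) ^ Poly_Mapping.lookup m i)"

definition monomial_degree :: "('v::finite \<Rightarrow>\<^sub>0 nat) \<Rightarrow> nat" where
  "monomial_degree m = (\<Sum>i\<in>UNIV. Poly_Mapping.lookup m i)"

lemma monomial_eval_add: "monomial_eval (m + n) x = monomial_eval m x * monomial_eval n x"
  by (simp add: monomial_eval_def lookup_add power_add prod.distrib)

lemma monomial_eval_0 [simp]: "monomial_eval 0 x = 1"
  by (simp add: monomial_eval_def)

lemma monomial_degree_add: "monomial_degree (m + n) = monomial_degree m + monomial_degree n"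
  by (simp add: monomial_degree_def lookup_add sum.distrib)

lemma monomial_degree_0 [simp]: "monomial_degree 0 = 0"
  by (simp add: monomial_degree_def)

text \<open>Summing over a superset of the support lets two polynomials share one index set, which
  gives additivity of evaluation.\<close>

lemma mpoly_eval_superset:
  assumes "finite A" "Poly_Mapping.keys p \<subseteq> A"
  shows "mpoly_eval p x = (\<Sum>m\<in>A. Poly_Mapping.lookup p m * monomial_eval m x)"
  unfolding mpoly_eval_def monomial_eval_def
  using assms by (intro sum.mono_neutral_left) (auto simp: in_keys_iff)

lemma mpoly_eval_alt:
  "mpoly_eval p x = (\<Sum>m\<in>Poly_Mapping.keys p. Poly_Mapping.lookup p m * monomial_eval m x)"
  by (rule mpoly_eval_superset) auto

lemma mpoly_eval_0 [simp]: "mpoly_eval 0 x = 0"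
  by (simp add: mpoly_eval_alt)

lemma mpoly_eval_single [simp]: "mpoly_eval (Poly_Mapping.single m c) x = c * monomial_eval m x"
  by (subst mpoly_eval_superset[of "{m}"]) (auto split: if_splits)

lemma mpoly_eval_1 [simp]: "mpoly_eval 1 x = 1"
  by (simp flip: single_one)

lemma mpoly_eval_add [simp]: "mpoly_eval (p + q) x = mpoly_eval p x + mpoly_eval q x"
proof -
  let ?A = "Poly_Mapping.keys p \<union> Poly_Mapping.keys q"
  have "Poly_Mapping.keys (p + q) \<subseteq> ?A" by (rule keys_add)
  then show ?thesis
    by (simp add: mpoly_eval_superset[of ?A] lookup_add algebra_simps sum.distrib)
qed

lemma mpoly_eval_uminus [simp]: "mpoly_eval (- p) x = - mpoly_eval p x"
  using mpoly_eval_add[of p "- p" x] by (simp add: add_eq_0_iff)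

lemma mpoly_eval_diff [simp]: "mpoly_eval (p - q) x = mpoly_eval p x - mpoly_eval q x"
  using mpoly_eval_add[of p "- q" x] by simp

lemma mpoly_eval_sum [simp]: "mpoly_eval (\<Sum>i\<in>I. f i) x = (\<Sum>i\<in>I. mpoly_eval (f i) x)"
  by (induction I rule: infinite_finite_induct) auto

lemma poly_mapping_sum_singles:
  "p = (\<Sum>m\<in>Poly_Mapping.keys p. Poly_Mapping.single m (Poly_Mapping.lookup p m))"
  by (rule poly_mapping_eqI)
    (auto simp: lookup_sum lookup_single when_def in_keys_iff sum.delta)

lemma mpoly_eval_mult [simp]: "mpoly_eval (p * q) x = mpoly_eval p x * mpoly_eval q x"
proof -
  have "mpoly_eval (p * q) x = mpoly_eval (\<Sum>m\<in>Poly_Mapping.keys p. \<Sum>n\<in>Poly_Mapping.keys q.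
      Poly_Mapping.single (m + n) (Poly_Mapping.lookup p m * Poly_Mapping.lookup q n)) x"
    by (subst poly_mapping_sum_singles[of p], subst poly_mapping_sum_singles[of q])
      (simp add: sum_product mult_single)
  also have "\<dots> = mpoly_eval p x * mpoly_eval q x"
    unfolding mpoly_eval_alt[of p] mpoly_eval_alt[of q]
    by (simp add: sum_product monomial_eval_add mult_ac)
  finally show ?thesis .
qed

lemma mpoly_eval_power [simp]: "mpoly_eval (p ^ n) x = mpoly_eval p x ^ n"
  by (induction n) auto

lemma mpoly_eval_scale [simp]: "mpoly_eval (scale_pm c p) x = c * mpoly_eval p x"
  by (simp add: scale_pm_def)

definition mpoly_var :: "'v \<Rightarrow> 'v mpoly" where
  "mpoly_var g = Poly_Mapping.single (Poly_Mapping.single g 1) 1"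

lemma mpoly_eval_var [simp]: "mpoly_eval (mpoly_var g) x = x $ g" for g :: "'v::finite"
proof -
  have "monomial_eval (Poly_Mapping.single g 1) x = (\<Prod>i\<in>UNIV. if i = g then x $ i else 1)"
    unfolding monomial_eval_def
    by (intro prod.cong) (auto simp: lookup_single when_def)
  then show ?thesis by (simp add: mpoly_var_def)
qed

section \<open>Closed sets and two criteria around irreducibility\<close>

lemma zariski_closed_Int:
  assumes "zariski_closed A" "zariski_closed B"
  shows "zariski_closed (A \<inter> B)"
proof -
  from assms obtain P Q where "A = {x. \<forall>p\<in>P. mpoly_eval p x = 0}" "B = {x. \<forall>p\<in>Q. mpoly_eval p x = 0}"
    unfolding zariski_closed_def by blast
  then have "A \<inter> B = {x. \<forall>p\<in>P \<union> Q. mpoly_eval p x = 0}" by blast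
  then show ?thesis unfolding zariski_closed_def by blast
qed

lemma zariski_closed_zeros: "zariski_closed {x. mpoly_eval p x = 0}"
  unfolding zariski_closed_def by (rule exI[of _ "{p}"]) simp

lemma subspace_vanishing_ideal: "pm.subspace (vanishing_ideal V)"
  by (rule pm.subspaceI) (auto simp: vanishing_ideal_def)

lemma mpoly_eval_curve:
  fixes \<gamma> :: "complex \<Rightarrow> complex ^ 'v::finite"
  assumes "\<And>i. \<exists>P. \<forall>t. \<gamma> t $ i = poly P t"
  shows "\<exists>P. \<forall>t. mpoly_eval p (\<gamma> t) = poly P t"
proof -
  from assms obtain P where P: "\<And>i t. \<gamma> t $ i = poly (P i) t" by metis
  have "mpoly_eval p (\<gamma> t) = poly (\<Sum>m\<in>Poly_Mapping.keys p.
      smult (Poly_Mapping.lookup p m) (\<Prod>i\<in>UNIV. P i ^ Poly_Mapping.lookup m i)) t" for t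
    by (simp add: mpoly_eval_def P poly_sum poly_prod)
  then show ?thesis by blast
qed

text \<open>If \<open>Z = A \<union> B\<close> properly, some \<open>f\<close> vanishes on
  \<open>A\<close> and some \<open>g\<close> on \<open>B\<close>, neither on all of
  \<open>Z\<close>; by density both are nonzero somewhere on \<open>W\<close>. Along a polynomial
  curve in \<open>Z\<close> through two such points \<open>f\<close> and \<open>g\<close> become
  nonzero polynomials in \<open>t\<close> with product zero. Curves are demanded only between points
  of \<open>W\<close>, where a parametrization is at hand.\<close>

lemma irreducible_variety_curves:
  fixes Z :: "(complex ^ 'v::finite) set"
  assumes closed: "zariski_closed Z" and sub: "W \<subseteq> Z" "W \<noteq> {}"
    and dense: "\<And>f x. (\<forall>y\<in>W. mpoly_eval f y = 0) \<Longrightarrow> x \<in> Z \<Longrightarrow> mpoly_eval f x = 0"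
    and curve: "\<And>p q. p \<in> W \<Longrightarrow> q \<in> W \<Longrightarrow>
      \<exists>\<gamma>. (\<forall>i. \<exists>P. \<forall>t. \<gamma> t $ i = poly P t) \<and> (\<forall>t. \<gamma> t \<in> Z) \<and> \<gamma> 0 = p \<and> \<gamma> 1 = q"
  shows "irreducible_variety Z"
  unfolding irreducible_variety_def
proof (intro conjI allI impI)
  show "zariski_closed Z" "Z \<noteq> {}" using closed sub by auto
next
  fix A B assume AB: "zariski_closed A \<and> zariski_closed B \<and> Z = A \<union> B"
  then obtain P Q where P: "A = {x. \<forall>p\<in>P. mpoly_eval p x = 0}"
    and Q: "B = {x. \<forall>p\<in>Q. mpoly_eval p x = 0}"
    unfolding zariski_closed_def by blast
  show "Z = A \<or> Z = B"
  proof (rule ccontr)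
    assume "\<not> (Z = A \<or> Z = B)"
    then obtain x y where "x \<in> Z" "x \<notin> A" "y \<in> Z" "y \<notin> B" using AB by blast
    then obtain f g where f: "f \<in> P" "mpoly_eval f x \<noteq> 0" and g: "g \<in> Q" "mpoly_eval g y \<noteq> 0"
      using P Q by blast
    obtain p q where p: "p \<in> W" "mpoly_eval f p \<noteq> 0" and q: "q \<in> W" "mpoly_eval g q \<noteq> 0"
      using dense f g \<open>x \<in> Z\<close> \<open>y \<in> Z\<close> by metis
    obtain \<gamma> where \<gamma>: "\<And>i. \<exists>P. \<forall>t. \<gamma> t $ i = poly P t" "\<And>t. \<gamma> t \<in> Z" "\<gamma> 0 = p" "\<gamma> 1 = q"
      using curve[OF p(1) q(1)] by blast
    obtain F where F: "\<And>t. mpoly_eval f (\<gamma> t) = poly F t" using mpoly_eval_curve[OF \<gamma>(1)] by blast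
    obtain G where G: "\<And>t. mpoly_eval g (\<gamma> t) = poly G t" using mpoly_eval_curve[OF \<gamma>(1)] by blast
    have "poly (F * G) t = 0" for t
      using \<gamma>(2)[of t] AB P Q f g by (auto simp flip: F G)
    then have "F * G = 0" by (metis poly_0 poly_eq_poly_eq_iff ext)
    then show False using p q F[of 0] G[of 1] \<gamma>(3,4) by auto
  qed
qed

text \<open>The coordinate ring of an irreducible variety is a domain: the zero sets of
  \<open>f\<close> and \<open>g\<close> are closed and cover \<open>Z\<close>.\<close>

lemma irreducible_variety_mult:
  assumes "irreducible_variety Z" "\<forall>x\<in>Z. mpoly_eval f x * mpoly_eval g x = 0"
  shows "(\<forall>x\<in>Z. mpoly_eval f x = 0) \<or> (\<forall>x\<in>Z. mpoly_eval g x = 0)"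
proof -
  let ?V = "\<lambda>f. Z \<inter> {x. mpoly_eval f x = 0}"
  have "zariski_closed Z" using assms(1) by (simp add: irreducible_variety_def)
  then have "zariski_closed (?V f)" for f by (intro zariski_closed_Int zariski_closed_zeros)
  moreover have "Z = ?V f \<union> ?V g" using assms(2) by auto
  ultimately have "Z = ?V f \<or> Z = ?V g"
    using assms(1) unfolding irreducible_variety_def by blast
  then show ?thesis by blast
qed

section \<open>Standard monomials of the cubic cone\<close>

lemma sum_edge: "(\<Sum>g\<in>UNIV. f g) = f E12 + f E13 + f E23 + f E14 + f E24 + f E34"
  for f :: "edge \<Rightarrow> 'a::comm_monoid_add"
  by (simp add: UNIV_edge add.assoc)

lemma prod_edge: "(\<Prod>g\<in>UNIV. f g) = f E12 * f E13 * f E23 * f E14 * f E24 * f E34"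
  for f :: "edge \<Rightarrow> 'a::comm_monoid_mult"
  by (simp add: UNIV_edge mult.assoc)

lemma all_edge: "(\<forall>g. P g) \<longleftrightarrow> P E12 \<and> P E13 \<and> P E23 \<and> P E14 \<and> P E24 \<and> P E34"
  by (metis edge.exhaust)

definition cubic_cone :: "(complex ^ edge) set" where
  "cubic_cone = {x.
     x$E12 * x$E24 * (x$E13 + x$E23) + x$E13 * x$E34 * (x$E12 - x$E23)
       - x$E24 * x$E34 * (x$E12 + x$E13) = 0 \<and>
     x$E12 * x$E23 * (x$E14 + x$E24) + x$E12 * x$E34 * (x$E23 - x$E14)
       + x$E14 * x$E34 * (x$E23 + x$E24) = 0 \<and>
     x$E13 * x$E23 * (x$E14 + x$E24) + x$E14 * x$E24 * (x$E13 + x$E23)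
       + x$E34 * (x$E13 * x$E23 - x$E14 * x$E24) = 0 \<and>
     x$E12 * (x$E13 * x$E14 - x$E23 * x$E24)
       + x$E34 * (x$E13 * x$E23 - x$E14 * x$E24) = 0}"

lemma zariski_closed_cubic_cone: "zariski_closed cubic_cone"
proof -
  let ?x = "mpoly_var :: edge \<Rightarrow> edge mpoly"
  have "cubic_cone = {x. \<forall>p\<in>{
     ?x E12 * ?x E24 * (?x E13 + ?x E23) + ?x E13 * ?x E34 * (?x E12 - ?x E23)
       - ?x E24 * ?x E34 * (?x E12 + ?x E13),
     ?x E12 * ?x E23 * (?x E14 + ?x E24) + ?x E12 * ?x E34 * (?x E23 - ?x E14)
       + ?x E14 * ?x E34 * (?x E23 + ?x E24),
     ?x E13 * ?x E23 * (?x E14 + ?x E24) + ?x E14 * ?x E24 * (?x E13 + ?x E23)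
       + ?x E34 * (?x E13 * ?x E23 - ?x E14 * ?x E24),
     ?x E12 * (?x E13 * ?x E14 - ?x E23 * ?x E24)
       + ?x E34 * (?x E13 * ?x E23 - ?x E14 * ?x E24)}. mpoly_eval p x = 0}"
    by (simp add: cubic_cone_def)
  then show ?thesis unfolding zariski_closed_def by blast
qed

definition standard_monomial :: "(edge \<Rightarrow>\<^sub>0 nat) \<Rightarrow> bool" where
  "standard_monomial m \<longleftrightarrow>
     (\<forall>(g, h, i) \<in> {(E12, E23, E24), (E12, E23, E14), (E13, E23, E14), (E12, E13, E14)}.
        Poly_Mapping.lookup m g = 0 \<or> Poly_Mapping.lookup m h = 0 \<or> Poly_Mapping.lookup m i = 0)"

definition standard_span :: "nat set \<Rightarrow> edge mpoly set" where
  "standard_span D =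
     pm.span ((\<lambda>m. Poly_Mapping.single m 1) ` {m. standard_monomial m \<and> monomial_degree m \<in> D})"

lemma subspace_standard_span: "pm.subspace (standard_span D)"
  by (simp add: standard_span_def)

abbreviation cubic_monomial :: "edge \<Rightarrow> edge \<Rightarrow> edge \<Rightarrow> edge \<Rightarrow>\<^sub>0 nat" where
  "cubic_monomial g h i \<equiv>
     Poly_Mapping.single g 1 + Poly_Mapping.single h 1 + Poly_Mapping.single i 1"

lemma monomial_eval_single [simp]: "monomial_eval (Poly_Mapping.single g (Suc 0)) x = x $ g"
  using mpoly_eval_var[of g x] by (simp add: mpoly_var_def)

lemma monomial_degree_single [simp]: "monomial_degree (Poly_Mapping.single g (Suc 0)) = 1"
  by (simp add: monomial_degree_def lookup_single when_def)

text \<open>The weights are chosen such that in each cubic one monomial outweighs all the others.\<close>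

definition reduction_weight :: "(edge \<Rightarrow>\<^sub>0 nat) \<Rightarrow> nat" where
  "reduction_weight m = 2 * Poly_Mapping.lookup m E14 + 2 * Poly_Mapping.lookup m E23
     + 2 * Poly_Mapping.lookup m E12 + Poly_Mapping.lookup m E13"

lemma reduction_weight_add: "reduction_weight (m + n) = reduction_weight m + reduction_weight n"
  by (simp add: reduction_weight_def lookup_add)

lemma divide_cubic_monomial:
  assumes "0 < Poly_Mapping.lookup m g" "0 < Poly_Mapping.lookup m h" "0 < Poly_Mapping.lookup m i"
    "g \<noteq> h" "g \<noteq> i" "h \<noteq> i"
  obtains k where "m = k + cubic_monomial g h i"
proof
  show "m = m - cubic_monomial g h i + cubic_monomial g h i"
    using assms by (intro poly_mapping_eqI) (auto simp: lookup_add lookup_minus lookup_single when_def)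
qed

text \<open>A multiple of a leading monomial is replaced, on the cone, by the remaining terms of its
  cubic. The weight is additive and drops at each replacement, and homogeneity of the cubics
  preserves the degree.\<close>

lemma standard_span_monomial:
  "\<exists>s\<in>standard_span {monomial_degree m}. \<forall>x\<in>cubic_cone. monomial_eval m x = mpoly_eval s x"
proof (induction m rule: measure_induct_rule[of reduction_weight])
  case (less m)
  \<comment> \<open>\<open>L\<close> holds the coefficients and monomials to which one cubic equates
    its leading monomial \<open>k'\<close>. Multiplied by the cofactor \<open>k\<close>, each of
    them is lighter than \<open>m\<close>, so the induction hypothesis applies to it.\<close>
  have step: ?case if "m = k + k'" and eval: "\<And>x. x \<in> cubic_cone \<Longrightarrow>
       monomial_eval k' x = (\<Sum>cn\<leftarrow>L. fst cn * monomial_eval (snd cn) x)"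
     and L: "\<And>c n. (c, n) \<in> set L \<Longrightarrow> reduction_weight n < reduction_weight k' \<and>
       monomial_degree n = monomial_degree k'" for k k' L
  proof -
    have "\<forall>cn\<in>set L. \<exists>s. s \<in> standard_span {monomial_degree m} \<and>
        (\<forall>x\<in>cubic_cone. monomial_eval (k + snd cn) x = mpoly_eval s x)"
    proof
      fix cn assume "cn \<in> set L"
      then have "reduction_weight (k + snd cn) < reduction_weight m"
        "monomial_degree (k + snd cn) = monomial_degree m"
        using L[of "fst cn" "snd cn"] \<open>m = k + k'\<close>
        by (auto simp: reduction_weight_add monomial_degree_add)
      then show "\<exists>s. s \<in> standard_span {monomial_degree m} \<and>
          (\<forall>x\<in>cubic_cone. monomial_eval (k + snd cn) x = mpoly_eval s x)"
        using less[of "k + snd cn"] by auto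
    qed
    from bchoice[OF this] obtain s where s: "\<And>cn. cn \<in> set L \<Longrightarrow> s cn \<in> standard_span {monomial_degree m}"
      "\<And>cn x. cn \<in> set L \<Longrightarrow> x \<in> cubic_cone \<Longrightarrow> monomial_eval (k + snd cn) x = mpoly_eval (s cn) x"
      by blast
    let ?s = "\<lambda>L. \<Sum>cn\<leftarrow>L. scale_pm (fst cn) (s cn)"
    have "?s L' \<in> standard_span {monomial_degree m}" if "set L' \<subseteq> set L" for L'
      using that
      by (induction L')
        (auto intro!: pm.subspace_0 pm.subspace_add pm.subspace_scale subspace_standard_span s(1))
    moreover have "mpoly_eval (?s L') x = (\<Sum>cn\<leftarrow>L'. fst cn * monomial_eval (k + snd cn) x)"
      if "set L' \<subseteq> set L" "x \<in> cubic_cone" for L' x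
      using that by (induction L') (auto simp: s(2))
    moreover have "(\<Sum>cn\<leftarrow>L'. fst cn * monomial_eval (k + snd cn) x) =
        monomial_eval k x * (\<Sum>cn\<leftarrow>L'. fst cn * monomial_eval (snd cn) x)" for L' x
      by (induction L') (auto simp: monomial_eval_add algebra_simps)
    ultimately show ?thesis
      using eval \<open>m = k + k'\<close>
      by (intro bexI[of _ "?s L"]) (auto simp: monomial_eval_add case_prod_beta)
  qed
  note cubic_simps = reduction_weight_add monomial_degree_add monomial_eval_add
  show ?case
  proof (cases "standard_monomial m")
    case True
    then show ?thesis
      by (intro bexI[of _ "Poly_Mapping.single m 1"])
        (auto simp: standard_span_def intro: pm.span_base)
  next
    case False
    then obtain g h i where ghi: "(g, h, i) \<in> {(E12, E23, E24), (E12, E23, E14), (E13, E23, E14), (E12, E13, E14)}"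
      and pos: "0 < Poly_Mapping.lookup m g" "0 < Poly_Mapping.lookup m h" "0 < Poly_Mapping.lookup m i"
      unfolding standard_monomial_def by auto
    from ghi have "g \<noteq> h" "g \<noteq> i" "h \<noteq> i" by auto
    from divide_cubic_monomial[OF pos this] obtain k where "m = k + cubic_monomial g h i" .
    with ghi consider (1) k where "m = k + cubic_monomial E12 E23 E24"
      | (2) k where "m = k + cubic_monomial E12 E23 E14"
      | (3) k where "m = k + cubic_monomial E13 E23 E14"
      | (4) k where "m = k + cubic_monomial E12 E13 E14"
      by fast
    then show ?thesis
    proof cases
      case 1
      show ?thesis
        by (rule step[OF 1, where L = "[(-1, cubic_monomial E12 E13 E24), (-1, cubic_monomial E12 E13 E34),
            (1, cubic_monomial E13 E34 E23), (1, cubic_monomial E12 E24 E34), (1, cubic_monomial E13 E24 E34)]"])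
          (simp add: cubic_simps cubic_cone_def, algebra,
           auto simp: cubic_simps reduction_weight_def lookup_add lookup_single)
    next
      case 2
      show ?thesis
        by (rule step[OF 2, where L = "[(-1, cubic_monomial E12 E23 E24), (-1, cubic_monomial E12 E23 E34),
            (1, cubic_monomial E12 E14 E34), (-1, cubic_monomial E14 E23 E34), (-1, cubic_monomial E14 E24 E34)]"])
          (simp add: cubic_simps cubic_cone_def, algebra,
           auto simp: cubic_simps reduction_weight_def lookup_add lookup_single)
    next
      case 3
      show ?thesis
        by (rule step[OF 3, where L = "[(-1, cubic_monomial E13 E23 E24), (-1, cubic_monomial E13 E14 E24),
            (-1, cubic_monomial E23 E14 E24), (-1, cubic_monomial E13 E23 E34), (1, cubic_monomial E14 E24 E34)]"])
          (simp add: cubic_simps cubic_cone_def, algebra,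
           auto simp: cubic_simps reduction_weight_def lookup_add lookup_single)
    next
      case 4
      show ?thesis
        by (rule step[OF 4, where L = "[(1, cubic_monomial E12 E23 E24), (-1, cubic_monomial E13 E23 E34),
            (1, cubic_monomial E14 E24 E34)]"])
          (simp add: cubic_simps cubic_cone_def, algebra,
           auto simp: cubic_simps reduction_weight_def lookup_add lookup_single)
    qed
  qed
qed

lemma standard_span_mpoly:
  assumes "\<And>m. m \<in> Poly_Mapping.keys p \<Longrightarrow> monomial_degree m \<in> D"
  shows "\<exists>s\<in>standard_span D. \<forall>x\<in>cubic_cone. mpoly_eval p x = mpoly_eval s x"
proof -
  obtain s where s: "\<And>m. s m \<in> standard_span {monomial_degree m}"
    "\<And>m x. x \<in> cubic_cone \<Longrightarrow> monomial_eval m x = mpoly_eval (s m) x"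
    using standard_span_monomial by metis
  have "s m \<in> standard_span D" if "m \<in> Poly_Mapping.keys p" for m
  proof -
    have "standard_span {monomial_degree m} \<subseteq> standard_span D"
      unfolding standard_span_def using assms[OF that]
      by (intro pm.span_mono image_mono) auto
    with s(1) show ?thesis by blast
  qed
  then have "(\<Sum>m\<in>Poly_Mapping.keys p. scale_pm (Poly_Mapping.lookup p m) (s m)) \<in> standard_span D"
    by (intro pm.subspace_sum pm.subspace_scale subspace_standard_span) auto
  then show ?thesis
    by (intro bexI) (auto simp: mpoly_eval_alt[of p] s(2))
qed

section \<open>Independence of the standard monomials\<close>

text \<open>Multiply the relation by \<open>\<beta> ^ K\<close> and let \<open>t\<close> tend to 0:
  a term with pole order below \<open>K\<close> keeps a factor \<open>\<beta>\<close> and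
  disappears. What is left carries the common factor \<open>\<rho> 0 ^ K\<close>, which is
  nonzero.\<close>

lemma principal_part_zero:
  fixes h :: "'m \<Rightarrow> complex \<Rightarrow> complex"
  assumes "finite M" and h: "\<And>m. m \<in> M \<Longrightarrow> isCont (h m) 0"
    and \<rho>: "isCont \<rho> 0" "\<rho> 0 \<noteq> 0" and \<beta>: "isCont \<beta> 0" "\<beta> 0 = 0"
    and K: "\<And>m. m \<in> M \<Longrightarrow> k m \<le> K"
    and zero: "\<forall>\<^sub>F t in at 0. \<beta> t \<noteq> 0 \<and> (\<Sum>m\<in>M. h m t * (\<rho> t / \<beta> t) ^ k m) = 0"
  shows "(\<Sum>m | m \<in> M \<and> k m = K. h m 0) = 0"
proof -
  define G where "G t = (\<Sum>m\<in>M. h m t * \<rho> t ^ k m * \<beta> t ^ (K - k m))" for t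
  have "isCont G 0"
    unfolding G_def using h \<rho> \<beta> by (intro continuous_intros) auto
  then have "(G \<longlongrightarrow> G 0) (at 0)" by (simp add: isCont_def)
  moreover have "\<forall>\<^sub>F t in at 0. G t = 0"
    using zero
  proof eventually_elim
    case (elim t)
    have "h m t * \<rho> t ^ k m * \<beta> t ^ (K - k m) = h m t * (\<rho> t / \<beta> t) ^ k m * \<beta> t ^ K" if "m \<in> M" for m
      using elim K[OF that] by (simp add: power_divide power_diff)
    then have "G t = (\<Sum>m\<in>M. h m t * (\<rho> t / \<beta> t) ^ k m) * \<beta> t ^ K"
      unfolding G_def sum_distrib_right by (intro sum.cong) auto
    with elim show ?case by simp
  qed
  then have "(G \<longlongrightarrow> 0) (at 0)" by (simp add: tendsto_eventually)
  ultimately have "G 0 = 0" by (metis at_neq_bot tendsto_unique)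
  moreover have "G 0 = (\<Sum>m\<in>M. if k m = K then h m 0 * \<rho> 0 ^ K else 0)"
    unfolding G_def using K \<beta>(2) by (intro sum.cong) (auto simp: power_0_left dest: antisym)
  then have "G 0 = (\<Sum>m | m \<in> M \<and> k m = K. h m 0) * \<rho> 0 ^ K"
    using \<open>finite M\<close> by (simp add: sum.If_cases sum_distrib_right Int_def)
  ultimately show ?thesis using \<rho>(2) by simp
qed

lemma monomials_independent:
  fixes c :: "'m \<Rightarrow> complex"
  assumes "finite M" "inj_on e M" and zero: "\<And>z::real. 1 < z \<Longrightarrow> (\<Sum>m\<in>M. c m * of_real z ^ e m) = 0"
    and "m \<in> M"
  shows "c m = 0"
proof -
  let ?P = "\<Sum>m\<in>M. monom (c m) (e m)"
  have "of_real ` {1::real<..} \<subseteq> {z. poly ?P z = 0}"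
    using zero by (auto simp: poly_sum poly_monom)
  moreover have "infinite (of_real ` {1::real<..} :: complex set)"
    by (subst finite_image_iff) (auto intro: inj_onI simp: infinite_Ioi)
  ultimately have "?P = 0" using poly_roots_finite finite_subset by blast
  then have "0 = coeff ?P (e m)" by simp
  also have "\<dots> = (\<Sum>n\<in>M. if n = m then c n else 0)"
    unfolding coeff_sum using assms(2,4) by (intro sum.cong) (auto dest: inj_onD)
  finally show ?thesis using assms(1,4) by simp
qed

lemma base_expansion_unique:
  fixes N :: nat
  assumes "a < N" "a' < N" "a + N * x = a' + N * x'"
  shows "a = a' \<and> x = x'"
proof -
  have "(a + N * x) mod N = (a' + N * x') mod N" using assms(3) by (rule arg_cong)
  then have "a = a'" using assms(1,2) by simp
  then show ?thesis using assms(2,3) by simp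
qed

text \<open>Substituting \<open>z\<close>, \<open>z\<^sup>N\<close>, \<open>z\<^bsup>N\<^sup>2\<^esup>\<close>, \<open>z\<^bsup>N\<^sup>3\<^esup>\<close> for large \<open>N\<close> sends distinct monomials to distinct
  powers of \<open>z\<close>, and it suffices to know the polynomial on these points.\<close>

lemma monomials_independent4:
  fixes c :: "'m \<Rightarrow> complex" and e1 e2 e3 e4 :: "'m \<Rightarrow> nat"
  assumes "finite M" and inj: "inj_on (\<lambda>m. (e1 m, e2 m, e3 m, e4 m)) M"
    and zero: "\<And>w x y z :: real. 1 < w \<Longrightarrow> w * w \<le> x \<Longrightarrow> x * x \<le> y \<Longrightarrow> y * y \<le> z \<Longrightarrow>
      (\<Sum>m\<in>M. c m * of_real w ^ e1 m * of_real x ^ e2 m * of_real y ^ e3 m * of_real z ^ e4 m) = 0"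
    and "m \<in> M"
  shows "c m = 0"
proof -
  \<comment> \<open>All exponents are below \<open>N\<close>, so \<open>e1\<close>,
    \<open>e2\<close>, \<open>e3\<close> are digits in base \<open>N\<close>. The summand 2 gives
    \<open>N \<ge> 2\<close>, which the growth conditions between successive substituted values
    require.\<close>
  define N where "N = (\<Sum>m\<in>M. e1 m + e2 m + e3 m + e4 m) + 2"
  have N: "e1 m < N" "e2 m < N" "e3 m < N" if "m \<in> M" for m
    using member_le_sum[of m M "\<lambda>m. e1 m + e2 m + e3 m + e4 m"] that \<open>finite M\<close>
    by (simp_all add: N_def)
  let ?e = "\<lambda>m. e1 m + N * (e2 m + N * (e3 m + N * e4 m))"
  have "inj_on ?e M"
  proof (rule inj_onI)
    fix m n assume mn: "m \<in> M" "n \<in> M" "?e m = ?e n"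
    from base_expansion_unique[OF N(1)[OF mn(1)] N(1)[OF mn(2)] mn(3)]
    have 1: "e1 m = e1 n" "e2 m + N * (e3 m + N * e4 m) = e2 n + N * (e3 n + N * e4 n)" by auto
    from base_expansion_unique[OF N(2)[OF mn(1)] N(2)[OF mn(2)] 1(2)]
    have 2: "e2 m = e2 n" "e3 m + N * e4 m = e3 n + N * e4 n" by auto
    from base_expansion_unique[OF N(3)[OF mn(1)] N(3)[OF mn(2)] 2(2)] N(1)[OF mn(1)]
    have "e3 m = e3 n" "e4 m = e4 n" by auto
    with 1 2 show "m = n" using inj_onD[OF inj _ mn(1,2)] by simp
  qed
  moreover have "(\<Sum>m\<in>M. c m * of_real z ^ ?e m) = 0" if "1 < z" for z :: real
  proof -
    have le: "z ^ k * z ^ k \<le> z ^ (N * k)" for k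
      using \<open>1 < z\<close> by (simp flip: power_add) (simp add: N_def)
    from zero[of z "z ^ N" "z ^ (N * N)" "z ^ (N * (N * N))"] le[of 1] le[of N] le[of "N * N"] \<open>1 < z\<close>
    have "(\<Sum>m\<in>M. c m * of_real z ^ e1 m * of_real (z ^ N) ^ e2 m * of_real (z ^ (N * N)) ^ e3 m
        * of_real (z ^ (N * (N * N))) ^ e4 m) = (0::complex)" by simp
    then show ?thesis
      by (simp add: power_add distrib_left mult.assoc flip: power_mult)
  qed
  ultimately show ?thesis using monomials_independent[of M ?e c m] assms by blast
qed

text \<open>The integer map to \<open>(a + b, b + c, a + d)\<close> has kernel spanned by
  \<open>(1, -1, 1, -1)\<close>. A shift along it moves \<open>a\<close> and \<open>c\<close>
  together, so requiring one of them to be 0 singles out one representative.\<close>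

lemma exponents_unique:
  fixes a b c d :: nat
  assumes "a = 0 \<or> c = 0" "a' = 0 \<or> c' = 0" "a + b = a' + b'" "b + c = b' + c'" "a + d = a' + d'"
  shows "a = a' \<and> b = b' \<and> c = c' \<and> d = d'"
  using assms by arith

text \<open>The argument order is \<open>x\<^sub>1\<^sub>2, x\<^sub>1\<^sub>3, x\<^sub>2\<^sub>4, x\<^sub>3\<^sub>4, x\<^sub>2\<^sub>3, x\<^sub>1\<^sub>4\<close>: the last two coordinates are rational
  functions of the first four on the cubic cone.\<close>

definition edge_vec :: "complex \<Rightarrow> complex \<Rightarrow> complex \<Rightarrow> complex \<Rightarrow> complex \<Rightarrow> complex \<Rightarrow> complex ^ edge" where
  "edge_vec a b c d u v =
     (\<chi> g. case g of E12 \<Rightarrow> a | E13 \<Rightarrow> b | E24 \<Rightarrow> c | E34 \<Rightarrow> d | E23 \<Rightarrow> u | E14 \<Rightarrow> v)"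

lemma edge_vec_nth [simp]:
  "edge_vec a b c d u v $ E12 = a" "edge_vec a b c d u v $ E13 = b" "edge_vec a b c d u v $ E24 = c"
  "edge_vec a b c d u v $ E34 = d" "edge_vec a b c d u v $ E23 = u" "edge_vec a b c d u v $ E14 = v"
  by (simp_all add: edge_vec_def)

text \<open>The three expressions are kept over an arbitrary commutative ring because they are also
  formed with polynomials in a curve parameter.\<close>

definition pole23 :: "'a::comm_ring_1 \<Rightarrow> 'a \<Rightarrow> 'a \<Rightarrow> 'a \<Rightarrow> 'a" where
  "pole23 a b c d = a * c - b * d"

definition pole14 :: "'a::comm_ring_1 \<Rightarrow> 'a \<Rightarrow> 'a \<Rightarrow> 'a \<Rightarrow> 'a" where
  "pole14 a b c d = a * b - c * d"

definition graph_num :: "'a::comm_ring_1 \<Rightarrow> 'a \<Rightarrow> 'a \<Rightarrow> 'a \<Rightarrow> 'a" where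
  "graph_num a b c d = a * c * d + b * c * d - a * b * c - a * b * d"

definition graph_point :: "complex \<Rightarrow> complex \<Rightarrow> complex \<Rightarrow> complex \<Rightarrow> complex ^ edge" where
  "graph_point a b c d =
     edge_vec a b c d (graph_num a b c d / pole23 a b c d) (graph_num a b c d / pole14 a b c d)"

lemma standard_span_keys:
  assumes "p \<in> standard_span D" "m \<in> Poly_Mapping.keys p"
  shows "standard_monomial m" "monomial_degree m \<in> D"
proof -
  let ?T = "{p. \<forall>m\<in>Poly_Mapping.keys p. standard_monomial m \<and> monomial_degree m \<in> D}"
  have "pm.subspace ?T"
  proof (rule pm.subspaceI)
    fix c and p :: "edge mpoly"
    assume "p \<in> ?T"
    then show "scale_pm c p \<in> ?T"
      using keys_mult[of "Poly_Mapping.single 0 c" p] by (force simp: scale_pm_def split: if_splits)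
  qed (use keys_add in fastforce)+
  then have "standard_span D \<subseteq> ?T"
    unfolding standard_span_def by (intro pm.span_minimal) auto
  with assms show "standard_monomial m" "monomial_degree m \<in> D" by auto
qed

text \<open>Among the monomials of \<open>f\<close> keep those of maximal degree \<open>K\<close> in \<open>x\<^sub>1\<^sub>4\<close>, and among these the ones of
  maximal degree \<open>L\<close> in \<open>x\<^sub>2\<^sub>3\<close>. If \<open>K > 0\<close>, the leading term along the pole \<open>ab = cd\<close>, parametrized by
  \<open>a = sc\<close>, \<open>d = sb\<close>, must vanish; there \<open>x\<^sub>2\<^sub>3\<close> becomes \<open>bc (s - 1) / (b + c)\<close>, which has a pole along
  \<open>b = -c\<close> if \<open>L > 0\<close>. If \<open>K = 0 < L\<close>, use the pole \<open>ac = bd\<close>, parametrized by \<open>a = sd\<close>, \<open>b = sc\<close>. In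
  each case standardness makes the surviving monomials distinct on the parametrized locus.\<close>

lemma standard_span_graph_zero:
  assumes std: "\<And>m. m \<in> Poly_Mapping.keys f \<Longrightarrow> standard_monomial m"
    and zero: "\<And>a b c d. pole23 a b c d \<noteq> 0 \<Longrightarrow> pole14 a b c d \<noteq> 0 \<Longrightarrow>
      mpoly_eval f (graph_point a b c d) = 0"
  shows "f = 0"
proof (rule ccontr)
  assume "f \<noteq> 0"
  let ?M = "Poly_Mapping.keys f" and ?c = "Poly_Mapping.lookup f"
  let ?a = "\<lambda>m. Poly_Mapping.lookup m E12" and ?b = "\<lambda>m. Poly_Mapping.lookup m E13"
  let ?s = "\<lambda>m. Poly_Mapping.lookup m E24" and ?d = "\<lambda>m. Poly_Mapping.lookup m E34"
  let ?u = "\<lambda>m. Poly_Mapping.lookup m E23" and ?v = "\<lambda>m. Poly_Mapping.lookup m E14"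
  let ?y = "\<lambda>m a b c d. ?c m * a ^ ?a m * b ^ ?b m * c ^ ?s m * d ^ ?d m"
  have M: "finite ?M" "?M \<noteq> {}" using \<open>f \<noteq> 0\<close> by auto
  have eqI: "m = n" if "?a m = ?a n" "?b m = ?b n" "?s m = ?s n" "?d m = ?d n" "?u m = ?u n" "?v m = ?v n" for m n
  proof (rule poly_mapping_eqI)
    show "Poly_Mapping.lookup m g = Poly_Mapping.lookup n g" for g
      using that by (cases g) auto
  qed
  have graph: "(\<Sum>m\<in>?M. ?y m a b c d * (graph_num a b c d / pole23 a b c d) ^ ?u m
      * (graph_num a b c d / pole14 a b c d) ^ ?v m) = 0"
    if "pole23 a b c d \<noteq> 0" "pole14 a b c d \<noteq> 0" for a b c d
    using zero[OF that]
    by (simp add: mpoly_eval_alt monomial_eval_def prod_edge graph_point_def mult_ac)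
  note defs = pole23_def pole14_def graph_num_def
  define K where "K = Max (?v ` ?M)"
  have K: "?v m \<le> K" if "m \<in> ?M" for m using that by (simp add: K_def)
  define M1 where "M1 = {m \<in> ?M. ?v m = K}"
  have M1: "finite M1" "M1 \<noteq> {}"
    using Max_in[of "?v ` ?M"] M unfolding M1_def K_def[symmetric] by auto
  define L where "L = Max (?u ` M1)"
  have L: "?u m \<le> L" if "m \<in> M1" for m using that M1 by (simp add: L_def)
  define M2 where "M2 = {m \<in> M1. ?u m = L}"
  have M2: "finite M2" "M2 \<noteq> {}"
    using Max_in[of "?u ` M1"] M1 unfolding M2_def L_def[symmetric] by auto
  have sub: "M1 \<subseteq> ?M" "M2 \<subseteq> M1" by (auto simp: M1_def M2_def)
  have M2_uv: "?u m = L" "?v m = K" if "m \<in> M2" for m using that by (auto simp: M1_def M2_def)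
  have M2_std: "standard_monomial m" "?c m \<noteq> 0" if "m \<in> M2" for m
    using that sub std by (auto simp: in_keys_iff)
  \<comment> \<open>The factor \<open>r\<close> absorbs the sign that the substitution
    \<open>b = -c\<close> produces in the last case.\<close>
  have contra: False if "\<And>m. m \<in> M2 \<Longrightarrow> ?c m * r m = 0" "\<And>m. r m \<noteq> 0" for r
    using that M2_std(2) M2(2) by fastforce
  \<comment> \<open>The pole \<open>ab = cd\<close> is approached by moving \<open>a\<close> away
    from \<open>s * c\<close>: then \<open>pole14\<close> equals \<open>t * b\<close>, a simple
    zero, while \<open>pole23\<close> and \<open>graph_num\<close> stay nonzero in the limit by the
    conditions on \<open>s\<close>, \<open>b\<close>, \<open>c\<close>.\<close>
  have pole14_part: "(\<Sum>m\<in>M1. ?y m (s * c) b c (s * b) * (b * c * (s - 1) / (b + c)) ^ ?u m) = 0"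
    if "s \<noteq> 0" "b \<noteq> 0" "c \<noteq> 0" "s \<noteq> 1" "b \<noteq> c" "b + c \<noteq> 0" for s b c :: complex
  proof -
    let ?p = "\<lambda>F t. F (s * c + t) b c (s * b) :: complex"
    have p0: "?p pole23 0 = s * (c - b) * (b + c)" "?p graph_num 0 = s * b * c * (c - b) * (s - 1)"
      by (simp_all add: defs algebra_simps)
    have cont: "isCont (?p pole23) 0" "isCont (?p graph_num) 0" "isCont (?p pole14) 0"
      unfolding defs by (intro continuous_intros)+
    have ne: "?p pole23 0 \<noteq> 0" and ne': "?p graph_num 0 \<noteq> 0" unfolding p0 using that by simp_all
    have zero: "?p pole14 0 = 0" by (simp add: defs)
    have "\<forall>\<^sub>F t in at 0. ?p pole23 t \<noteq> 0"
      using cont(1) ne by (intro tendsto_imp_eventually_ne) (auto simp: isCont_def)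
    moreover have "\<forall>\<^sub>F t in at (0::complex). t \<noteq> 0" by (simp add: eventually_at_filter)
    ultimately have ev: "\<forall>\<^sub>F t in at 0. ?p pole14 t \<noteq> 0 \<and>
        (\<Sum>m\<in>?M. ?y m (s * c + t) b c (s * b) * (?p graph_num t / ?p pole23 t) ^ ?u m
          * (?p graph_num t / ?p pole14 t) ^ ?v m) = 0"
    proof eventually_elim
      case (elim t)
      have "?p pole14 t = t * b" by (simp add: defs algebra_simps)
      with elim that have "?p pole14 t \<noteq> 0" by simp
      with graph[OF elim(1) this] show ?case by simp
    qed
    have "(\<Sum>m | m \<in> ?M \<and> ?v m = K. ?y m (s * c + 0) b c (s * b) * (?p graph_num 0 / ?p pole23 0) ^ ?u m) = 0"
    proof (rule principal_part_zero[OF M(1) _ cont(2) ne' cont(3) zero K ev])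
      show "isCont (\<lambda>t. ?y m (s * c + t) b c (s * b) * (?p graph_num t / ?p pole23 t) ^ ?u m) 0" for m
        using cont(1,2) ne by (intro continuous_intros) auto
    qed
    then show ?thesis
      unfolding p0 using that by (simp add: M1_def mult.assoc)
  qed
  consider "K = 0" "L = 0" | "K = 0" "L > 0" | "K > 0" "L = 0" | "K > 0" "L > 0" by blast
  then show False
  proof cases
    case 1
    have M12: "?M = M1" "M1 = M2"
      using K L 1 unfolding M1_def M2_def by auto
    have "?c m = 0" if "m \<in> M2" for m
    proof (rule monomials_independent4[OF M2(1) _ _ that])
      show "inj_on (\<lambda>m. (?a m, ?b m, ?s m, ?d m)) M2"
        by (rule inj_onI) (auto intro!: eqI simp: M2_uv)
      fix w x y z :: real
      assume *: "1 < w" "w * w \<le> x" "x * x \<le> y" "y * y \<le> z"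
      \<comment> \<open>The growth conditions order the four values strictly, which keeps both
        \<open>ac - bd\<close> and \<open>ab - cd\<close> away from zero. No pole occurs in this
        case, and the four coordinates are free.\<close>
      have **: "w < x" "x < y" "y < z" "0 < w"
        using * by (smt (verit) mult_less_cancel_left1 mult_le_cancel_left1)+
      have "w * y < x * z" "w * x < y * z"
        using ** by (intro mult_strict_mono; simp)+
      then have "pole23 (complex_of_real w) (of_real x) (of_real y) (of_real z) \<noteq> 0"
        "pole14 (complex_of_real w) (of_real x) (of_real y) (of_real z) \<noteq> 0"
        unfolding defs by (simp_all flip: of_real_mult)
      from graph[OF this] show "(\<Sum>m\<in>M2. ?c m * of_real w ^ ?a m * of_real x ^ ?b m * of_real y ^ ?s m
          * of_real z ^ ?d m) = 0"
        unfolding M12 by (simp add: M2_uv 1)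
    qed
    then show False using contra[of "\<lambda>_. 1"] by simp
  next
    case 2
    have v0: "?v m = 0" if "m \<in> ?M" for m using K[OF that] 2 by simp
    then have M12: "M1 = ?M" using 2 unfolding M1_def by auto
    have pole23_part: "(\<Sum>m\<in>M2. ?y m (s * d) (s * c) c d) = 0"
      if "s \<noteq> 0" "c \<noteq> 0" "d \<noteq> 0" "s \<noteq> 1" "s + 1 \<noteq> 0" "c + d \<noteq> 0" for s c d :: complex
    proof -
      let ?p = "\<lambda>F t. F (s * d + t) (s * c) c d :: complex"
      have p0: "?p pole14 0 = c * d * (s - 1) * (s + 1)" "?p graph_num 0 = s * c * d * (c + d) * (1 - s)"
        by (simp_all add: defs algebra_simps)
      have cont: "isCont (?p pole23) 0" "isCont (?p graph_num) 0" "isCont (?p pole14) 0"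
        unfolding defs by (intro continuous_intros)+
      have ne: "?p pole14 0 \<noteq> 0" and ne': "?p graph_num 0 \<noteq> 0" unfolding p0 using that by simp_all
      have zero: "?p pole23 0 = 0" by (simp add: defs)
      have "\<forall>\<^sub>F t in at 0. ?p pole14 t \<noteq> 0"
        using cont(3) ne by (intro tendsto_imp_eventually_ne) (auto simp: isCont_def)
      moreover have "\<forall>\<^sub>F t in at (0::complex). t \<noteq> 0" by (simp add: eventually_at_filter)
      ultimately have ev: "\<forall>\<^sub>F t in at 0. ?p pole23 t \<noteq> 0 \<and>
          (\<Sum>m\<in>M1. ?y m (s * d + t) (s * c) c d * (?p graph_num t / ?p pole23 t) ^ ?u m) = 0"
      proof eventually_elim
        case (elim t)
        have "?p pole23 t = t * c" by (simp add: defs algebra_simps)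
        with elim that have "?p pole23 t \<noteq> 0" by simp
        with graph[OF this elim(1)] show ?case
          unfolding M12 by (simp add: v0)
      qed
      have "(\<Sum>m | m \<in> M1 \<and> ?u m = L. ?y m (s * d + 0) (s * c) c d) = 0"
      proof (rule principal_part_zero[OF M1(1) _ cont(2) ne' cont(1) zero L ev])
        show "isCont (\<lambda>t. ?y m (s * d + t) (s * c) c d) 0" for m
          by (intro continuous_intros)
      qed
      then show ?thesis by (simp add: M2_def)
    qed
    have "?c m = 0" if "m \<in> M2" for m
    proof (rule monomials_independent4[OF M2(1) _ _ that])
      \<comment> \<open>Here \<open>u\<close> divides every surviving monomial, so the forbidden
        \<open>uac\<close> leaves no room for both \<open>a\<close> and \<open>c\<close>: exactly
        the normalization that makes the exponents of \<open>s\<close>, \<open>c\<close>,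
        \<open>d\<close> determine the monomial.\<close>
      have zero: "?a m = 0 \<or> ?s m = 0" if "m \<in> M2" for m
        using M2_std(1)[OF that] M2_uv[OF that] 2 by (auto simp: standard_monomial_def)
      show "inj_on (\<lambda>m. (?a m + ?b m, ?b m + ?s m, ?a m + ?d m, 0)) M2"
      proof (rule inj_onI)
        fix m n assume mn: "m \<in> M2" "n \<in> M2"
          "(?a m + ?b m, ?b m + ?s m, ?a m + ?d m, 0) = (?a n + ?b n, ?b n + ?s n, ?a n + ?d n, 0)"
        then show "m = n"
          using exponents_unique[OF zero[OF mn(1)] zero[OF mn(2)], of "?b m" "?b n" "?d m" "?d n"]
          by (intro eqI) (simp_all add: M2_uv)
      qed
      fix w x y z :: real
      assume *: "1 < w" "w * w \<le> x" "x * x \<le> y"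
      have "w < x" "x < y"
        using * by (smt (verit) mult_less_cancel_left1 mult_le_cancel_left1)+
      then have "complex_of_real x + of_real y \<noteq> 0" "complex_of_real w + 1 \<noteq> 0"
        "complex_of_real w \<noteq> 0" "complex_of_real x \<noteq> 0" "complex_of_real y \<noteq> 0" "complex_of_real w \<noteq> 1"
        using * of_real_eq_0_iff[of "x + y", where ?'a = complex] of_real_eq_0_iff[of "w + 1", where ?'a = complex]
        by simp_all
      then have "(\<Sum>m\<in>M2. ?y m (of_real w * of_real y) (of_real w * of_real x) (of_real x) (of_real y)) = 0"
        by (intro pole23_part)
      then show "(\<Sum>m\<in>M2. ?c m * of_real w ^ (?a m + ?b m) * of_real x ^ (?b m + ?s m)
          * of_real y ^ (?a m + ?d m) * of_real z ^ 0) = 0"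
        by (simp add: power_add power_mult_distrib mult_ac)
    qed
    then show False using contra[of "\<lambda>_. 1"] by simp
  next
    case 3
    have M12: "M1 = M2" using L 3 unfolding M2_def by auto
    have "?c m = 0" if "m \<in> M2" for m
    proof (rule monomials_independent4[OF M2(1) _ _ that])
      \<comment> \<open>Now \<open>v\<close> divides every surviving monomial, and the forbidden
        \<open>vab\<close> provides the normalization.\<close>
      have zero: "?a m = 0 \<or> ?b m = 0" if "m \<in> M2" for m
        using M2_std(1)[OF that] M2_uv[OF that] 3 by (auto simp: standard_monomial_def)
      show "inj_on (\<lambda>m. (?a m + ?d m, ?d m + ?b m, ?a m + ?s m, 0)) M2"
      proof (rule inj_onI)
        fix m n assume mn: "m \<in> M2" "n \<in> M2"
          "(?a m + ?d m, ?d m + ?b m, ?a m + ?s m, 0) = (?a n + ?d n, ?d n + ?b n, ?a n + ?s n, 0)"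
        then show "m = n"
          using exponents_unique[OF zero[OF mn(1)] zero[OF mn(2)], of "?d m" "?d n" "?s m" "?s n"]
          by (intro eqI) (simp_all add: M2_uv)
      qed
      fix w x y z :: real
      assume *: "1 < w" "w * w \<le> x" "x * x \<le> y"
      have "w < x" "x < y"
        using * by (smt (verit) mult_less_cancel_left1 mult_le_cancel_left1)+
      then have "complex_of_real x + of_real y \<noteq> 0" "complex_of_real x \<noteq> of_real y"
        "complex_of_real w \<noteq> 0" "complex_of_real x \<noteq> 0" "complex_of_real y \<noteq> 0" "complex_of_real w \<noteq> 1"
        using * of_real_eq_0_iff[of "x + y", where ?'a = complex] by simp_all
      then have "(\<Sum>m\<in>M1. ?y m (of_real w * of_real y) (of_real x) (of_real y) (of_real w * of_real x)
          * (of_real x * of_real y * (of_real w - 1) / (of_real x + of_real y)) ^ ?u m) = 0"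
        by (intro pole14_part)
      then show "(\<Sum>m\<in>M2. ?c m * of_real w ^ (?a m + ?d m) * of_real x ^ (?d m + ?b m)
          * of_real y ^ (?a m + ?s m) * of_real z ^ 0) = 0"
        unfolding M12 by (simp add: M2_uv 3 power_add power_mult_distrib mult_ac)
    qed
    then show False using contra[of "\<lambda>_. 1"] by simp
  next
    case 4
    \<comment> \<open>With both \<open>u\<close> and \<open>v\<close> present, \<open>vua\<close>
      and \<open>vub\<close> exclude \<open>a\<close> and \<open>b\<close> altogether; two
      parameters then suffice to separate the monomials.\<close>
    have ab0: "?a m = 0" "?b m = 0" if "m \<in> M2" for m
      using M2_std(1)[OF that] M2_uv[OF that] 4 by (auto simp: standard_monomial_def)
    \<comment> \<open>A second principal part, taken of the first one along
      \<open>b = t - c\<close>, where \<open>b + c = t\<close>. The conditions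
      \<open>t \<noteq> c\<close> and \<open>t \<noteq> 2 * c\<close> keep
      \<open>b \<noteq> 0\<close> and \<open>b \<noteq> c\<close>.\<close>
    have part: "(\<Sum>m\<in>M2. ?y m (s * c) (- c) c (- (s * c))) = 0"
      if "s \<noteq> 0" "c \<noteq> 0" "s \<noteq> 1" for s c :: complex
    proof -
      have "\<forall>\<^sub>F t in at (0::complex). t \<noteq> 0" by (simp add: eventually_at_filter)
      moreover have "\<forall>\<^sub>F t in at (0::complex). t \<noteq> c"
        using that by (intro tendsto_imp_eventually_ne[OF tendsto_ident_at]) auto
      moreover have "\<forall>\<^sub>F t in at (0::complex). t \<noteq> 2 * c"
        using that by (intro tendsto_imp_eventually_ne[OF tendsto_ident_at]) auto
      ultimately have ev: "\<forall>\<^sub>F t in at (0::complex). t \<noteq> 0 \<and>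
        (\<Sum>m\<in>M1. ?y m (s * c) (t - c) c (s * (t - c)) * ((t - c) * c * (s - 1) / t) ^ ?u m) = 0"
      proof eventually_elim
        case (elim t)
        then show ?case
          using pole14_part[of s "t - c" c] that by (simp add: algebra_simps)
      qed
      have "(\<Sum>m | m \<in> M1 \<and> ?u m = L. ?y m (s * c) (0 - c) c (s * (0 - c))) = 0"
      proof (rule principal_part_zero[OF M1(1) _ _ _ _ _ L ev])
        show "isCont (\<lambda>t. ?y m (s * c) (t - c) c (s * (t - c))) 0" for m
          by (intro continuous_intros)
        show "isCont (\<lambda>t. (t - c) * c * (s - 1)) 0" by (intro continuous_intros)
      qed (use that in simp_all)
      then show ?thesis by (simp add: M2_def)
    qed
    have "?c m * (-1) ^ ?d m = 0" if "m \<in> M2" for m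
    proof (rule monomials_independent4[OF M2(1) _ _ that])
      show "inj_on (\<lambda>m. (?d m, ?s m + ?d m, 0, 0)) M2"
        by (intro inj_onI eqI) (auto simp: M2_uv ab0)
      fix w x y z :: real
      assume *: "1 < w" "w * w \<le> x"
      have "w < x"
        using * by (smt (verit) mult_less_cancel_left1 mult_le_cancel_left1)
      then have "complex_of_real w \<noteq> 0" "complex_of_real x \<noteq> 0" "complex_of_real w \<noteq> 1"
        using * by simp_all
      then have "(\<Sum>m\<in>M2. ?y m (of_real w * of_real x) (- of_real x) (of_real x) (- (of_real w * of_real x))) = 0"
        by (intro part)
      moreover have "?y m (of_real w * of_real x) (- of_real x) (of_real x) (- (of_real w * of_real x)) = ?c m * (- 1) ^ ?d m * of_real w ^ ?d m
          * of_real x ^ (?s m + ?d m) * of_real y ^ 0 * of_real z ^ 0" if "m \<in> M2" for m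
        using ab0[OF that] power_minus[of "complex_of_real w * of_real x" "?d m"]
        by (simp add: power_add power_mult_distrib mult_ac)
      ultimately show "(\<Sum>m\<in>M2. ?c m * (- 1) ^ ?d m * of_real w ^ ?d m
          * of_real x ^ (?s m + ?d m) * of_real y ^ 0 * of_real z ^ 0) = 0"
        by (metis (mono_tags, lifting) sum.cong)
    qed
    then show False using contra[of "\<lambda>m. (-1) ^ ?d m"] by simp
  qed
qed

section \<open>Irreducibility and flags of subvarieties\<close>

lemma graph_point_in_cubic_cone:
  assumes "pole23 a b c d \<noteq> 0" "pole14 a b c d \<noteq> 0"
  shows "graph_point a b c d \<in> cubic_cone"
proof -
  define u where "u = graph_num a b c d / pole23 a b c d"
  define v where "v = graph_num a b c d / pole14 a b c d"
  have "u * (a * c - b * d) = a * c * d + b * c * d - a * b * c - a * b * d"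
    "v * (a * b - c * d) = a * c * d + b * c * d - a * b * c - a * b * d"
    using assms by (simp_all add: u_def v_def pole23_def pole14_def graph_num_def)
  moreover have "a * c - b * d \<noteq> 0" "a * b - c * d \<noteq> 0"
    using assms by (simp_all add: pole23_def pole14_def)
  ultimately show ?thesis
    unfolding graph_point_def u_def[symmetric] v_def[symmetric] cubic_cone_def
    by (simp; algebra)
qed

definition graph_cone :: "(complex ^ edge) set" where
  "graph_cone = {graph_point a b c d |a b c d. pole23 a b c d \<noteq> 0 \<and> pole14 a b c d \<noteq> 0}"

text \<open>On the cone \<open>f\<close> agrees with a standard form, and a standard form that
  vanishes on the graph is zero. In particular no component of the cone hides over the zeros of
  \<open>pole23\<close> or \<open>pole14\<close>.\<close>

lemma graph_cone_dense:
  assumes "\<forall>y\<in>graph_cone. mpoly_eval f y = 0" "x \<in> cubic_cone"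
  shows "mpoly_eval f x = 0"
proof -
  obtain s where s: "s \<in> standard_span UNIV" "\<forall>x\<in>cubic_cone. mpoly_eval f x = mpoly_eval s x"
    using standard_span_mpoly[of f UNIV] by auto
  have "s = 0"
  proof (rule standard_span_graph_zero)
    show "standard_monomial m" if "m \<in> Poly_Mapping.keys s" for m
      using standard_span_keys[OF s(1) that] by simp
    show "mpoly_eval s (graph_point a b c d) = 0"
      if "pole23 a b c d \<noteq> 0" "pole14 a b c d \<noteq> 0" for a b c d
      using graph_point_in_cubic_cone[OF that] s(2) assms(1) that
      unfolding graph_cone_def by force
  qed
  with s(2) assms(2) show ?thesis by simp
qed

lemma poly_graph_functions:
  "poly (pole23 A B C D) t = pole23 (poly A t) (poly B t) (poly C t) (poly D t)"
  "poly (pole14 A B C D) t = pole14 (poly A t) (poly B t) (poly C t) (poly D t)"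
  "poly (graph_num A B C D) t = graph_num (poly A t) (poly B t) (poly C t) (poly D t)"
  by (simp_all add: pole23_def pole14_def graph_num_def)

text \<open>A graph point scaled by \<open>r * P * Q\<close> has no denominators left, so membership
  becomes a polynomial identity, valid also where \<open>P\<close> or \<open>Q\<close> vanishes.
  This lets a segment of parameters cross the poles.\<close>

lemma cubic_cone_cleared_graph:
  fixes a b c d r :: complex
  defines "P \<equiv> pole23 a b c d" and "Q \<equiv> pole14 a b c d" and "R \<equiv> graph_num a b c d"
  shows "edge_vec (r * P * Q * a) (r * P * Q * b) (r * P * Q * c) (r * P * Q * d) (r * Q * R) (r * P * R)
    \<in> cubic_cone"
  unfolding cubic_cone_def P_def Q_def R_def pole23_def pole14_def graph_num_def
  by (simp; algebra)

lemma irreducible_variety_cubic_cone: "irreducible_variety cubic_cone"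
proof (rule irreducible_variety_curves[where W = graph_cone])
  show "zariski_closed cubic_cone" by (rule zariski_closed_cubic_cone)
  show "graph_cone \<subseteq> cubic_cone"
    using graph_point_in_cubic_cone by (auto simp: graph_cone_def)
  have "pole23 1 2 3 (4::complex) \<noteq> 0" "pole14 1 2 3 (4::complex) \<noteq> 0"
    by (simp_all add: pole23_def pole14_def)
  then have "graph_point 1 2 3 4 \<in> graph_cone"
    unfolding graph_cone_def by blast
  then show "graph_cone \<noteq> {}" by auto
  show "mpoly_eval f x = 0" if "\<forall>y\<in>graph_cone. mpoly_eval f y = 0" "x \<in> cubic_cone" for f x
    using graph_cone_dense that by blast
next
  fix p q assume "p \<in> graph_cone" "q \<in> graph_cone"
  then obtain a b c d a' b' c' d' where
    p: "p = graph_point a b c d" "pole23 a b c d \<noteq> 0" "pole14 a b c d \<noteq> 0" and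
    q: "q = graph_point a' b' c' d'" "pole23 a' b' c' d' \<noteq> 0" "pole14 a' b' c' d' \<noteq> 0"
    unfolding graph_cone_def by blast
  define A where "A = [:a, a' - a:]"
  define B where "B = [:b, b' - b:]"
  define C where "C = [:c, c' - c:]"
  define D where "D = [:d, d' - d:]"
  define P where "P = pole23 A B C D"
  define Q where "Q = pole14 A B C D"
  define R where "R = graph_num A B C D"
  \<comment> \<open>With these values the scaling factor is 1 at both ends, so the curve starts at
    \<open>p\<close> and ends at \<open>q\<close>; \<open>S\<close> interpolates linearly between
    them.\<close>
  define r where "r = 1 / (pole23 a b c d * pole14 a b c d)"
  define r' where "r' = 1 / (pole23 a' b' c' d' * pole14 a' b' c' d')"
  define S where "S = [:r, r' - r:]"
  note defs = A_def B_def C_def D_def P_def Q_def R_def S_def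
  define \<gamma> where "\<gamma> t = edge_vec (poly (S * P * Q * A) t) (poly (S * P * Q * B) t)
    (poly (S * P * Q * C) t) (poly (S * P * Q * D) t) (poly (S * Q * R) t) (poly (S * P * R) t)" for t
  have "\<exists>F. \<forall>t. \<gamma> t $ i = poly F t" for i
    by (cases i) (auto simp only: \<gamma>_def edge_vec_nth)
  moreover have "\<gamma> t \<in> cubic_cone" for t
    unfolding \<gamma>_def P_def Q_def R_def poly_mult poly_graph_functions
    by (rule cubic_cone_cleared_graph)
  moreover have "\<gamma> 0 = p"
    using p(2,3)
    unfolding \<gamma>_def p(1) graph_point_def P_def Q_def R_def poly_mult poly_graph_functions
    by (simp add: A_def B_def C_def D_def S_def r_def)
  moreover have "\<gamma> 1 = q"
    using q(2,3)
    unfolding \<gamma>_def q(1) graph_point_def P_def Q_def R_def poly_mult poly_graph_functions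
    by (simp add: A_def B_def C_def D_def S_def r'_def)
  ultimately show "\<exists>\<gamma>. (\<forall>i. \<exists>P. \<forall>t. \<gamma> t $ i = poly P t) \<and> (\<forall>t. \<gamma> t \<in> cubic_cone) \<and> \<gamma> 0 = p \<and> \<gamma> 1 = q"
    by blast
qed

section \<open>A flag of length four in the cone\<close>

definition coordinate_subspace :: "edge set \<Rightarrow> (complex ^ edge) set" where
  "coordinate_subspace J = {x. \<forall>g. g \<notin> J \<longrightarrow> x $ g = 0}"

lemma irreducible_variety_coordinate_subspace: "irreducible_variety (coordinate_subspace J)"
proof (rule irreducible_variety_curves[where W = "coordinate_subspace J"])
  have "coordinate_subspace J = {x. \<forall>p\<in>mpoly_var ` (- J). mpoly_eval p x = 0}"
    by (auto simp: coordinate_subspace_def)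
  then show "zariski_closed (coordinate_subspace J)"
    unfolding zariski_closed_def by blast
  have "0 \<in> coordinate_subspace J" by (simp add: coordinate_subspace_def)
  then show "coordinate_subspace J \<noteq> {}" by blast
next
  fix p q assume pq: "p \<in> coordinate_subspace J" "q \<in> coordinate_subspace J"
  define \<gamma> where "\<gamma> t = (\<chi> g. poly [:p $ g, q $ g - p $ g:] t)" for t
  have "\<exists>F. \<forall>t. \<gamma> t $ i = poly F t" for i
    unfolding \<gamma>_def vec_lambda_beta by blast
  moreover have "\<gamma> t \<in> coordinate_subspace J" for t
    using pq by (simp add: \<gamma>_def coordinate_subspace_def)
  moreover have "\<gamma> 0 = p" "\<gamma> 1 = q" by (simp_all add: \<gamma>_def vec_eq_iff)
  ultimately show "\<exists>\<gamma>. (\<forall>i. \<exists>P. \<forall>t. \<gamma> t $ i = poly P t) \<and> (\<forall>t. \<gamma> t \<in> coordinate_subspace J) \<and>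
      \<gamma> 0 = p \<and> \<gamma> 1 = q" by blast
qed auto

lemma coordinate_subspace_psubset:
  assumes "J \<subseteq> K" "g \<in> K" "g \<notin> J"
  shows "coordinate_subspace J \<subset> coordinate_subspace K"
proof
  show "coordinate_subspace J \<subseteq> coordinate_subspace K"
    using assms by (auto simp: coordinate_subspace_def)
  have "unit_vec g \<in> coordinate_subspace K - coordinate_subspace J"
    using assms by (auto simp: coordinate_subspace_def axis_def)
  then show "coordinate_subspace J \<noteq> coordinate_subspace K" by blast
qed

lemma variety_dim_cubic_cone_ge: "4 \<le> variety_dim cubic_cone"
proof -
  \<comment> \<open>No monomial of the four cubics involves only \<open>E13\<close>,
    \<open>E34\<close> and \<open>E14\<close>, so their coordinate 3-space lies in the cone.\<close>
  define Z where "Z i = (if i = 0 then coordinate_subspace {} else if i = 1 then coordinate_subspace {E13}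
    else if i = 2 then coordinate_subspace {E13, E34} else if i = 3 then coordinate_subspace {E13, E34, E14}
    else cubic_cone)" for i :: nat
  have Z3: "coordinate_subspace {E13, E34, E14} \<subset> cubic_cone"
  proof
    show "coordinate_subspace {E13, E34, E14} \<subseteq> cubic_cone"
      by (auto simp: coordinate_subspace_def cubic_cone_def)
    have "unit_vec E12 \<in> cubic_cone - coordinate_subspace {E13, E34, E14}"
      by (auto simp: coordinate_subspace_def cubic_cone_def axis_def)
    then show "coordinate_subspace {E13, E34, E14} \<noteq> cubic_cone" by blast
  qed
  have "irreducible_variety (Z i)" for i
    by (simp add: Z_def irreducible_variety_coordinate_subspace irreducible_variety_cubic_cone)
  moreover have mono: "Z i \<subset> Z (Suc i)" if "i < 4" for i
  proof -
    have "i \<in> {0, 1, 2, 3}" using that by auto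
    then show ?thesis
      using Z3 by (elim insertE emptyE) (simp_all add: Z_def coordinate_subspace_psubset[of _ _ E13]
        coordinate_subspace_psubset[of _ _ E34] coordinate_subspace_psubset[of _ _ E14])
  qed
  moreover have "Z i \<subseteq> cubic_cone" if "i \<le> 4" for i
    using that
  proof (induction rule: inc_induct)
    case base
    then show ?case by (simp add: Z_def)
  next
    case (step n)
    then show ?case using mono[of n] by simp
  qed
  ultimately have "4 \<in> {n. \<exists>Z. (\<forall>i\<le>n. irreducible_variety (Z i) \<and> Z i \<subseteq> cubic_cone) \<and> (\<forall>i<n. Z i \<subset> Z (Suc i))}"
    by blast
  then have "enat 4 \<le> variety_dim cubic_cone"
    unfolding variety_dim_def by (rule SUP_upper)
  then show ?thesis by (simp add: numeral_eq_enat)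
qed

section \<open>Hilbert function and dimension\<close>

definition exponent_map :: "nat \<Rightarrow> nat \<Rightarrow> nat \<Rightarrow> nat \<Rightarrow> nat \<Rightarrow> nat \<Rightarrow> edge \<Rightarrow>\<^sub>0 nat" where
  "exponent_map a b c d u v = Abs_poly_mapping
     (\<lambda>g. case g of E12 \<Rightarrow> a | E13 \<Rightarrow> b | E24 \<Rightarrow> c | E34 \<Rightarrow> d | E23 \<Rightarrow> u | E14 \<Rightarrow> v)"

lemma lookup_exponent_map [simp]:
  "Poly_Mapping.lookup (exponent_map a b c d u v) E12 = a"
  "Poly_Mapping.lookup (exponent_map a b c d u v) E13 = b"
  "Poly_Mapping.lookup (exponent_map a b c d u v) E24 = c"
  "Poly_Mapping.lookup (exponent_map a b c d u v) E34 = d"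
  "Poly_Mapping.lookup (exponent_map a b c d u v) E23 = u"
  "Poly_Mapping.lookup (exponent_map a b c d u v) E14 = v"
  by (simp_all add: exponent_map_def)

lemma exponent_map_lookup:
  "exponent_map (Poly_Mapping.lookup m E12) (Poly_Mapping.lookup m E13) (Poly_Mapping.lookup m E24)
     (Poly_Mapping.lookup m E34) (Poly_Mapping.lookup m E23) (Poly_Mapping.lookup m E14) = m"
proof (rule poly_mapping_eqI)
  show "Poly_Mapping.lookup (exponent_map (Poly_Mapping.lookup m E12) (Poly_Mapping.lookup m E13)
    (Poly_Mapping.lookup m E24) (Poly_Mapping.lookup m E34) (Poly_Mapping.lookup m E23)
    (Poly_Mapping.lookup m E14)) g = Poly_Mapping.lookup m g" for g
    by (cases g) simp_all
qed

lemma exponent_map_eqI: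
  assumes "Poly_Mapping.lookup m E12 = a" "Poly_Mapping.lookup m E13 = b" "Poly_Mapping.lookup m E24 = c"
    "Poly_Mapping.lookup m E34 = d" "Poly_Mapping.lookup m E23 = u" "Poly_Mapping.lookup m E14 = v"
  shows "exponent_map a b c d u v = m"
  using exponent_map_lookup[of m] assms by simp

lemma monomial_degree_edge:
  "monomial_degree m = Poly_Mapping.lookup m E12 + Poly_Mapping.lookup m E13 + Poly_Mapping.lookup m E23
     + Poly_Mapping.lookup m E14 + Poly_Mapping.lookup m E24 + Poly_Mapping.lookup m E34"
  for m :: "edge \<Rightarrow>\<^sub>0 nat"
  by (simp add: monomial_degree_def sum_edge)

text \<open>The number \<open>k\<close> is the degree of the fixed monomial of a Stanley summand;
  \<open>w\<close>, \<open>x\<close>, \<open>y\<close>, \<open>z\<close> are its free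
  exponents.\<close>

definition compositions4 :: "nat \<Rightarrow> nat \<Rightarrow> (nat \<times> nat \<times> nat \<times> nat) set" where
  "compositions4 k n = {(w, x, y, z). w + x + y + z + k = n}"

lemma card_compositions4:
  "card (compositions4 k n) = (if k \<le> n then (n - k + 3) choose 3 else 0)"
proof (cases "k \<le> n")
  case True
  have "bij_betw (\<lambda>(w, x, y, z). [w, x, y, z]) (compositions4 k n) {l :: nat list. length l = 4 \<and> sum_list l = n - k}"
    by (rule bij_betw_byWitness[where f' = "\<lambda>l. (l ! 0, l ! 1, l ! 2, l ! 3)"])
      (use True in \<open>auto simp: compositions4_def length_Suc_conv numeral_eq_Suc\<close>)
  then have "card (compositions4 k n) = (n - k + 4 - 1) choose (n - k)"
    using card_length_sum_list[of 4 "n - k"] bij_betw_same_card by force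
  also have "\<dots> = (n - k + 3) choose 3"
    using binomial_symmetric[of "n - k" "n - k + 3"] by (simp add: add.commute[of 3])
  finally show ?thesis using True by simp
next
  case False
  then have "compositions4 k n = {}" by (auto simp: compositions4_def)
  with False show ?thesis by simp
qed

lemma finite_compositions4: "finite (compositions4 k n)"
proof -
  have "compositions4 k n \<subseteq> {..n} \<times> {..n} \<times> {..n} \<times> {..n}" by (auto simp: compositions4_def)
  then show ?thesis by (rule finite_subset) auto
qed

text \<open>A Stanley decomposition of the standard monomials, refining the three squarefree conditions
  into six families with four free exponents each.\<close>

lemma card_standard_monomials:
  "finite {m. standard_monomial m \<and> monomial_degree m = n}"
  "card {m. standard_monomial m \<and> monomial_degree m = n} =
     card (compositions4 0 n) + 2 * card (compositions4 1 n) + 3 * card (compositions4 2 n)"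
proof -
  let ?S = "{m. standard_monomial m \<and> monomial_degree m = n}"
  let ?a = "\<lambda>m. Poly_Mapping.lookup m E12" and ?b = "\<lambda>m. Poly_Mapping.lookup m E13"
  let ?c = "\<lambda>m. Poly_Mapping.lookup m E24" and ?d = "\<lambda>m. Poly_Mapping.lookup m E34"
  let ?u = "\<lambda>m. Poly_Mapping.lookup m E23" and ?v = "\<lambda>m. Poly_Mapping.lookup m E14"
  \<comment> \<open>Which of \<open>u\<close> and \<open>v\<close> occur decides the conditions that
    remain. With \<open>u\<close> alone it is \<open>ac\<close>, split into \<open>c = 0\<close> and
    \<open>c > 0\<close>, \<open>a = 0\<close>; with \<open>v\<close> alone it is \<open>ab\<close>,
    split likewise; with both, \<open>a = b = 0\<close>.\<close>
  define S1 where "S1 = {m \<in> ?S. ?u m = 0 \<and> ?v m = 0}"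
  define S2 where "S2 = {m \<in> ?S. ?u m > 0 \<and> ?v m = 0 \<and> ?c m = 0}"
  define S3 where "S3 = {m \<in> ?S. ?u m > 0 \<and> ?v m = 0 \<and> ?c m > 0}"
  define S4 where "S4 = {m \<in> ?S. ?u m = 0 \<and> ?v m > 0 \<and> ?b m = 0}"
  define S5 where "S5 = {m \<in> ?S. ?u m = 0 \<and> ?v m > 0 \<and> ?b m > 0}"
  define S6 where "S6 = {m \<in> ?S. ?u m > 0 \<and> ?v m > 0}"
  note defs = compositions4_def standard_monomial_def monomial_degree_edge
  have S1: "bij_betw (\<lambda>(w, x, y, z). exponent_map w x y z 0 0) (compositions4 0 n) S1"
    by (rule bij_betw_byWitness[where f' = "\<lambda>m. (?a m, ?b m, ?c m, ?d m)"])
      (auto simp: S1_def defs intro!: exponent_map_eqI)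
  have S2: "bij_betw (\<lambda>(w, x, y, z). exponent_map w x 0 y (Suc z) 0) (compositions4 1 n) S2"
    by (rule bij_betw_byWitness[where f' = "\<lambda>m. (?a m, ?b m, ?d m, ?u m - 1)"])
      (auto simp: S2_def defs intro!: exponent_map_eqI)
  have S3: "bij_betw (\<lambda>(w, x, y, z). exponent_map 0 w (Suc x) y (Suc z) 0) (compositions4 2 n) S3"
    by (rule bij_betw_byWitness[where f' = "\<lambda>m. (?b m, ?c m - 1, ?d m, ?u m - 1)"])
      (auto simp: S3_def defs intro!: exponent_map_eqI)
  have S4: "bij_betw (\<lambda>(w, x, y, z). exponent_map w 0 x y 0 (Suc z)) (compositions4 1 n) S4"
    by (rule bij_betw_byWitness[where f' = "\<lambda>m. (?a m, ?c m, ?d m, ?v m - 1)"])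
      (auto simp: S4_def defs intro!: exponent_map_eqI)
  have S5: "bij_betw (\<lambda>(w, x, y, z). exponent_map 0 (Suc w) x y 0 (Suc z)) (compositions4 2 n) S5"
    by (rule bij_betw_byWitness[where f' = "\<lambda>m. (?b m - 1, ?c m, ?d m, ?v m - 1)"])
      (auto simp: S5_def defs intro!: exponent_map_eqI)
  have S6: "bij_betw (\<lambda>(w, x, y, z). exponent_map 0 0 w x (Suc y) (Suc z)) (compositions4 2 n) S6"
    by (rule bij_betw_byWitness[where f' = "\<lambda>m. (?c m, ?d m, ?u m - 1, ?v m - 1)"])
      (auto simp: S6_def defs intro!: exponent_map_eqI)
  note bij = S1 S2 S3 S4 S5 S6
  note fin = bij[THEN bij_betw_finite, simplified finite_compositions4, simplified]
  have S: "?S = S1 \<union> (S2 \<union> (S3 \<union> (S4 \<union> (S5 \<union> S6))))"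
    unfolding S1_def S2_def S3_def S4_def S5_def S6_def by auto
  show "finite ?S" unfolding S using fin by simp
  have "card ?S = card S1 + (card S2 + (card S3 + (card S4 + (card S5 + card S6))))"
    unfolding S
    by ((subst card_Un_disjoint; (simp add: fin)?),
        (force simp: S1_def S2_def S3_def S4_def S5_def S6_def)?)+
  then show "card ?S = card (compositions4 0 n) + 2 * card (compositions4 1 n) + 3 * card (compositions4 2 n)"
    using bij[THEN bij_betw_same_card] by simp
qed

lemma six_choose_three: "6 * ((k + 3) choose 3) = (k + 3) * (k + 2) * (k + 1)"
proof (induction k)
  case (Suc k)
  have "(Suc k + 3) choose 3 = ((k + 3) choose 3) + ((k + 3) choose 2)"
    using binomial_Suc_Suc[of "k + 3" 2] by (simp add: numeral_3_eq_3)
  moreover have "2 * ((k + 3) choose 2) = (k + 3) * (k + 2)"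
    using choose_two[of "k + 3"] by (simp add: even_mult_iff)
  ultimately show ?case using Suc by (simp add: algebra_simps)
qed simp

text \<open>The Hilbert series is \<open>(1 + 2 t + 3 t^2) / (1 - t)^4\<close>. From
  \<open>n = 2\<close> on all three kinds of summands contribute and the natural subtractions are
  exact; the factor 6 clears the binomial denominators.\<close>

lemma card_standard_monomials_eq:
  assumes "2 \<le> n"
  shows "card {m. standard_monomial m \<and> monomial_degree m = n} = n ^ 3 + 2 * n ^ 2 + 2 * n + 1"
proof -
  obtain k where n: "n = k + 2" using assms by (metis add.commute le_Suc_ex)
  have "6 * card {m. standard_monomial m \<and> monomial_degree m = n} =
      6 * (n ^ 3 + 2 * n ^ 2 + 2 * n + 1)"
    using six_choose_three[of k] six_choose_three[of "Suc k"] six_choose_three[of "Suc (Suc k)"]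
    unfolding card_standard_monomials card_compositions4 n
    by (simp add: algebra_simps power2_eq_square power3_eq_cube)
  then show ?thesis by simp
qed

text \<open>Only the exponent 4 matters: it is smaller than the number of independent functions that
  a chain with five strict inclusions would give.\<close>

lemma card_standard_monomials_le:
  "card {m. standard_monomial m \<and> monomial_degree m \<in> {..N}} \<le> 6 * (N + 3) ^ 4"
  "finite {m. standard_monomial m \<and> monomial_degree m \<in> {..N}}"
proof -
  have eq: "{m. standard_monomial m \<and> monomial_degree m \<in> {..N}} =
      (\<Union>n\<in>{..N}. {m. standard_monomial m \<and> monomial_degree m = n})" by auto
  show "finite {m. standard_monomial m \<and> monomial_degree m \<in> {..N}}"
    unfolding eq using card_standard_monomials(1) by blast
  have le: "card (compositions4 k n) \<le> (N + 3) ^ 3" if "n \<le> N" for k n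
  proof -
    have "((n - k + 3) choose 3) \<le> (n - k + 3) ^ 3" by (rule binomial_le_pow) simp
    also have "\<dots> \<le> (N + 3) ^ 3" using that by (intro power_mono) auto
    finally show ?thesis
      by (cases "k \<le> n") (simp_all only: card_compositions4 if_True if_False le0)
  qed
  have "card {m. standard_monomial m \<and> monomial_degree m \<in> {..N}} \<le>
      (\<Sum>n\<le>N. card {m. standard_monomial m \<and> monomial_degree m = n})"
    unfolding eq by (rule card_UN_le) simp
  also have "\<dots> \<le> (\<Sum>n\<le>N. 6 * (N + 3) ^ 3)"
  proof (rule sum_mono)
    fix n assume "n \<in> {..N}"
    then show "card {m. standard_monomial m \<and> monomial_degree m = n} \<le> 6 * (N + 3) ^ 3"
      using le[of n 0] le[of n 1] le[of n 2] unfolding card_standard_monomials(2) by simp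
  qed
  also have "\<dots> = 6 * ((N + 1) * (N + 3) ^ 3)" by simp
  also have "\<dots> \<le> 6 * ((N + 3) * (N + 3) ^ 3)" by (intro mult_left_mono mult_right_mono) auto
  finally show "card {m. standard_monomial m \<and> monomial_degree m \<in> {..N}} \<le> 6 * (N + 3) ^ 4"
    by (simp add: numeral_eq_Suc)
qed

lemma finite_monomials_of_degree: "finite {m :: edge \<Rightarrow>\<^sub>0 nat. monomial_degree m = n}"
proof (rule finite_subset)
  show "{m :: edge \<Rightarrow>\<^sub>0 nat. monomial_degree m = n} \<subseteq>
      (\<lambda>(a, b, c, d, u, v). exponent_map a b c d u v) ` ({..n} \<times> {..n} \<times> {..n} \<times> {..n} \<times> {..n} \<times> {..n})"
  proof
    fix m :: "edge \<Rightarrow>\<^sub>0 nat" assume "m \<in> {m. monomial_degree m = n}"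
    then show "m \<in> (\<lambda>(a, b, c, d, u, v). exponent_map a b c d u v) `
        ({..n} \<times> {..n} \<times> {..n} \<times> {..n} \<times> {..n} \<times> {..n})"
      by (intro image_eqI[where x = "(Poly_Mapping.lookup m E12, Poly_Mapping.lookup m E13, Poly_Mapping.lookup m E24,
        Poly_Mapping.lookup m E34, Poly_Mapping.lookup m E23, Poly_Mapping.lookup m E14)"])
        (auto simp: exponent_map_lookup monomial_degree_edge)
  qed
qed auto

section \<open>Hilbert function, Hilbert polynomial and degree\<close>

lemma scale_pm_single [simp]: "scale_pm c (Poly_Mapping.single m d) = Poly_Mapping.single m (c * d)"
  by (simp add: scale_pm_def mult_single)

lemma subspace_homogeneous_part: "pm.subspace (homogeneous_part n)"
proof (rule pm.subspaceI)
  fix c and p :: "'v::finite mpoly"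
  assume "p \<in> homogeneous_part n"
  then show "scale_pm c p \<in> homogeneous_part n"
    using keys_mult[of "Poly_Mapping.single 0 c" p]
    by (force simp: scale_pm_def homogeneous_part_def split: if_splits)
next
  fix p q :: "'v::finite mpoly"
  assume "p \<in> homogeneous_part n" "q \<in> homogeneous_part n"
  then show "p + q \<in> homogeneous_part n"
    using keys_add[of p q] by (force simp: homogeneous_part_def)
qed (simp add: homogeneous_part_def)

lemma homogeneous_part_subset_span:
  "homogeneous_part n \<subseteq> pm.span ((\<lambda>m. Poly_Mapping.single m 1) ` {m. monomial_degree m = n})"
proof
  fix p :: "'v::finite mpoly" assume p: "p \<in> homogeneous_part n"
  have "(\<Sum>m\<in>Poly_Mapping.keys p. scale_pm (Poly_Mapping.lookup p m) (Poly_Mapping.single m 1))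
      \<in> pm.span ((\<lambda>m. Poly_Mapping.single m 1) ` {m. monomial_degree m = n})"
    using p by (intro pm.span_sum pm.span_scale pm.span_base)
      (auto simp: homogeneous_part_def monomial_degree_def)
  then show "p \<in> pm.span ((\<lambda>m. Poly_Mapping.single m 1) ` {m. monomial_degree m = n})"
    by (simp flip: poly_mapping_sum_singles)
qed

lemma standard_span_subset_homogeneous_part: "standard_span {n} \<subseteq> homogeneous_part n"
  using standard_span_keys(2) by (fastforce simp: homogeneous_part_def monomial_degree_def)

lemma standard_span_vanishing:
  assumes "p \<in> standard_span D" "\<forall>x\<in>cubic_cone. mpoly_eval p x = 0"
  shows "p = 0"
proof (rule standard_span_graph_zero)
  show "standard_monomial m" if "m \<in> Poly_Mapping.keys p" for m
    using standard_span_keys[OF assms(1) that] by simp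
qed (use assms(2) graph_point_in_cubic_cone in blast)

lemma inj_single_one: "inj (\<lambda>m. Poly_Mapping.single m (1::complex))"
  by (rule injI) (metis lookup_single_eq lookup_single_not_eq one_neq_zero)

text \<open>The standard monomials of degree \<open>n\<close> form a quotient basis: rewriting makes
  them span modulo the vanishing ideal, and a standard form that vanishes on the cone is
  zero.\<close>

lemma hilbert_function_cubic_cone:
  "hilbert_function cubic_cone n = card {m. standard_monomial m \<and> monomial_degree m = n}"
proof -
  let ?mon = "\<lambda>m :: edge \<Rightarrow>\<^sub>0 nat. Poly_Mapping.single m (1::complex)"
  let ?Z = "homogeneous_part n :: edge mpoly set" and ?B = "homogeneous_part n \<inter> vanishing_ideal cubic_cone"
  let ?S = "?mon ` {m. standard_monomial m \<and> monomial_degree m = n}"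
  have S: "?S \<subseteq> standard_span {n}"
    unfolding standard_span_def by (rule subset_trans[OF _ pm.span_superset]) auto
  have "quotient_basis scale_pm ?Z ?B ?S"
    unfolding quotient_basis_def
  proof (intro conjI allI impI)
    show "?S \<subseteq> ?Z" using S standard_span_subset_homogeneous_part by blast
    show "?Z \<subseteq> {u + b |u b. u \<in> pm.span ?S \<and> b \<in> ?B}"
    proof
      fix p assume p: "p \<in> ?Z"
      then obtain s where s: "s \<in> standard_span {n}" "\<forall>x\<in>cubic_cone. mpoly_eval p x = mpoly_eval s x"
        using standard_span_mpoly[of p "{n}"] by (auto simp: homogeneous_part_def monomial_degree_def)
      have "p - s \<in> ?Z"
        using p s(1) standard_span_subset_homogeneous_part
        by (intro pm.subspace_diff subspace_homogeneous_part) auto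
      then have "p - s \<in> ?B" using s(2) by (simp add: vanishing_ideal_def)
      moreover have "s \<in> pm.span ?S" using s(1) by (simp add: standard_span_def)
      ultimately show "p \<in> {u + b |u b. u \<in> pm.span ?S \<and> b \<in> ?B}"
        by (intro CollectI exI[of _ s] exI[of _ "p - s"]) simp
    qed
  next
    fix F c assume F: "finite F \<and> F \<subseteq> ?S \<and> (\<Sum>s\<in>F. scale_pm (c s) s) \<in> ?B"
    then obtain M where M: "F = ?mon ` M" by (auto simp: subset_image_iff)
    have inj: "inj_on ?mon M" by (rule inj_on_subset[OF inj_single_one subset_UNIV])
    then have fin: "finite M" using F M finite_imageD by blast
    have "(\<Sum>s\<in>F. scale_pm (c s) s) \<in> standard_span {n}"
      using F S by (intro pm.subspace_sum pm.subspace_scale subspace_standard_span) auto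
    then have "(\<Sum>s\<in>F. scale_pm (c s) s) = 0"
      using F by (intro standard_span_vanishing) (auto simp: vanishing_ideal_def)
    then have sum0: "(\<Sum>m\<in>M. Poly_Mapping.single m (c (?mon m))) = 0"
      unfolding M sum.reindex[OF inj] by simp
    have "c (?mon m) = 0" if "m \<in> M" for m
    proof -
      have "0 = Poly_Mapping.lookup (\<Sum>m\<in>M. Poly_Mapping.single m (c (?mon m))) m" using sum0 by simp
      then show ?thesis
        using that fin by (simp add: lookup_sum lookup_single when_def sum.delta)
    qed
    then show "\<forall>s\<in>F. c s = 0" using M by auto
  qed
  moreover have B: "pm.subspace ?B" "?B \<subseteq> ?Z"
    by (auto intro: pm.subspace_inter subspace_homogeneous_part subspace_vanishing_ideal)
  moreover note fin = finite_imageI[OF finite_monomials_of_degree[of n], of ?mon]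
  ultimately have "card ?S = pm.dim ?Z - pm.dim ?B"
    by (intro pm.quotient_basis_card[OF subspace_homogeneous_part _ _ _ homogeneous_part_subset_span])
  also have "\<dots> = hilbert_function cubic_cone n"
    unfolding hilbert_function_def
    using pm.dim_quotient_eq[OF subspace_homogeneous_part B fin homogeneous_part_subset_span] by simp
  finally show ?thesis
    by (simp add: card_image[OF inj_on_subset[OF inj_single_one]])
qed

lemma hilbert_polynomial_unique:
  fixes P :: "rat poly"
  assumes "\<forall>\<^sub>F n in sequentially. poly P (of_nat n) = of_nat (hilbert_function V n)"
  shows "hilbert_polynomial V = P"
  unfolding hilbert_polynomial_def
proof (rule the_equality)
  show "\<forall>\<^sub>F n in sequentially. poly P (of_nat n) = of_nat (hilbert_function V n)" by fact
next
  fix Q :: "rat poly"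
  assume "\<forall>\<^sub>F n in sequentially. poly Q (of_nat n) = of_nat (hilbert_function V n)"
  with assms have "\<forall>\<^sub>F n in sequentially. poly (Q - P) (of_nat n) = 0"
    by eventually_elim simp
  then obtain N where N: "\<And>n. N \<le> n \<Longrightarrow> poly (Q - P) (of_nat n) = 0"
    by (auto simp: eventually_sequentially)
  have "of_nat ` {N..} \<subseteq> {x. poly (Q - P) x = 0}" using N by auto
  moreover have "infinite (of_nat ` {N..} :: rat set)"
    by (subst finite_image_iff) (auto intro: inj_onI simp: infinite_Ici)
  ultimately have "Q - P = 0" using poly_roots_finite finite_subset by blast
  then show "Q = P" by simp
qed

text \<open>The Hilbert polynomial is monic of degree 3, so the degree is \<open>3!\<close>; it is
  also the value \<open>1 + 2 + 3\<close> of the numerator of the Hilbert series at 1.\<close>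

lemma cone_degree_cubic_cone: "cone_degree cubic_cone = 6"
proof -
  have "\<forall>\<^sub>F n in sequentially. poly [:1, 2, 2, 1:] (of_nat n) = (of_nat (hilbert_function cubic_cone n) :: rat)"
    using eventually_ge_at_top[of 2]
    by eventually_elim
      (simp add: hilbert_function_cubic_cone card_standard_monomials_eq algebra_simps
        power2_eq_square power3_eq_cube)
  from hilbert_polynomial_unique[OF this] show ?thesis
    by (simp add: cone_degree_def numeral_eq_Suc)
qed

section \<open>Chains of irreducible closed sets\<close>

text \<open>The relation is indexed by \<open>A\<close> and not by the image, since different power
  products may have the same normal form; such a coincidence is itself a relation.\<close>

lemma (in vector_space) family_dependent:
  assumes "finite A" "finite T" "s ` A \<subseteq> span T" "card T < card A"
  obtains c where "\<exists>i\<in>A. c i \<noteq> 0" "(\<Sum>i\<in>A. scale (c i) (s i)) = 0"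
proof (cases "inj_on s A")
  case True
  then have "card T < card (s ` A)" using assms(4) by (simp add: card_image)
  then have "dependent (s ` A)"
    using independent_span_bound[OF \<open>finite T\<close> _ assms(3)] by force
  then obtain u where u: "\<exists>v\<in>s ` A. u v \<noteq> 0" "(\<Sum>v\<in>s ` A. scale (u v) v) = 0"
    using dependent_finite[of "s ` A"] \<open>finite A\<close> by auto
  then show ?thesis
    using that[of "u \<circ> s"] True by (auto simp: sum.reindex)
next
  case False
  then obtain i j where ij: "i \<in> A" "j \<in> A" "i \<noteq> j" "s i = s j" unfolding inj_on_def by blast
  let ?c = "\<lambda>k. if k = i then 1 else if k = j then - 1 else 0"
  have "(\<Sum>k\<in>A. scale (?c k) (s k)) = (\<Sum>k\<in>{i, j}. scale (?c k) (s k))"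
    using ij \<open>finite A\<close> by (intro sum.mono_neutral_right) auto
  also have "\<dots> = 0" using ij by simp
  finally show ?thesis using that[of ?c] ij(1) by force
qed

text \<open>A chain of \<open>k\<close> strict inclusions of irreducible closed sets yields \<open>k\<close> functions that are
  algebraically independent on its top member: \<open>F i\<close> vanishes on \<open>Z i\<close> but not on \<open>Z (Suc i)\<close>, so
  a relation on \<open>Z (Suc k)\<close> may be divided by powers of \<open>F k\<close> and then restricted to \<open>Z k\<close>. The
  list \<open>\<alpha>\<close> holds the exponents of \<open>F (k - 1)\<close>, ..., \<open>F 0\<close>, all at most \<open>n\<close>.\<close>

primrec power_product :: "(nat \<Rightarrow> 'v::finite mpoly) \<Rightarrow> nat list \<Rightarrow> 'v mpoly" where
  "power_product F [] = 1"
| "power_product F (j # \<alpha>) = F (length \<alpha>) ^ j * power_product F \<alpha>"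

abbreviation bounded_lists :: "nat \<Rightarrow> nat \<Rightarrow> nat list set" where
  "bounded_lists n k \<equiv> {\<alpha>. set \<alpha> \<subseteq> {..n} \<and> length \<alpha> = k}"

lemma sum_bounded_lists_Suc:
  "(\<Sum>\<alpha>\<in>bounded_lists n (Suc k). f \<alpha>) = (\<Sum>j\<le>n. \<Sum>\<alpha>\<in>bounded_lists n k. f (j # \<alpha>))"
proof -
  have "bounded_lists n (Suc k) = (\<lambda>(j, \<alpha>). j # \<alpha>) ` ({..n} \<times> bounded_lists n k)"
    by (auto simp: length_Suc_conv image_iff)
  then have "(\<Sum>\<alpha>\<in>bounded_lists n (Suc k). f \<alpha>) = (\<Sum>(j, \<alpha>)\<in>{..n} \<times> bounded_lists n k. f (j # \<alpha>))"
    by (simp add: sum.reindex inj_on_def case_prod_beta)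
  then show ?thesis by (simp add: sum.cartesian_product)
qed

text \<open>Once \<open>h i = 0\<close> for \<open>i < j\<close>, the sum is \<open>f ^ j\<close>
  times a cofactor. Irreducibility of \<open>Z\<close> removes \<open>f ^ j\<close>, and on
  \<open>Y\<close>, where \<open>f\<close> vanishes, the cofactor reduces to
  \<open>h j\<close>.\<close>

lemma expansion_coeffs_zero:
  assumes irr: "irreducible_variety Z" and f: "\<not> (\<forall>x\<in>Z. mpoly_eval f x = 0)"
    and sub: "Y \<subseteq> Z" and Y: "\<forall>x\<in>Y. mpoly_eval f x = 0"
    and zero: "\<And>j. j \<le> n \<Longrightarrow> \<forall>x\<in>Y. mpoly_eval (h j) x = 0 \<Longrightarrow> h j = 0"
    and sum: "\<forall>x\<in>Z. (\<Sum>j\<le>n. mpoly_eval (h j) x * mpoly_eval f x ^ j) = 0"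
  shows "\<forall>j\<le>n. h j = 0"
proof (intro allI impI)
  fix j assume "j \<le> n"
  then show "h j = 0"
  proof (induction j rule: less_induct)
    case (less j)
    let ?q = "\<Sum>i\<in>{j..n}. h i * f ^ (i - j)"
    have "mpoly_eval (f ^ j) x * mpoly_eval ?q x = 0" if "x \<in> Z" for x
    proof -
      have "(\<Sum>i\<le>n. mpoly_eval (h i) x * mpoly_eval f x ^ i) =
          (\<Sum>i\<in>{j..n}. mpoly_eval (h i) x * mpoly_eval f x ^ i)"
        using less by (intro sum.mono_neutral_right) auto
      also have "\<dots> = mpoly_eval (f ^ j) x * mpoly_eval ?q x"
        by (simp add: sum_distrib_left mult_ac flip: power_add)
      finally show ?thesis using sum that by simp
    qed
    then have "(\<forall>x\<in>Z. mpoly_eval (f ^ j) x = 0) \<or> (\<forall>x\<in>Z. mpoly_eval ?q x = 0)"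
      using irreducible_variety_mult[OF irr] by blast
    then have q: "\<forall>x\<in>Z. mpoly_eval ?q x = 0" using f by auto
    have "mpoly_eval (h j) x = 0" if "x \<in> Y" for x
    proof -
      have "mpoly_eval ?q x = (\<Sum>i\<in>{j..n}. if i = j then mpoly_eval (h i) x else 0)"
        unfolding mpoly_eval_sum using Y that by (intro sum.cong) (auto simp: power_0_left)
      then show ?thesis using q sub that \<open>j \<le> n\<close> by auto
    qed
    then show ?case using zero[OF \<open>j \<le> n\<close>] by blast
  qed
qed

lemma chain_independent:
  assumes "\<And>i. i \<le> k \<Longrightarrow> irreducible_variety (Z i)" "\<And>i. i < k \<Longrightarrow> Z i \<subset> Z (Suc i)"
    and "\<And>i x. i < k \<Longrightarrow> x \<in> Z i \<Longrightarrow> mpoly_eval (F i) x = 0"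
    and "\<And>i. i < k \<Longrightarrow> \<exists>x\<in>Z (Suc i). mpoly_eval (F i) x \<noteq> 0"
    and "\<forall>x\<in>Z k. mpoly_eval (\<Sum>\<alpha>\<in>bounded_lists n k. scale_pm (c \<alpha>) (power_product F \<alpha>)) x = 0"
  shows "\<forall>\<alpha>\<in>bounded_lists n k. c \<alpha> = 0"
  using assms
proof (induction k arbitrary: c)
  case 0
  have "bounded_lists n 0 = {[]}" by auto
  moreover have "Z 0 \<noteq> {}" using 0(1)[of 0] by (simp add: irreducible_variety_def)
  ultimately show ?case using 0(5) by auto
next
  case (Suc k)
  \<comment> \<open>\<open>h j\<close> is the coefficient of \<open>F k ^ j\<close>. It involves
    only \<open>F 0\<close>, ..., \<open>F (k - 1)\<close>, so the induction hypothesis on the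
    shorter chain applies to it.\<close>
  define h where "h j = (\<Sum>\<alpha>\<in>bounded_lists n k. scale_pm (c (j # \<alpha>)) (power_product F \<alpha>))" for j
  have IH: "\<forall>\<alpha>\<in>bounded_lists n k. c (j # \<alpha>) = 0" if "\<forall>x\<in>Z k. mpoly_eval (h j) x = 0" for j
    using Suc.IH[of "\<lambda>\<alpha>. c (j # \<alpha>)"] Suc.prems(1-4) that by (simp add: h_def)
  have "(\<Sum>j\<le>n. mpoly_eval (h j) x * mpoly_eval (F k) x ^ j) =
      mpoly_eval (\<Sum>\<alpha>\<in>bounded_lists n (Suc k). scale_pm (c \<alpha>) (power_product F \<alpha>)) x" for x
    by (simp add: sum_bounded_lists_Suc h_def sum_distrib_left mult_ac)
  then have "\<forall>x\<in>Z (Suc k). (\<Sum>j\<le>n. mpoly_eval (h j) x * mpoly_eval (F k) x ^ j) = 0"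
    using Suc.prems(5) by simp
  moreover have "h j = 0" if "\<forall>x\<in>Z k. mpoly_eval (h j) x = 0" for j
    using IH[OF that] by (simp add: h_def)
  ultimately have "\<forall>j\<le>n. h j = 0"
    using Suc.prems(1)[of "Suc k"] Suc.prems(2)[of k] Suc.prems(3)[of k] Suc.prems(4)[of k]
    by (intro expansion_coeffs_zero[where Z = "Z (Suc k)" and Y = "Z k" and f = "F k"]) auto
  then have "c (j # \<alpha>) = 0" if "j \<le> n" "\<alpha> \<in> bounded_lists n k" for j \<alpha>
    using IH[of j] that by simp
  then show ?case by (auto simp: length_Suc_conv)
qed

definition degree_bounded :: "nat \<Rightarrow> 'v::finite mpoly \<Rightarrow> bool" where
  "degree_bounded N p \<longleftrightarrow> (\<forall>m\<in>Poly_Mapping.keys p. monomial_degree m \<le> N)"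

lemma degree_bounded_exists: "\<exists>N. degree_bounded N p"
proof (intro exI)
  show "degree_bounded (\<Sum>m\<in>Poly_Mapping.keys p. monomial_degree m) p"
    unfolding degree_bounded_def by (auto intro: member_le_sum)
qed

lemma degree_bounded_mono: "degree_bounded M p \<Longrightarrow> M \<le> N \<Longrightarrow> degree_bounded N p"
  by (auto simp: degree_bounded_def)

lemma degree_bounded_1: "degree_bounded 0 1"
  by (simp add: degree_bounded_def)

lemma degree_bounded_mult:
  assumes "degree_bounded M p" "degree_bounded N q"
  shows "degree_bounded (M + N) (p * q)"
  using keys_mult[of p q] assms
  by (force simp: degree_bounded_def monomial_degree_add intro: add_mono)

lemma degree_bounded_power: "degree_bounded D p \<Longrightarrow> degree_bounded (j * D) (p ^ j)"
  by (induction j) (auto intro: degree_bounded_1 degree_bounded_mult)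

lemma degree_bounded_power_product:
  assumes "\<And>i. i < length \<alpha> \<Longrightarrow> degree_bounded D (F i)" "set \<alpha> \<subseteq> {..n}"
  shows "degree_bounded (length \<alpha> * n * D) (power_product F \<alpha>)"
  using assms
proof (induction \<alpha>)
  case Nil
  show ?case using degree_bounded_1 by simp
next
  case (Cons j \<alpha>)
  have "degree_bounded (n * D) (F (length \<alpha>) ^ j)"
    using Cons.prems by (intro degree_bounded_mono[OF degree_bounded_power[of D]]) auto
  moreover have "degree_bounded (length \<alpha> * n * D) (power_product F \<alpha>)" using Cons by simp
  ultimately show ?case
    using degree_bounded_mult by (fastforce simp: algebra_simps)
qed

text \<open>Five independent functions would yield \<open>(n + 1) ^ 5\<close> independent power
  products whose degrees grow linearly in \<open>n\<close>, more than the standard monomials of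
  those degrees can accommodate.\<close>

lemma no_chain_cubic_cone:
  assumes "\<And>i. i \<le> 5 \<Longrightarrow> irreducible_variety (Z i)" "\<And>i. i < 5 \<Longrightarrow> Z i \<subset> Z (Suc i)"
    and "Z 5 \<subseteq> cubic_cone"
  shows False
proof -
  have "\<exists>f. (\<forall>x\<in>Z i. mpoly_eval f x = 0) \<and> (\<exists>x\<in>Z (Suc i). mpoly_eval f x \<noteq> 0)" if "i < 5" for i
  proof -
    have "zariski_closed (Z i)" using assms(1)[of i] that by (simp add: irreducible_variety_def)
    then obtain P where P: "Z i = {x. \<forall>p\<in>P. mpoly_eval p x = 0}" unfolding zariski_closed_def by blast
    obtain x where x: "x \<in> Z (Suc i)" "x \<notin> Z i" using assms(2)[OF \<open>i < 5\<close>] by blast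
    then obtain p where "p \<in> P" "mpoly_eval p x \<noteq> 0" using P by blast
    with x P show ?thesis by blast
  qed
  then obtain F where F: "\<And>i x. i < 5 \<Longrightarrow> x \<in> Z i \<Longrightarrow> mpoly_eval (F i) x = 0"
    "\<And>i. i < 5 \<Longrightarrow> \<exists>x\<in>Z (Suc i). mpoly_eval (F i) x \<noteq> 0"
    by metis
  have "\<forall>i. \<exists>N. degree_bounded N (F i)" by (intro allI degree_bounded_exists)
  then obtain d where d: "\<And>i. degree_bounded (d i) (F i)" by metis
  define D where "D = (\<Sum>i<5. d i)"
  have D: "degree_bounded D (F i)" if "i < 5" for i
    unfolding D_def using that by (intro degree_bounded_mono[OF d]) (auto intro: member_le_sum)
  \<comment> \<open>Chosen so that \<open>6 * ((5 * D + 3) * (n + 1)) ^ 4\<close>, which bounds the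
    number of standard monomials of degree at most \<open>5 * n * D\<close>, equals
    \<open>n * (n + 1) ^ 4\<close>, just below \<open>(n + 1) ^ 5\<close>.\<close>
  define n where "n = 6 * (5 * D + 3) ^ 4"
  let ?N = "5 * n * D" and ?A = "bounded_lists n 5"
  have "\<forall>\<alpha>\<in>?A. \<exists>s. s \<in> standard_span {..?N} \<and>
    (\<forall>x\<in>cubic_cone. mpoly_eval (power_product F \<alpha>) x = mpoly_eval s x)"
  proof
    fix \<alpha> assume that: "\<alpha> \<in> ?A"
    have "degree_bounded ?N (power_product F \<alpha>)"
      using degree_bounded_power_product[of \<alpha> D F n] that D by auto
    then show "\<exists>s. s \<in> standard_span {..?N} \<and>
        (\<forall>x\<in>cubic_cone. mpoly_eval (power_product F \<alpha>) x = mpoly_eval s x)"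
      using standard_span_mpoly[of "power_product F \<alpha>" "{..?N}"] by (auto simp: degree_bounded_def)
  qed
  from bchoice[OF this] obtain s where s: "\<And>\<alpha>. \<alpha> \<in> ?A \<Longrightarrow> s \<alpha> \<in> standard_span {..?N}"
    "\<And>\<alpha> x. \<alpha> \<in> ?A \<Longrightarrow> x \<in> cubic_cone \<Longrightarrow> mpoly_eval (power_product F \<alpha>) x = mpoly_eval (s \<alpha>) x"
    by blast
  let ?T = "(\<lambda>m. Poly_Mapping.single m (1::complex)) ` {m. standard_monomial m \<and> monomial_degree m \<in> {..?N}}"
  have "card ?T \<le> 6 * (?N + 3) ^ 4"
    using card_standard_monomials_le[of ?N] card_image_le le_trans by blast
  also have "\<dots> \<le> 6 * ((5 * D + 3) * (n + 1)) ^ 4"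
    by (intro mult_left_mono power_mono) (simp_all add: algebra_simps)
  also have "\<dots> = n * (n + 1) ^ 4" by (simp only: n_def power_mult_distrib mult.assoc)
  also have "\<dots> < (n + 1) * (n + 1) ^ 4" by (intro mult_strict_right_mono) simp_all
  also have "\<dots> = (n + 1) ^ 5" using power_Suc[of "n + 1" 4] by simp
  also have "\<dots> = card ?A" by (simp add: card_lists_length_eq)
  finally have card: "card ?T < card ?A" .
  have "finite ?A" by (rule finite_lists_length_eq) simp
  moreover have "finite ?T" using card_standard_monomials_le(2) by blast
  moreover have "s ` ?A \<subseteq> pm.span ?T" using s(1) by (auto simp: standard_span_def)
  ultimately obtain c where c: "\<exists>\<alpha>\<in>?A. c \<alpha> \<noteq> 0" "(\<Sum>\<alpha>\<in>?A. scale_pm (c \<alpha>) (s \<alpha>)) = 0"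
    using card by (rule pm.family_dependent)
  have "mpoly_eval (\<Sum>\<alpha>\<in>?A. scale_pm (c \<alpha>) (power_product F \<alpha>)) x = 0" if "x \<in> Z 5" for x
  proof -
    have "mpoly_eval (\<Sum>\<alpha>\<in>?A. scale_pm (c \<alpha>) (power_product F \<alpha>)) x =
        mpoly_eval (\<Sum>\<alpha>\<in>?A. scale_pm (c \<alpha>) (s \<alpha>)) x"
      using assms(3) that s(2) unfolding mpoly_eval_sum mpoly_eval_scale by (intro sum.cong) auto
    then show ?thesis by (simp add: c(2))
  qed
  then have "\<forall>\<alpha>\<in>?A. c \<alpha> = 0"
    using assms(1,2) F by (intro chain_independent[where Z = Z and F = F]) auto
  with c(1) show False by blast
qed

lemma variety_dim_cubic_cone: "variety_dim cubic_cone = 4"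
proof (rule antisym)
  show "variety_dim cubic_cone \<le> 4"
    unfolding variety_dim_def
  proof (rule SUP_least)
    fix n assume "n \<in> {n. \<exists>Z. (\<forall>i\<le>n. irreducible_variety (Z i) \<and> Z i \<subseteq> cubic_cone) \<and> (\<forall>i<n. Z i \<subset> Z (Suc i))}"
    then obtain Z where Z: "\<And>i. i \<le> n \<Longrightarrow> irreducible_variety (Z i) \<and> Z i \<subseteq> cubic_cone"
      "\<And>i. i < n \<Longrightarrow> Z i \<subset> Z (Suc i)" by blast
    have "n \<le> 4"
    proof (rule ccontr)
      assume "\<not> n \<le> 4"
      with Z show False by (intro no_chain_cubic_cone[of Z]) auto
    qed
    then show "enat n \<le> 4" by (simp add: numeral_eq_enat)
  qed
qed (rule variety_dim_cubic_cone_ge)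

section \<open>Products of degree one classes\<close>

text \<open>The degree \<open>2\<close> part of the algebra has a basis of seven products, one for each of the following
  lists: the list holds the products \<open>e\<^sub>g e\<^sub>h\<close> that are equal to the basis element.\<close>

definition product_classes :: "(edge \<times> edge) list list" where
  "product_classes =
     [[(E12, E13), (E12, E23), (E13, E23)], [(E12, E14), (E12, E24), (E14, E24)],
      [(E13, E14), (E13, E34), (E14, E34)], [(E23, E24), (E23, E34), (E24, E34)],
      [(E12, E34)], [(E13, E24)], [(E23, E14)]]"

definition class_coeff :: "(edge \<times> edge) list \<Rightarrow> edge \<Rightarrow> edge \<Rightarrow> complex" where
  "class_coeff L g h = (if (g, h) \<in> set L then 1 else if (h, g) \<in> set L then - 1 else 0)"

definition free_product_coeff :: "(edge \<times> edge) list \<Rightarrow> edge free_algebra \<Rightarrow> complex" where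
  "free_product_coeff L p =
     (\<Sum>g\<in>UNIV. \<Sum>h\<in>UNIV. class_coeff L g h * Poly_Mapping.lookup p (Word [g, h]))"

lemma free_product_coeff_add: "free_product_coeff L (p + q) = free_product_coeff L p + free_product_coeff L q"
  by (simp add: free_product_coeff_def lookup_add algebra_simps sum.distrib)

lemma free_product_coeff_diff: "free_product_coeff L (p - q) = free_product_coeff L p - free_product_coeff L q"
  by (simp add: free_product_coeff_def lookup_minus algebra_simps sum_subtractf)

lemma free_product_coeff_sum: "free_product_coeff L (\<Sum>i\<in>I. f i) = (\<Sum>i\<in>I. free_product_coeff L (f i))"
proof (induction I rule: infinite_finite_induct)
  case (insert i I)
  then show ?case by (simp add: free_product_coeff_add)
qed (simp_all add: free_product_coeff_def)

lemma free_product_coeff_single: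
  "free_product_coeff L (Poly_Mapping.single (Word [g, h]) c) = class_coeff L g h * c"
proof -
  have "free_product_coeff L (Poly_Mapping.single (Word [g, h]) c) =
      (\<Sum>g'\<in>UNIV. \<Sum>h'\<in>UNIV. if h' = h then if g' = g then class_coeff L g h * c else 0 else 0)"
    unfolding free_product_coeff_def by (intro sum.cong) (auto simp: lookup_single when_def)
  then show ?thesis by simp
qed

lemma free_gen_mult: "free_gen g * free_gen h = Poly_Mapping.single (Word [g, h]) 1"
  by (simp add: free_gen_def mult_single plus_word_def)

text \<open>Multiplication by an element without constant term raises the length of all words.\<close>

lemma lookup_scalar_part_mult:
  fixes p a :: "edge free_algebra"
  assumes "\<And>w. w \<in> Poly_Mapping.keys p \<Longrightarrow> 2 \<le> length (letters w)"
  shows "Poly_Mapping.lookup (a * p) (Word [g, h]) = Poly_Mapping.lookup a 0 * Poly_Mapping.lookup p (Word [g, h])"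
    and "Poly_Mapping.lookup (p * a) (Word [g, h]) = Poly_Mapping.lookup p (Word [g, h]) * Poly_Mapping.lookup a 0"
proof -
  define b where "b = a - Poly_Mapping.single 0 (Poly_Mapping.lookup a 0)"
  have b: "1 \<le> length (letters w)" if "w \<in> Poly_Mapping.keys b" for w
  proof -
    have "w \<noteq> 0" using that by (auto simp: b_def in_keys_iff lookup_minus)
    then show ?thesis by (cases w) (auto simp: zero_word_def Suc_le_eq)
  qed
  have a: "a = Poly_Mapping.single 0 (Poly_Mapping.lookup a 0) + b" by (simp add: b_def)
  have len: "length (letters w) + length (letters w') = 2" if "Word [g, h] = w + w'" for w w' :: "edge word"
    using arg_cong[OF that, of "length \<circ> letters"] by (simp add: plus_word_def)
  have "Word [g, h] \<notin> Poly_Mapping.keys (b * p)"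
  proof
    assume "Word [g, h] \<in> Poly_Mapping.keys (b * p)"
    then obtain w w' where "Word [g, h] = w + w'" "w \<in> Poly_Mapping.keys b" "w' \<in> Poly_Mapping.keys p"
      using keys_mult[of b p] by blast
    then show False using len[of w w'] b[of w] assms[of w'] by simp
  qed
  moreover have "Word [g, h] \<notin> Poly_Mapping.keys (p * b)"
  proof
    assume "Word [g, h] \<in> Poly_Mapping.keys (p * b)"
    then obtain w w' where "Word [g, h] = w + w'" "w \<in> Poly_Mapping.keys p" "w' \<in> Poly_Mapping.keys b"
      using keys_mult[of p b] by blast
    then show False using len[of w w'] b[of w'] assms[of w] by simp
  qed
  moreover have "Poly_Mapping.single 0 c * p = Poly_Mapping.map ((*) c) p" for c
    by (simp add: mult_map_scale_conv_mult)
  moreover have "p * Poly_Mapping.single 0 c = Poly_Mapping.single 0 c * p" for c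
    by (subst (1 2) poly_mapping_sum_singles)
      (simp add: sum_distrib_left sum_distrib_right mult_single mult.commute)
  ultimately show "Poly_Mapping.lookup (a * p) (Word [g, h]) = Poly_Mapping.lookup a 0 * Poly_Mapping.lookup p (Word [g, h])"
    "Poly_Mapping.lookup (p * a) (Word [g, h]) = Poly_Mapping.lookup p (Word [g, h]) * Poly_Mapping.lookup a 0"
    by (subst a, simp add: distrib_left distrib_right lookup_add in_keys_iff Poly_Mapping.map.rep_eq when_def)+
qed

lemma class_coeff_antisym:
  assumes "L \<in> set product_classes"
  shows "class_coeff L g h = - class_coeff L h g"
proof -
  have "\<forall>L\<in>set product_classes. \<forall>(g, h)\<in>set L. (h, g) \<notin> set L"
    by (simp add: product_classes_def)
  then show ?thesis using assms by (auto simp: class_coeff_def)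
qed

lemma class_coeff_triple:
  assumes "L \<in> set product_classes"
    and "(i, j, k) \<in> {(E12, E13, E23), (E12, E14, E24), (E13, E14, E34), (E23, E24, E34)}"
  shows "class_coeff L i j = class_coeff L i k" "class_coeff L i k = class_coeff L j k"
proof -
  have "\<forall>L\<in>set product_classes.
      \<forall>(i, j, k)\<in>{(E12, E13, E23), (E12, E14, E24), (E13, E14, E34), (E23, E24, E34)}.
        class_coeff L i j = class_coeff L i k \<and> class_coeff L i k = class_coeff L j k"
    by (simp add: product_classes_def class_coeff_def)
  then show "class_coeff L i j = class_coeff L i k" "class_coeff L i k = class_coeff L j k"
    using assms by fast+
qed

lemma vP4_relations_cases:
  assumes "r \<in> vP4_relations"
  obtains (comm) g h where "r = free_gen g * free_gen h + free_gen h * free_gen g"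
    | (triple) i j k where "(i, j, k) \<in> {(E12, E13, E23), (E12, E14, E24), (E13, E14, E34), (E23, E24, E34)}"
        "r = free_gen i * free_gen j - free_gen i * free_gen k \<or>
         r = free_gen i * free_gen k - free_gen j * free_gen k"
proof -
  consider g h where "r = free_gen g * free_gen h + free_gen h * free_gen g"
    | t where "t \<in> {(E12, E13, E23), (E12, E14, E24), (E13, E14, E34), (E23, E24, E34)}"
      "r \<in> (case t of (i, j, k) \<Rightarrow>
        {free_gen i * (free_gen j - free_gen k), (free_gen i - free_gen j) * free_gen k})"
    using assms unfolding vP4_relations_def by blast
  then show thesis
  proof cases
    case 1
    then show thesis by (rule comm)
  next
    case 2
    obtain i j k where "t = (i, j, k)" by (cases t)
    with 2 show thesis
      by (intro triple[of i j k]) (simp_all add: right_diff_distrib left_diff_distrib)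
  qed
qed

text \<open>The seven functionals thus descend to the quotient, which shows that the seven products
  are independent there. In a multiple of \<open>p\<close> only the constant term of the other
  factor reaches words of length two, since \<open>p\<close> has no shorter words.\<close>

lemma free_product_coeff_ideal:
  assumes "p \<in> two_sided_ideal vP4_relations" and L: "L \<in> set product_classes"
  shows "free_product_coeff L p = 0"
  using assms(1)
proof induction
  case zero
  show ?case by (simp add: free_product_coeff_def)
next
  case (base r)
  then show ?case
  proof (cases rule: vP4_relations_cases)
    case (comm g h)
    then show ?thesis
      using class_coeff_antisym[OF L, of g h]
      by (simp add: free_product_coeff_add free_gen_mult free_product_coeff_single)
  next
    case (triple i j k)
    then show ?thesis
      using class_coeff_triple[OF L triple(1)]
      by (auto simp: free_product_coeff_diff free_gen_mult free_product_coeff_single)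
  qed
next
  case (add p q)
  then show ?case by (simp add: free_product_coeff_add)
next
  case (left p a)
  have "free_product_coeff L (a * p) = Poly_Mapping.lookup a 0 * free_product_coeff L p"
    using lookup_scalar_part_mult(1)[OF keys_two_sided_ideal_vP4[OF left(1)]]
    by (simp add: free_product_coeff_def sum_distrib_left mult_ac)
  with left show ?case by simp
next
  case (right p a)
  have "free_product_coeff L (p * a) = Poly_Mapping.lookup a 0 * free_product_coeff L p"
    using lookup_scalar_part_mult(2)[OF keys_two_sided_ideal_vP4[OF right(1)]]
    by (simp add: free_product_coeff_def sum_distrib_left mult_ac)
  with right show ?case by simp
qed

definition cup_zero :: "complex ^ edge \<Rightarrow> complex ^ edge \<Rightarrow> bool" where
  "cup_zero x y \<longleftrightarrow> (\<forall>L\<in>set product_classes. (\<Sum>(g, h)\<leftarrow>L. x $ g * y $ h - x $ h * y $ g) = 0)"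

lemma class_coeff_sum:
  assumes "L \<in> set product_classes"
  shows "(\<Sum>g\<in>UNIV. \<Sum>h\<in>UNIV. class_coeff L g h * (x $ g * y $ h)) =
    (\<Sum>(g, h)\<leftarrow>L. x $ g * y $ h - x $ h * y $ g)"
proof -
  have "\<forall>L\<in>set product_classes. (\<Sum>g\<in>UNIV. \<Sum>h\<in>UNIV. class_coeff L g h * (x $ g * y $ h)) =
      (\<Sum>(g, h)\<leftarrow>L. x $ g * y $ h - x $ h * y $ g)"
    by (simp add: product_classes_def class_coeff_def sum_edge)
  with assms show ?thesis by blast
qed

lemma vP4_gen_mult: "vP4_gen g * vP4_gen h = abs_vP4_cohomology (free_gen g * free_gen h)"
  by (simp add: vP4_gen_def times_vP4_cohomology.abs_eq)

lemma vP4_gen_relations: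
  "vP4_gen g * vP4_gen h = - (vP4_gen h * vP4_gen g)"
  "(i, j, k) \<in> {(E12, E13, E23), (E12, E14, E24), (E13, E14, E34), (E23, E24, E34)} \<Longrightarrow>
     vP4_gen i * vP4_gen j = vP4_gen i * vP4_gen k \<and> vP4_gen i * vP4_gen k = vP4_gen j * vP4_gen k"
proof -
  have "free_gen g * free_gen h + free_gen h * free_gen g \<in> two_sided_ideal vP4_relations"
    by (rule two_sided_ideal.base) (auto simp: vP4_relations_def)
  then show "vP4_gen g * vP4_gen h = - (vP4_gen h * vP4_gen g)"
    by (simp add: vP4_gen_mult uminus_vP4_cohomology.abs_eq vP4_cohomology.abs_eq_iff)
next
  assume ijk: "(i, j, k) \<in> {(E12, E13, E23), (E12, E14, E24), (E13, E14, E34), (E23, E24, E34)}"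
  have "free_gen i * (free_gen j - free_gen k) \<in> two_sided_ideal vP4_relations"
    "(free_gen i - free_gen j) * free_gen k \<in> two_sided_ideal vP4_relations"
    using ijk by (intro two_sided_ideal.base; force simp: vP4_relations_def)+
  then show "vP4_gen i * vP4_gen j = vP4_gen i * vP4_gen k \<and> vP4_gen i * vP4_gen k = vP4_gen j * vP4_gen k"
    by (simp add: vP4_gen_mult vP4_cohomology.abs_eq_iff algebra_simps)
qed

text \<open>Anticommutativity gives only twice the square; over the complex numbers the factor 2 can
  be cancelled.\<close>

lemma vP4_gen_square: "vP4_gen g * vP4_gen g = 0"
proof -
  have "vP4_gen g * vP4_gen g + vP4_gen g * vP4_gen g = 0"
    using vP4_gen_relations(1)[of g g] by (simp add: eq_neg_iff_add_eq_0)
  then have "scale_vP4 2 (vP4_gen g * vP4_gen g) = 0"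
    using vP4.scale_left_distrib[of 1 1 "vP4_gen g * vP4_gen g"] by simp
  then show ?thesis by (simp only: vP4.scale_eq_0_iff) simp
qed

lemma scale_vP4_mult:
  "scale_vP4 c p * q = scale_vP4 c (p * q)" "p * scale_vP4 c q = scale_vP4 c (p * q)"
proof -
  have comm: "P * Poly_Mapping.single 0 c = Poly_Mapping.single 0 c * P" for P :: "edge free_algebra"
    by (subst (1 2) poly_mapping_sum_singles)
      (simp add: sum_distrib_left sum_distrib_right mult_single mult.commute)
  show "scale_vP4 c p * q = scale_vP4 c (p * q)"
    by transfer (simp add: scale_pm_def mult.assoc two_sided_ideal.zero)
  have "P * scale_pm c Q = scale_pm c (P * Q)" for P Q :: "edge free_algebra"
    unfolding scale_pm_def by (metis comm mult.assoc)
  then show "p * scale_vP4 c q = scale_vP4 c (p * q)"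
    by transfer (simp add: two_sided_ideal.zero)
qed

text \<open>The spanning half of the basis statement; the head of each list represents its
  class.\<close>

lemma vP4_gen_mult_expand:
  "vP4_gen g * vP4_gen h = (\<Sum>L\<leftarrow>product_classes.
     scale_vP4 (class_coeff L g h) (vP4_gen (fst (hd L)) * vP4_gen (snd (hd L))))"
proof -
  have rel: "vP4_gen E12 * vP4_gen E23 = vP4_gen E12 * vP4_gen E13"
    "vP4_gen E13 * vP4_gen E23 = vP4_gen E12 * vP4_gen E13"
    "vP4_gen E12 * vP4_gen E24 = vP4_gen E12 * vP4_gen E14"
    "vP4_gen E14 * vP4_gen E24 = vP4_gen E12 * vP4_gen E14"
    "vP4_gen E13 * vP4_gen E34 = vP4_gen E13 * vP4_gen E14"
    "vP4_gen E14 * vP4_gen E34 = vP4_gen E13 * vP4_gen E14"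
    "vP4_gen E23 * vP4_gen E34 = vP4_gen E23 * vP4_gen E24"
    "vP4_gen E24 * vP4_gen E34 = vP4_gen E23 * vP4_gen E24"
    using vP4_gen_relations(2)[of E12 E13 E23] vP4_gen_relations(2)[of E12 E14 E24]
      vP4_gen_relations(2)[of E13 E14 E34] vP4_gen_relations(2)[of E23 E24 E34] by simp_all
  have anti: "vP4_gen h * vP4_gen g = - (vP4_gen g * vP4_gen h)" for g h by (rule vP4_gen_relations(1))
  have pos: "vP4_gen g * vP4_gen h = (\<Sum>L\<leftarrow>product_classes.
     scale_vP4 (class_coeff L g h) (vP4_gen (fst (hd L)) * vP4_gen (snd (hd L))))"
    if "(g, h) \<in> set (concat product_classes)" for g h
  proof -
    have "\<forall>(g, h)\<in>set (concat product_classes). vP4_gen g * vP4_gen h = (\<Sum>L\<leftarrow>product_classes.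
        scale_vP4 (class_coeff L g h) (vP4_gen (fst (hd L)) * vP4_gen (snd (hd L))))"
      by (simp add: product_classes_def class_coeff_def rel)
    with that show ?thesis by blast
  qed
  show ?thesis
  proof (cases "(g, h) \<in> set (concat product_classes)")
    case True
    then show ?thesis by (rule pos)
  next
    case False
    show ?thesis
    proof (cases "g = h")
      case True
      show ?thesis unfolding True[symmetric]
        by (cases g) (simp_all add: vP4_gen_square product_classes_def class_coeff_def)
    next
      case ne: False
      with False have hg: "(h, g) \<in> set (concat product_classes)"
        by (cases g; cases h; simp add: product_classes_def)
      have "vP4_gen g * vP4_gen h = - (\<Sum>L\<leftarrow>product_classes.
          scale_vP4 (class_coeff L h g) (vP4_gen (fst (hd L)) * vP4_gen (snd (hd L))))"
        using pos[OF hg] anti[of g h] by simp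
      also have "\<dots> = (\<Sum>L\<leftarrow>product_classes.
          - scale_vP4 (class_coeff L h g) (vP4_gen (fst (hd L)) * vP4_gen (snd (hd L))))"
        by (simp add: uminus_sum_list_map o_def)
      also have "\<dots> = (\<Sum>L\<leftarrow>product_classes.
          scale_vP4 (class_coeff L g h) (vP4_gen (fst (hd L)) * vP4_gen (snd (hd L))))"
        using class_coeff_antisym[of _ g h] by (intro arg_cong[where f = sum_list] map_cong) simp_all
      finally show ?thesis .
    qed
  qed
qed

text \<open>One direction applies the seven functionals to an element of the ideal, the other
  expands the product in the seven representatives.\<close>

lemma vP4_class_mult_eq_0_iff: "vP4_class x * vP4_class y = 0 \<longleftrightarrow> cup_zero x y"
proof
  assume "vP4_class x * vP4_class y = 0"
  then have ideal: "(\<Sum>g\<in>UNIV. scale_pm (x $ g) (free_gen g)) * (\<Sum>h\<in>UNIV. scale_pm (y $ h) (free_gen h))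
      \<in> two_sided_ideal vP4_relations" (is "?p \<in> _")
    by (simp add: vP4_class_eq times_vP4_cohomology.abs_eq zero_vP4_cohomology.abs_eq vP4_cohomology.abs_eq_iff)
  have p: "?p = (\<Sum>g\<in>UNIV. \<Sum>h\<in>UNIV. Poly_Mapping.single (Word [g, h]) (x $ g * y $ h))"
    by (simp add: sum_product scale_pm_def free_gen_def mult_single plus_word_def zero_word_def)
  show "cup_zero x y"
    unfolding cup_zero_def
  proof
    fix L assume L: "L \<in> set product_classes"
    have "free_product_coeff L ?p = 0" by (rule free_product_coeff_ideal[OF ideal L])
    then show "(\<Sum>(g, h)\<leftarrow>L. x $ g * y $ h - x $ h * y $ g) = 0"
      unfolding p by (simp add: free_product_coeff_sum free_product_coeff_single class_coeff_sum[OF L])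
  qed
next
  assume cup: "cup_zero x y"
  let ?e = "\<lambda>L. vP4_gen (fst (hd L)) * vP4_gen (snd (hd L))"
  have "vP4_class x * vP4_class y =
      (\<Sum>g\<in>UNIV. \<Sum>h\<in>UNIV. scale_vP4 (x $ g * y $ h) (vP4_gen g * vP4_gen h))"
    by (simp add: vP4_class_def sum_product scale_vP4_mult mult.commute)
  also have "\<dots> = (\<Sum>g\<in>UNIV. \<Sum>h\<in>UNIV. \<Sum>L\<leftarrow>product_classes.
      scale_vP4 (class_coeff L g h * (x $ g * y $ h)) (?e L))"
    by (subst vP4_gen_mult_expand) (simp add: product_classes_def vP4.scale_right_distrib mult.commute)
  also have "\<dots> = (\<Sum>L\<leftarrow>product_classes.
      scale_vP4 (\<Sum>g\<in>UNIV. \<Sum>h\<in>UNIV. class_coeff L g h * (x $ g * y $ h)) (?e L))"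
    by (simp add: product_classes_def sum.distrib vP4.scale_sum_left)
  also have "\<dots> = (\<Sum>L\<leftarrow>product_classes. 0)"
    using cup class_coeff_sum by (intro arg_cong[where f = sum_list] map_cong) (auto simp: cup_zero_def)
  also have "\<dots> = 0" by simp
  finally show "vP4_class x * vP4_class y = 0" .
qed

section \<open>Aomoto Betti numbers\<close>

lemma cup_zero_iff:
  "cup_zero x y \<longleftrightarrow>
     x$E12 * y$E13 - x$E13 * y$E12 + (x$E12 * y$E23 - x$E23 * y$E12) + (x$E13 * y$E23 - x$E23 * y$E13) = 0 \<and>
     x$E12 * y$E14 - x$E14 * y$E12 + (x$E12 * y$E24 - x$E24 * y$E12) + (x$E14 * y$E24 - x$E24 * y$E14) = 0 \<and>
     x$E13 * y$E14 - x$E14 * y$E13 + (x$E13 * y$E34 - x$E34 * y$E13) + (x$E14 * y$E34 - x$E34 * y$E14) = 0 \<and>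
     x$E23 * y$E24 - x$E24 * y$E23 + (x$E23 * y$E34 - x$E34 * y$E23) + (x$E24 * y$E34 - x$E34 * y$E24) = 0 \<and>
     x$E12 * y$E34 - x$E34 * y$E12 = 0 \<and> x$E13 * y$E24 - x$E24 * y$E13 = 0 \<and>
     x$E23 * y$E14 - x$E14 * y$E23 = 0"
  by (simp add: cup_zero_def product_classes_def add.assoc)

definition cup_kernel :: "complex ^ edge \<Rightarrow> (complex ^ edge) set" where
  "cup_kernel x = {y. cup_zero x y}"

lemma linear_vP4_class: "Vector_Spaces.linear (*s) scale_vP4 vP4_class"
  by unfold_locales
    (simp_all add: vP4_class_def vP4.scale_left_distrib sum.distrib vP4.scale_sum_right)

lemma subspace_cup_kernel: "vec.subspace (cup_kernel x)"
  by (rule vec.subspaceI) (simp_all add: cup_kernel_def cup_zero_iff; algebra)+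

lemma self_in_cup_kernel: "x \<in> cup_kernel x"
  by (simp add: cup_kernel_def cup_zero_iff)

lemma inj_vP4_class: "inj vP4_class"
  using bij_betw_vP4_class by (simp add: bij_betw_def)

lemma vP4_class_in_part: "vP4_class x \<in> vP4_part 1"
  using bij_betw_vP4_class by (auto simp: bij_betw_def)

lemma vP4_dim_image_class:
  assumes "vec.subspace V"
  shows "vP4.dim (vP4_class ` V) = vec.dim V" "vP4.subspace (vP4_class ` V)"
    "\<exists>T. finite T \<and> vP4_class ` V \<subseteq> vP4.span T"
proof -
  interpret lin: Vector_Spaces.linear "(*s)" scale_vP4 vP4_class by (rule linear_vP4_class)
  obtain B where B: "B \<subseteq> V" "vec.independent B" "V \<subseteq> vec.span B" "card B = vec.dim V"
    by (rule vec.basis_exists)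
  have inj: "inj_on vP4_class S" for S using inj_vP4_class by (rule inj_on_subset) simp
  have "vP4.independent (vP4_class ` B)" by (rule lin.independent_injective_image[OF B(2) inj])
  moreover have span: "vP4_class ` V \<subseteq> vP4.span (vP4_class ` B)"
    using B(3) by (auto simp: lin.span_image)
  ultimately have "vP4.dim (vP4_class ` V) = card (vP4_class ` B)"
    using B(1) by (intro vP4.dim_unique[where B = "vP4_class ` B"]) auto
  then show "vP4.dim (vP4_class ` V) = vec.dim V" using B(4) by (simp add: card_image[OF inj])
  show "vP4.subspace (vP4_class ` V)" by (rule lin.subspace_image[OF assms])
  have "finite B" using B(2) by (rule vec.finiteI_independent)
  then show "\<exists>T. finite T \<and> vP4_class ` V \<subseteq> vP4.span T"
    using span by blast
qed

lemma vP4_part_0: "vP4_part 0 = range (\<lambda>c. scale_vP4 c 1)"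
proof -
  have "free_part 0 = range (\<lambda>c. scale_pm c 1 :: edge free_algebra)"
  proof
    show "free_part 0 \<subseteq> range (\<lambda>c. scale_pm c 1 :: edge free_algebra)"
    proof
      fix p :: "edge free_algebra" assume p: "p \<in> free_part 0"
      have "p = Poly_Mapping.single 0 (Poly_Mapping.lookup p 0)"
      proof (rule poly_mapping_eqI)
        fix w
        have "Poly_Mapping.lookup p w = 0" if "w \<noteq> 0"
        proof (rule ccontr)
          assume "Poly_Mapping.lookup p w \<noteq> 0"
          then have "length (letters w) = 0" using p by (simp add: free_part_def in_keys_iff)
          with that show False by (cases w) (simp add: zero_word_def)
        qed
        then show "Poly_Mapping.lookup p w =
            Poly_Mapping.lookup (Poly_Mapping.single 0 (Poly_Mapping.lookup p 0)) w"
          by (simp add: lookup_single when_def)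
      qed
      then show "p \<in> range (\<lambda>c. scale_pm c 1)"
        by (intro range_eqI[of _ _ "Poly_Mapping.lookup p 0"]) (simp add: scale_pm_def)
    qed
    show "range (\<lambda>c. scale_pm c 1 :: edge free_algebra) \<subseteq> free_part 0"
      by (auto simp: scale_pm_def free_part_def zero_word_def split: if_splits)
  qed
  then show ?thesis
    by (simp add: vP4_part_def image_image scale_vP4.abs_eq one_vP4_cohomology.abs_eq)
qed

text \<open>Degree zero consists of scalars, so the coboundaries are the multiples of the class
  itself: a line, except at \<open>x = 0\<close>. The injective map \<open>vP4_class\<close> moves
  all dimensions to coordinate space.\<close>

lemma aomoto_betti_vP4_class:
  "aomoto_betti 1 (vP4_class x) = vec.dim (cup_kernel x) - (if x = 0 then 0 else 1)"
proof -
  have "vP4_part 1 = range vP4_class" using bij_betw_vP4_class by (simp add: bij_betw_def)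
  then have Z: "aomoto_cocycles 1 (vP4_class x) = vP4_class ` cup_kernel x"
    unfolding aomoto_cocycles_def cup_kernel_def by (auto simp: vP4_class_mult_eq_0_iff)
  have "aomoto_coboundaries 1 (vP4_class x) = vP4.span {vP4_class x}"
    by (simp add: aomoto_coboundaries_def vP4_part_0 image_image scale_vP4_mult vP4.span_singleton)
  also have "\<dots> = vP4_class ` vec.span {x}"
  proof -
    interpret lin: Vector_Spaces.linear "(*s)" scale_vP4 vP4_class by (rule linear_vP4_class)
    show ?thesis using lin.span_image[of "{x}"] by simp
  qed
  finally have B: "aomoto_coboundaries 1 (vP4_class x) = vP4_class ` vec.span {x}" .
  have sub: "vec.span {x} \<subseteq> cup_kernel x"
    by (rule vec.span_minimal) (simp_all add: self_in_cup_kernel subspace_cup_kernel)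
  obtain T where T: "finite T" "vP4_class ` cup_kernel x \<subseteq> vP4.span T"
    using vP4_dim_image_class(3)[OF subspace_cup_kernel] by blast
  have "aomoto_betti 1 (vP4_class x) = vec.dim (cup_kernel x) - vec.dim (vec.span {x})"
    unfolding aomoto_betti_def Z B
    using vP4.dim_quotient_eq[OF vP4_dim_image_class(2)[OF subspace_cup_kernel]
        vP4_dim_image_class(2)[OF vec.subspace_span] image_mono[OF sub] T]
    by (simp only: vP4_dim_image_class(1)[OF subspace_cup_kernel] vP4_dim_image_class(1)[OF vec.subspace_span])
  then show ?thesis by simp
qed

lemma resonance_coords_Suc_0:
  "x \<in> resonance_coords (Suc 0) d \<longleftrightarrow> d \<le> vec.dim (cup_kernel x) - (if x = 0 then 0 else 1)"
  using vP4_class_in_part[of x] aomoto_betti_vP4_class[of x]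
  by (simp add: resonance_coords_def resonance_def)

section \<open>Dimension bounds from selected coordinates\<close>

definition coordinate_projection :: "edge set \<Rightarrow> complex ^ edge \<Rightarrow> complex ^ edge" where
  "coordinate_projection J y = (\<chi> g. if g \<in> J then y $ g else 0)"

lemma linear_coordinate_projection: "Vector_Spaces.linear (*s) (*s) (coordinate_projection J)"
  by unfold_locales (auto simp: coordinate_projection_def vec_eq_iff)

lemma coordinate_projection_in_span: "coordinate_projection J y \<in> vec.span (unit_vec ` J)"
proof -
  have "coordinate_projection J y = (\<Sum>g\<in>J. y $ g *s unit_vec g)"
    by (auto simp: coordinate_projection_def vec_eq_iff axis_def if_distrib cong: if_cong)
  also have "\<dots> \<in> vec.span (unit_vec ` J)"
    by (intro vec.span_sum vec.span_scale vec.span_base) auto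
  finally show ?thesis .
qed

lemma inj_unit_vec: "inj_on unit_vec J"
  by (rule inj_onI) (simp add: axis_eq_axis)

lemma independent_unit_vecs: "vec.independent (unit_vec ` J)"
proof -
  have "unit_vec ` J \<subseteq> cart_basis" by (auto simp: cart_basis_def)
  then show ?thesis using independent_cart_basis vec.independent_mono by blast
qed

lemma dim_le_determining:
  fixes V :: "(complex ^ edge) set" and J :: "edge set"
  assumes V: "vec.subspace V" and det: "\<And>y. y \<in> V \<Longrightarrow> (\<And>g. g \<in> J \<Longrightarrow> y $ g = 0) \<Longrightarrow> y = 0"
  shows "vec.dim V \<le> card J"
proof -
  let ?f = "coordinate_projection J"
  have "inj_on ?f V"
  proof (rule inj_onI)
    fix y z assume yz: "y \<in> V" "z \<in> V" "?f y = ?f z"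
    have "y - z = 0"
    proof (rule det)
      show "y - z \<in> V" using V yz by (intro vec.subspace_diff)
      show "(y - z) $ g = 0" if "g \<in> J" for g
        using arg_cong[OF yz(3), of "\<lambda>v. v $ g"] that by (simp add: coordinate_projection_def)
    qed
    then show "y = z" by simp
  qed
  then have "vec.dim V = vec.dim (?f ` V)"
    using vec.dim_image_eq[OF linear_coordinate_projection, of J V] vec.span_eq_iff V by metis
  also have "\<dots> \<le> card (unit_vec ` J)"
    using coordinate_projection_in_span by (intro vec.dim_le_card) auto
  finally show ?thesis by (simp add: card_image[OF inj_unit_vec])
qed

lemma dim_ge_dual:
  fixes V :: "(complex ^ edge) set" and J :: "edge set"
  assumes "vec.subspace V"
    and dual: "\<And>g. g \<in> J \<Longrightarrow> \<exists>y\<in>V. \<forall>h\<in>J. y $ h = (if h = g then 1 else 0)"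
  shows "card J \<le> vec.dim V"
proof -
  have "unit_vec ` J \<subseteq> coordinate_projection J ` V"
  proof
    fix v assume "v \<in> unit_vec ` J"
    then obtain g where g: "g \<in> J" "v = unit_vec g" by blast
    obtain y where y: "y \<in> V" "\<forall>h\<in>J. y $ h = (if h = g then 1 else 0)" using dual[OF g(1)] by blast
    have "v = coordinate_projection J y"
      using g y(2) by (auto simp: coordinate_projection_def vec_eq_iff axis_def)
    with y(1) show "v \<in> coordinate_projection J ` V" by blast
  qed
  then have "card (unit_vec ` J) \<le> vec.dim (coordinate_projection J ` V)"
    using independent_unit_vecs by (rule vec.independent_card_le_dim)
  also have "\<dots> \<le> vec.dim V" by (rule vec.dim_image_le[OF linear_coordinate_projection])
  finally show ?thesis by (simp add: card_image[OF inj_unit_vec])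
qed

section \<open>Classification of the resonant classes\<close>

definition resonant_vectors :: "(complex ^ edge) set" where
  "resonant_vectors =
     {unit_vec E12, unit_vec E13, unit_vec E23, unit_vec E14, unit_vec E24, unit_vec E34,
      unit_vec E12 - unit_vec E13 + unit_vec E23,
      unit_vec E12 - unit_vec E14 + unit_vec E24,
      unit_vec E13 - unit_vec E14 + unit_vec E34,
      unit_vec E23 - unit_vec E24 + unit_vec E34,
      unit_vec E13 - unit_vec E23 - unit_vec E14 + unit_vec E24,
      unit_vec E12 + unit_vec E23 - unit_vec E14 + unit_vec E34,
      unit_vec E12 - unit_vec E13 + unit_vec E24 - unit_vec E34}"

lemma resonant_vectors_eq:
  "resonant_vectors =
     {edge_vec 1 0 0 0 0 0,
      edge_vec 0 1 0 0 0 0,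
      edge_vec 0 0 0 0 1 0,
      edge_vec 0 0 0 0 0 1,
      edge_vec 0 0 1 0 0 0,
      edge_vec 0 0 0 1 0 0,
      edge_vec 1 (- 1) 0 0 1 0,
      edge_vec 1 0 1 0 0 (- 1),
      edge_vec 0 1 0 1 0 (- 1),
      edge_vec 0 0 (- 1) 1 1 0,
      edge_vec 0 1 1 0 (- 1) (- 1),
      edge_vec 1 0 0 1 1 (- 1),
      edge_vec 1 (- 1) 1 (- 1) 0 0}"
proof -
  have unit: "unit_vec g = edge_vec (of_bool (g = E12)) (of_bool (g = E13)) (of_bool (g = E24))
      (of_bool (g = E34)) (of_bool (g = E23)) (of_bool (g = E14))" for g
    by (simp add: vec_eq_iff all_edge axis_def)
  have arith: "edge_vec a b c d u v + edge_vec a' b' c' d' u' v' =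
      edge_vec (a + a') (b + b') (c + c') (d + d') (u + u') (v + v')"
    "edge_vec a b c d u v - edge_vec a' b' c' d' u' v' =
      edge_vec (a - a') (b - b') (c - c') (d - d') (u - u') (v - v')" for a b c d u v a' b' c' d' u' v'
    by (simp_all add: vec_eq_iff all_edge)
  show ?thesis unfolding resonant_vectors_def unit arith by simp
qed

definition resonant :: "complex ^ edge \<Rightarrow> bool" where
  "resonant x \<longleftrightarrow> (\<exists>k. \<exists>w\<in>resonant_vectors. x = k *s w)"

lemma scale_edge_vec: "k *s edge_vec a b c d u v = edge_vec (k * a) (k * b) (k * c) (k * d) (k * u) (k * v)"
  by (simp add: vec_eq_iff all_edge)

lemma resonant_edge_vec:
  "resonant (edge_vec k 0 0 0 0 0)"
  "resonant (edge_vec 0 k 0 0 0 0)"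
  "resonant (edge_vec 0 0 0 0 k 0)"
  "resonant (edge_vec 0 0 0 0 0 k)"
  "resonant (edge_vec 0 0 k 0 0 0)"
  "resonant (edge_vec 0 0 0 k 0 0)"
  "resonant (edge_vec k (- k) 0 0 k 0)"
  "resonant (edge_vec k 0 k 0 0 (- k))"
  "resonant (edge_vec 0 k 0 k 0 (- k))"
  "resonant (edge_vec 0 0 (- k) k k 0)"
  "resonant (edge_vec 0 k k 0 (- k) (- k))"
  "resonant (edge_vec k 0 0 k k (- k))"
  "resonant (edge_vec k (- k) k (- k) 0 0)"
  unfolding resonant_def resonant_vectors_eq
  by (auto simp: scale_edge_vec intro: exI[of _ k])

lemma dim_cup_kernel_3:
  assumes ne: "g1 \<noteq> g2" "g1 \<noteq> g3" "g2 \<noteq> g3"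
    and y: "cup_zero w y1" "cup_zero w y2" "cup_zero w y3"
    and dual: "y1 $ g1 = 1" "y1 $ g2 = 0" "y1 $ g3 = 0" "y2 $ g1 = 0" "y2 $ g2 = 1" "y2 $ g3 = 0"
      "y3 $ g1 = 0" "y3 $ g2 = 0" "y3 $ g3 = 1"
    and det: "\<And>y. cup_zero w y \<Longrightarrow> y $ g1 = 0 \<Longrightarrow> y $ g2 = 0 \<Longrightarrow> y $ g3 = 0 \<Longrightarrow> y = 0"
  shows "vec.dim (cup_kernel w) = 3"
proof (rule antisym)
  have card: "card {g1, g2, g3} = 3" using ne by simp
  have "vec.dim (cup_kernel w) \<le> card {g1, g2, g3}"
    by (rule dim_le_determining[OF subspace_cup_kernel]) (auto simp: cup_kernel_def intro: det)
  then show "vec.dim (cup_kernel w) \<le> 3" using card by simp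
  have "card {g1, g2, g3} \<le> vec.dim (cup_kernel w)"
  proof (rule dim_ge_dual[OF subspace_cup_kernel])
    fix g assume "g \<in> {g1, g2, g3}"
    then consider "g = g1" | "g = g2" | "g = g3" by blast
    then show "\<exists>y\<in>cup_kernel w. \<forall>h\<in>{g1, g2, g3}. y $ h = (if h = g then 1 else 0)"
    proof cases
      case 1
      then show ?thesis using y dual ne by (intro bexI[of _ y1]) (auto simp: cup_kernel_def)
    next
      case 2
      then show ?thesis using y dual ne by (intro bexI[of _ y2]) (auto simp: cup_kernel_def)
    next
      case 3
      then show ?thesis using y dual ne by (intro bexI[of _ y3]) (auto simp: cup_kernel_def)
    qed
  qed
  then show "3 \<le> vec.dim (cup_kernel w)" using card by simp
qed

lemma dim_cup_kernel_resonant_vector: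
  assumes "w \<in> resonant_vectors"
  shows "vec.dim (cup_kernel w) = 3"
proof -
  have "vec.dim (cup_kernel (edge_vec 1 0 0 0 0 0)) = 3"
    by (rule dim_cup_kernel_3[of E12 E23 E24 _ "edge_vec 1 0 0 0 0 0" "edge_vec 0 (- 1) 0 0 1 0" "edge_vec 0 0 1 0 0 (- 1)"])
      (auto simp: cup_zero_iff vec_eq_iff all_edge)
  moreover
  have "vec.dim (cup_kernel (edge_vec 0 1 0 0 0 0)) = 3"
    by (rule dim_cup_kernel_3[of E13 E23 E34 _ "edge_vec 0 1 0 0 0 0" "edge_vec 1 0 0 0 1 0" "edge_vec 0 0 0 1 0 (- 1)"])
      (auto simp: cup_zero_iff vec_eq_iff all_edge)
  moreover
  have "vec.dim (cup_kernel (edge_vec 0 0 0 0 1 0)) = 3"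
    by (rule dim_cup_kernel_3[of E13 E23 E34 _ "edge_vec (- 1) 1 0 0 0 0" "edge_vec 0 0 0 0 1 0" "edge_vec 0 0 (- 1) 1 0 0"])
      (auto simp: cup_zero_iff vec_eq_iff all_edge)
  moreover
  have "vec.dim (cup_kernel (edge_vec 0 0 0 0 0 1)) = 3"
    by (rule dim_cup_kernel_3[of E14 E24 E34 _ "edge_vec 0 0 0 0 0 1" "edge_vec 1 0 1 0 0 0" "edge_vec 0 1 0 1 0 0"])
      (auto simp: cup_zero_iff vec_eq_iff all_edge)
  moreover
  have "vec.dim (cup_kernel (edge_vec 0 0 1 0 0 0)) = 3"
    by (rule dim_cup_kernel_3[of E14 E24 E34 _ "edge_vec (- 1) 0 0 0 0 1" "edge_vec 0 0 1 0 0 0" "edge_vec 0 0 0 1 1 0"])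
      (auto simp: cup_zero_iff vec_eq_iff all_edge)
  moreover
  have "vec.dim (cup_kernel (edge_vec 0 0 0 1 0 0)) = 3"
    by (rule dim_cup_kernel_3[of E14 E24 E34 _ "edge_vec 0 (- 1) 0 0 0 1" "edge_vec 0 0 1 0 (- 1) 0" "edge_vec 0 0 0 1 0 0"])
      (auto simp: cup_zero_iff vec_eq_iff all_edge)
  moreover
  \<comment> \<open>For a triangle vector the kernel is the span of the three generators of that
    triangle.\<close>
  have "vec.dim (cup_kernel (edge_vec 1 (- 1) 0 0 1 0)) = 3"
    by (rule dim_cup_kernel_3[of E12 E13 E23 _ "edge_vec 1 0 0 0 0 0" "edge_vec 0 1 0 0 0 0" "edge_vec 0 0 0 0 1 0"])
      (auto simp: cup_zero_iff vec_eq_iff all_edge)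
  moreover
  have "vec.dim (cup_kernel (edge_vec 1 0 1 0 0 (- 1))) = 3"
    by (rule dim_cup_kernel_3[of E12 E14 E24 _ "edge_vec 1 0 0 0 0 0" "edge_vec 0 0 0 0 0 1" "edge_vec 0 0 1 0 0 0"])
      (auto simp: cup_zero_iff vec_eq_iff all_edge)
  moreover
  have "vec.dim (cup_kernel (edge_vec 0 1 0 1 0 (- 1))) = 3"
    by (rule dim_cup_kernel_3[of E13 E14 E34 _ "edge_vec 0 1 0 0 0 0" "edge_vec 0 0 0 0 0 1" "edge_vec 0 0 0 1 0 0"])
      (auto simp: cup_zero_iff vec_eq_iff all_edge)
  moreover
  have "vec.dim (cup_kernel (edge_vec 0 0 (- 1) 1 1 0)) = 3"
    by (rule dim_cup_kernel_3[of E23 E24 E34 _ "edge_vec 0 0 0 0 1 0" "edge_vec 0 0 1 0 0 0" "edge_vec 0 0 0 1 0 0"])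
      (auto simp: cup_zero_iff vec_eq_iff all_edge)
  moreover
  \<comment> \<open>For a 4-cycle vector the kernel is spanned by the vector itself and the
    generators of the two diagonals.\<close>
  have "vec.dim (cup_kernel (edge_vec 0 1 1 0 (- 1) (- 1))) = 3"
    by (rule dim_cup_kernel_3[of E12 E24 E34 _ "edge_vec 1 0 0 0 0 0" "edge_vec 0 1 1 0 (- 1) (- 1)" "edge_vec 0 0 0 1 0 0"])
      (auto simp: cup_zero_iff vec_eq_iff all_edge)
  moreover
  have "vec.dim (cup_kernel (edge_vec 1 0 0 1 1 (- 1))) = 3"
    by (rule dim_cup_kernel_3[of E13 E24 E34 _ "edge_vec 0 1 0 0 0 0" "edge_vec 0 0 1 0 0 0" "edge_vec 1 0 0 1 1 (- 1)"])
      (auto simp: cup_zero_iff vec_eq_iff all_edge)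
  moreover
  have "vec.dim (cup_kernel (edge_vec 1 (- 1) 1 (- 1) 0 0)) = 3"
    by (rule dim_cup_kernel_3[of E23 E14 E34 _ "edge_vec 0 0 0 0 1 0" "edge_vec 0 0 0 0 0 1" "edge_vec (- 1) 1 (- 1) 1 0 0"])
      (auto simp: cup_zero_iff vec_eq_iff all_edge)
  ultimately show ?thesis using assms unfolding resonant_vectors_eq by blast
qed

lemma cup_zero_edge_vec:
  "cup_zero (edge_vec a b c d u v) (edge_vec a' b' c' d' u' v') \<longleftrightarrow>
     a * b' - b * a' + (a * u' - u * a') + (b * u' - u * b') = 0 \<and>
     a * v' - v * a' + (a * c' - c * a') + (v * c' - c * v') = 0 \<and>
     b * v' - v * b' + (b * d' - d * b') + (v * d' - d * v') = 0 \<and>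
     u * c' - c * u' + (u * d' - d * u') + (c * d' - d * c') = 0 \<and>
     a * d' - d * a' = 0 \<and> b * c' - c * b' = 0 \<and> u * v' - v * u' = 0"
  by (simp add: cup_zero_iff)

lemma edge_vec_surj: obtains a b c d u v where "x = edge_vec a b c d u v"
proof
  show "x = edge_vec (x $ E12) (x $ E13) (x $ E24) (x $ E34) (x $ E23) (x $ E14)"
    by (simp add: vec_eq_iff all_edge)
qed

section \<open>Nontrivial kernels and the cubic cone\<close>

lemma edge_vec_in_cubic_cone:
  "edge_vec a b c d u v \<in> cubic_cone \<longleftrightarrow>
     a * c * (b + u) + b * d * (a - u) - c * d * (a + b) = 0 \<and>
     a * u * (v + c) + a * d * (u - v) + v * d * (u + c) = 0 \<and>
     b * u * (v + c) + v * c * (b + u) + d * (b * u - v * c) = 0 \<and>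
     a * (b * v - u * c) + d * (b * u - v * c) = 0"
  by (simp add: cubic_cone_def)

lemma edge_vec_eq_0_iff [simp]:
  "edge_vec a b c d u v = 0 \<longleftrightarrow> a = 0 \<and> b = 0 \<and> c = 0 \<and> d = 0 \<and> u = 0 \<and> v = 0"
  by (auto simp: vec_eq_iff all_edge)

text \<open>Twelve of the fifteen minors are listed; the other three vanish outright by the
  equations for disjoint edges.\<close>

lemma cubics_times_minors:
  fixes a b c d u v a' b' c' d' u' v' :: complex
  assumes h: "a * b' - b * a' + (a * u' - u * a') + (b * u' - u * b') = 0"
    "a * v' - v * a' + (a * c' - c * a') + (v * c' - c * v') = 0"
    "b * v' - v * b' + (b * d' - d * b') + (v * d' - d * v') = 0"
    "u * c' - c * u' + (u * d' - d * u') + (c * d' - d * c') = 0"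
    "a * d' - d * a' = 0" "b * c' - c * b' = 0" "u * v' - v * u' = 0"
  shows "\<forall>f\<in>{a * c * (b + u) + b * d * (a - u) - c * d * (a + b),
      a * u * (v + c) + a * d * (u - v) + v * d * (u + c),
      b * u * (v + c) + v * c * (b + u) + d * (b * u - v * c),
      a * (b * v - u * c) + d * (b * u - v * c)}.
      f * (a * b' - b * a') = 0 \<and> f * (a * u' - u * a') = 0 \<and> f * (a * v' - v * a') = 0 \<and>
      f * (a * c' - c * a') = 0 \<and> f * (b * u' - u * b') = 0 \<and> f * (b * v' - v * b') = 0 \<and>
      f * (b * d' - d * b') = 0 \<and> f * (u * c' - c * u') = 0 \<and> f * (u * d' - d * u') = 0 \<and>
      f * (v * c' - c * v') = 0 \<and> f * (v * d' - d * v') = 0 \<and> f * (c * d' - d * c') = 0"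
  by (intro ballI conjI; elim insertE emptyE; hypsubst; use h in algebra)

text \<open>If some cubic were nonzero at \<open>x\<close>, all minors of \<open>(x, y)\<close>
  would vanish and \<open>y\<close> would be a multiple of \<open>x\<close>.\<close>

lemma cubic_cone_if_cup_zero:
  assumes "cup_zero x y" "x \<noteq> 0" "\<And>k. y \<noteq> k *s x"
  shows "x \<in> cubic_cone"
proof -
  obtain a b c d u v where x: "x = edge_vec a b c d u v" by (rule edge_vec_surj)
  obtain a' b' c' d' u' v' where y: "y = edge_vec a' b' c' d' u' v'" by (rule edge_vec_surj)
  note h = assms(1)[unfolded x y cup_zero_edge_vec]
  have f0: "f = 0" if f: "f \<in> {a * c * (b + u) + b * d * (a - u) - c * d * (a + b),
      a * u * (v + c) + a * d * (u - v) + v * d * (u + c),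
      b * u * (v + c) + v * c * (b + u) + d * (b * u - v * c),
      a * (b * v - u * c) + d * (b * u - v * c)}" for f
  proof (rule ccontr)
    assume "f \<noteq> 0"
    have "f * (a * b' - b * a') = 0 \<and> f * (a * u' - u * a') = 0 \<and> f * (a * v' - v * a') = 0 \<and>
      f * (a * c' - c * a') = 0 \<and> f * (b * u' - u * b') = 0 \<and> f * (b * v' - v * b') = 0 \<and>
      f * (b * d' - d * b') = 0 \<and> f * (u * c' - c * u') = 0 \<and> f * (u * d' - d * u') = 0 \<and>
      f * (v * c' - c * v') = 0 \<and> f * (v * d' - d * v') = 0 \<and> f * (c * d' - d * c') = 0"
      using h by (intro bspec[OF cubics_times_minors f]) blast+
    with \<open>f \<noteq> 0\<close> h have m: "a * b' = b * a'" "a * u' = u * a'" "a * v' = v * a'" "a * c' = c * a'" "b * u' = u * b'"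
      "b * v' = v * b'" "b * d' = d * b'" "u * c' = c * u'" "u * d' = d * u'" "v * c' = c * v'"
      "v * d' = d * v'" "c * d' = d * c'" "a * d' = d * a'" "b * c' = c * b'" "u * v' = v * u'"
      by simp_all
    from \<open>x \<noteq> 0\<close> consider "a \<noteq> 0" | "b \<noteq> 0" | "c \<noteq> 0" | "d \<noteq> 0" | "u \<noteq> 0" | "v \<noteq> 0" by (auto simp: x)
    then have "\<exists>k. y = k *s x"
    proof cases
      case 1
      with m have "y = (a' / a) *s x" by (simp add: x y scale_edge_vec vec_eq_iff all_edge field_simps)
      then show ?thesis ..
    next
      case 2
      with m have "y = (b' / b) *s x" by (simp add: x y scale_edge_vec vec_eq_iff all_edge field_simps)
      then show ?thesis ..
    next
      case 3
      with m have "y = (c' / c) *s x" by (simp add: x y scale_edge_vec vec_eq_iff all_edge field_simps)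
      then show ?thesis ..
    next
      case 4
      with m have "y = (d' / d) *s x" by (simp add: x y scale_edge_vec vec_eq_iff all_edge field_simps)
      then show ?thesis ..
    next
      case 5
      with m have "y = (u' / u) *s x" by (simp add: x y scale_edge_vec vec_eq_iff all_edge field_simps)
      then show ?thesis ..
    next
      case 6
      with m have "y = (v' / v) *s x" by (simp add: x y scale_edge_vec vec_eq_iff all_edge field_simps)
      then show ?thesis ..
    qed
    with assms(3) show False by blast
  qed
  show ?thesis unfolding x edge_vec_in_cubic_cone by (intro conjI f0) simp_all
qed

lemma nonzero_solution_2:
  fixes A1 A2 A3 A4 B1 B2 B3 B4 :: complex
  assumes "A1 * B2 = A2 * B1" "A1 * B3 = A3 * B1" "A1 * B4 = A4 * B1" "A2 * B3 = A3 * B2"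
    "A2 * B4 = A4 * B2" "A3 * B4 = A4 * B3"
  obtains q t where "q \<noteq> 0 \<or> t \<noteq> 0" "q * A1 + t * B1 = 0" "q * A2 + t * B2 = 0"
    "q * A3 + t * B3 = 0" "q * A4 + t * B4 = 0"
proof -
  consider "A1 = 0" "B1 = 0" "A2 = 0" "B2 = 0" "A3 = 0" "B3 = 0" "A4 = 0" "B4 = 0"
    | "A1 \<noteq> 0 \<or> B1 \<noteq> 0" | "A2 \<noteq> 0 \<or> B2 \<noteq> 0" | "A3 \<noteq> 0 \<or> B3 \<noteq> 0" | "A4 \<noteq> 0 \<or> B4 \<noteq> 0" by blast
  then show thesis
  proof cases
    case 1
    then show thesis using that[of 1 0] by simp
  next
    case 2
    then show thesis using that[of B1 "- A1"] assms by (auto simp: mult.commute)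
  next
    case 3
    then show thesis using that[of B2 "- A2"] assms by (auto simp: mult.commute)
  next
    case 4
    then show thesis using that[of B3 "- A3"] assms by (auto simp: mult.commute)
  next
    case 5
    then show thesis using that[of B4 "- A4"] assms by (auto simp: mult.commute)
  qed
qed

text \<open>If one of the two left-hand columns vanishes, its unknown is free and
  \<open>t = 0\<close> works; otherwise \<open>t = 1\<close> and each proportionality can be solved
  separately. Here \<open>p\<close> and \<open>q\<close> fill a pair on which \<open>x\<close>
  vanishes, and \<open>t\<close> scales another pair.\<close>

lemma nonzero_solution_3:
  fixes X1 X2 Y1 Y2 M1 M2 N1 N2 :: complex
  assumes "M1 * X2 = M2 * X1" "N1 * Y2 = N2 * Y1"
  obtains p q t where "p \<noteq> 0 \<or> q \<noteq> 0 \<or> t \<noteq> 0" "p * X1 = M1 * t" "p * X2 = M2 * t" "q * Y1 = N1 * t" "q * Y2 = N2 * t"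
proof -
  have sol: "\<exists>p. p * X = M \<and> p * X' = M'" if "M * X' = M' * X" "X \<noteq> 0 \<or> X' \<noteq> 0" for X X' M M' :: complex
  proof (cases "X = 0")
    case True
    then show ?thesis using that by (intro exI[of _ "M' / X'"]) auto
  next
    case False
    then show ?thesis using that by (intro exI[of _ "M / X"]) (auto simp: field_simps)
  qed
  consider "X1 = 0" "X2 = 0" | "Y1 = 0" "Y2 = 0" | "X1 \<noteq> 0 \<or> X2 \<noteq> 0" "Y1 \<noteq> 0 \<or> Y2 \<noteq> 0" by blast
  then show thesis
  proof cases
    case 1
    then show thesis using that[of 1 0 0] by simp
  next
    case 2
    then show thesis using that[of 0 1 0] by simp
  next
    case 3
    obtain p where "p * X1 = M1" "p * X2 = M2" using sol[OF assms(1) 3(1)] by blast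
    moreover obtain q where "q * Y1 = N1" "q * Y2 = N2" using sol[OF assms(2) 3(2)] by blast
    ultimately show thesis using that[of p q 1] by simp
  qed
qed

text \<open>If none of the pairs \<open>(x\<^sub>1\<^sub>2, x\<^sub>3\<^sub>4)\<close>, \<open>(x\<^sub>1\<^sub>3, x\<^sub>2\<^sub>4)\<close>, \<open>(x\<^sub>2\<^sub>3, x\<^sub>1\<^sub>4)\<close> vanishes, every solution \<open>y\<close> is
  proportional to \<open>x\<close> on each of them, and modulo \<open>x\<close> the first factor may be taken to be \<open>0\<close>. If a
  pair vanishes, the corresponding pair of \<open>y\<close> is free.\<close>

lemma exists_cup_zero:
  assumes "x \<in> cubic_cone" "x \<noteq> 0"
  shows "\<exists>y. cup_zero x y \<and> (\<forall>k. y \<noteq> k *s x)"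
proof -
  obtain a b c d u v where x: "x = edge_vec a b c d u v" by (rule edge_vec_surj)
  note eqs = assms(1)[unfolded x edge_vec_in_cubic_cone]
  have e1: "a * c * (b + u) + b * d * (a - u) - c * d * (a + b) = 0"
    and e2: "a * u * (v + c) + a * d * (u - v) + v * d * (u + c) = 0"
    and e3: "b * u * (v + c) + v * c * (b + u) + d * (b * u - v * c) = 0"
    and e4: "a * (b * v - u * c) + d * (b * u - v * c) = 0" using eqs by blast+
  have solution: ?thesis if "cup_zero x (edge_vec a' b' c' d' u' v')"
    "\<And>k. \<not> (a' = k * a \<and> b' = k * b \<and> c' = k * c \<and> d' = k * d \<and> u' = k * u \<and> v' = k * v)"
    for a' b' c' d' u' v'
    using that by (intro exI[of _ "edge_vec a' b' c' d' u' v'"])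
      (auto simp: x scale_edge_vec vec_eq_iff all_edge)
  have nz: "\<not> (a = 0 \<and> b = 0 \<and> c = 0 \<and> d = 0 \<and> u = 0 \<and> v = 0)" using assms(2) by (simp add: x)
  consider (none) "a \<noteq> 0 \<or> d \<noteq> 0" "b \<noteq> 0 \<or> c \<noteq> 0" "u \<noteq> 0 \<or> v \<noteq> 0"
    | (A) "a = 0" "d = 0" "b \<noteq> 0 \<or> c \<noteq> 0" "u \<noteq> 0 \<or> v \<noteq> 0"
    | (B) "b = 0" "c = 0" "a \<noteq> 0 \<or> d \<noteq> 0" "u \<noteq> 0 \<or> v \<noteq> 0"
    | (C) "u = 0" "v = 0" "a \<noteq> 0 \<or> d \<noteq> 0" "b \<noteq> 0 \<or> c \<noteq> 0"
    | (BC) "b = 0" "c = 0" "u = 0" "v = 0"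
    | (AC) "a = 0" "d = 0" "u = 0" "v = 0"
    | (AB) "a = 0" "d = 0" "b = 0" "c = 0" using nz by blast
  then show ?thesis
  proof cases
    case none
    \<comment> \<open>With \<open>y\<close> equal to 0, \<open>q\<close> times \<open>x\<close> and
      \<open>t\<close> times \<open>x\<close> on the three pairs, the triangle equations become a
      linear system in \<open>q\<close> and \<open>t\<close>. Its six minors vanish on the
      cone.\<close>
    note e = e1 e2 e3 e4
    have m1: "b * (a - u) * (v * (a - c)) = c * (a + v) * (u * (a + b))" using e by algebra
    have m2: "b * (a - u) * (- (v * (b - d))) = b * (v + d) * (u * (a + b))" using e by algebra
    have m3: "b * (a - u) * (- (u * (c + d))) = c * (u - d) * (u * (a + b))" using e by algebra
    have m4: "c * (a + v) * (- (v * (b - d))) = b * (v + d) * (v * (a - c))" using e by algebra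
    have m5: "c * (a + v) * (- (u * (c + d))) = c * (u - d) * (v * (a - c))" using e by algebra
    have m6: "b * (v + d) * (- (u * (c + d))) = c * (u - d) * (- (v * (b - d)))" using e by algebra
    obtain q t where qt: "q \<noteq> 0 \<or> t \<noteq> 0"
      "q * (b * (a - u)) + t * (u * (a + b)) = 0" "q * (c * (a + v)) + t * (v * (a - c)) = 0"
      "q * (b * (v + d)) + t * (- (v * (b - d))) = 0" "q * (c * (u - d)) + t * (- (u * (c + d))) = 0"
      by (rule nonzero_solution_2[OF m1 m2 m3 m4 m5 m6])
    show ?thesis
    proof (rule solution[of 0 "q * b" "q * c" 0 "t * u" "t * v"])
      show "cup_zero x (edge_vec 0 (q * b) (q * c) 0 (t * u) (t * v))"
        unfolding x cup_zero_edge_vec by (intro conjI; (use qt(2-5) in algebra | simp))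
      \<comment> \<open>As \<open>a\<close> or \<open>d\<close> is nonzero, \<open>k = 0\<close>;
        then \<open>q = t = 0\<close>, since the other two pairs are nonzero as well.\<close>
      show "\<not> (0 = k * a \<and> q * b = k * b \<and> q * c = k * c \<and> 0 = k * d \<and> t * u = k * u \<and> t * v = k * v)" for k
        using none qt(1) by auto
    qed
  next
    case A
    have m1: "b * u * (v + c) = - (v * c) * (b + u)" using e3 A(1,2) by algebra
    have m2: "- (b * v) * (u + c) = u * c * (b + v)" using e3 A(1,2) by algebra
    obtain p q t where pqt: "p \<noteq> 0 \<or> q \<noteq> 0 \<or> t \<noteq> 0" "p * (b + u) = b * u * t" "p * (v + c) = - (v * c) * t"
      "q * (b + v) = - (b * v) * t" "q * (u + c) = u * c * t"
      by (rule nonzero_solution_3[OF m1 m2])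
    show ?thesis
    proof (rule solution[of p 0 0 q "t * u" "t * v"])
      show "cup_zero x (edge_vec p 0 0 q (t * u) (t * v))"
        unfolding x cup_zero_edge_vec by (intro conjI; (use pqt(2-5) A(1,2) in algebra | simp))
      show "\<not> (p = k * a \<and> 0 = k * b \<and> 0 = k * c \<and> q = k * d \<and> t * u = k * u \<and> t * v = k * v)" for k
        using A pqt(1) by auto
    qed
  next
    case B
    have m1: "- (a * u) * (v + d) = - (d * v) * (a - u)" using e1 e2 e3 e4 B(1,2) by algebra
    have m2: "- (a * v) * (u - d) = u * d * (a + v)" using e1 e2 e3 e4 B(1,2) by algebra
    obtain p q t where pqt: "p \<noteq> 0 \<or> q \<noteq> 0 \<or> t \<noteq> 0" "p * (a - u) = - (a * u) * t" "p * (v + d) = - (d * v) * t"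
      "q * (a + v) = - (a * v) * t" "q * (u - d) = u * d * t"
      by (rule nonzero_solution_3[OF m1 m2])
    show ?thesis
    proof (rule solution[of 0 p q 0 "t * u" "t * v"])
      show "cup_zero x (edge_vec 0 p q 0 (t * u) (t * v))"
        unfolding x cup_zero_edge_vec by (intro conjI; (use pqt(2-5) B(1,2) in algebra | simp))
      show "\<not> (0 = k * a \<and> p = k * b \<and> q = k * c \<and> 0 = k * d \<and> t * u = k * u \<and> t * v = k * v)" for k
        using B pqt(1) by auto
    qed
  next
    case C
    have m1: "- (a * b) * (c + d) = - (c * d) * (a + b)" using e1 e2 e3 e4 C(1,2) by algebra
    have m2: "- (a * c) * (b - d) = b * d * (a - c)" using e1 e2 e3 e4 C(1,2) by algebra
    obtain p q t where pqt: "p \<noteq> 0 \<or> q \<noteq> 0 \<or> t \<noteq> 0" "p * (a + b) = - (a * b) * t" "p * (c + d) = - (c * d) * t"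
      "q * (a - c) = - (a * c) * t" "q * (b - d) = b * d * t"
      by (rule nonzero_solution_3[OF m1 m2])
    show ?thesis
    proof (rule solution[of 0 "t * b" "t * c" 0 p q])
      show "cup_zero x (edge_vec 0 (t * b) (t * c) 0 p q)"
        unfolding x cup_zero_edge_vec by (intro conjI; (use pqt(2-5) C(1,2) in algebra | simp))
      show "\<not> (0 = k * a \<and> t * b = k * b \<and> t * c = k * c \<and> 0 = k * d \<and> p = k * u \<and> q = k * v)" for k
        using C pqt(1) by auto
    qed
  next
    case BC
    \<comment> \<open>In the last three cases \<open>x\<close> lives on one disjoint pair, and the
      vector of the complementary 4-cycle annihilates it.\<close>
    then show ?thesis by (intro solution[of 0 1 1 0 "- 1" "- 1"]) (auto simp: x cup_zero_edge_vec)
  next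
    case AC
    then show ?thesis by (intro solution[of 1 0 0 1 1 "- 1"]) (auto simp: x cup_zero_edge_vec)
  next
    case AB
    then show ?thesis by (intro solution[of 1 "- 1" 1 "- 1" 0 0]) (auto simp: x cup_zero_edge_vec)
  qed
qed

text \<open>Two coordinates are found that determine \<open>y\<close>. Where every such choice
  fails, enough coefficients of the triangle equations vanish to put \<open>x\<close> on one of the
  thirteen lines.\<close>

lemma dim_cup_kernel_le_2:
  assumes "x \<noteq> 0" "\<not> resonant x"
  shows "vec.dim (cup_kernel x) \<le> 2"
proof -
  obtain a b c d u v where x: "x = edge_vec a b c d u v" by (rule edge_vec_surj)
  have two: ?thesis
    if det: "\<And>a' b' c' d' u' v'. \<lbrakk>cup_zero x (edge_vec a' b' c' d' u' v');
       edge_vec a' b' c' d' u' v' $ g = 0; edge_vec a' b' c' d' u' v' $ h = 0\<rbrakk> \<Longrightarrow>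
       a' = 0 \<and> b' = 0 \<and> c' = 0 \<and> d' = 0 \<and> u' = 0 \<and> v' = 0" for g h
  proof -
    have "vec.dim (cup_kernel x) \<le> card {g, h}"
    proof (rule dim_le_determining[OF subspace_cup_kernel])
      fix y assume y: "y \<in> cup_kernel x" "\<And>i. i \<in> {g, h} \<Longrightarrow> y $ i = 0"
      obtain a' b' c' d' u' v' where y': "y = edge_vec a' b' c' d' u' v'" by (rule edge_vec_surj)
      have "a' = 0 \<and> b' = 0 \<and> c' = 0 \<and> d' = 0 \<and> u' = 0 \<and> v' = 0"
        using y(1) y(2)[of g] y(2)[of h] unfolding y' cup_kernel_def by (intro det) simp_all
      then show "y = 0" by (simp add: y')
    qed
    also have "\<dots> \<le> 2" by (simp add: card_insert_if)
    finally show ?thesis .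
  qed
  \<comment> \<open>On a pair where \<open>x\<close> is nonzero, \<open>y\<close> is proportional to
    \<open>x\<close>, so the coordinate at a nonzero entry of \<open>x\<close> controls both entries
    of \<open>y\<close>.\<close>
  have pivot12: "\<exists>p. \<forall>a' b' c' d' u' v'. cup_zero x (edge_vec a' b' c' d' u' v') \<longrightarrow>
      edge_vec a' b' c' d' u' v' $ p = 0 \<longrightarrow> a' = 0 \<and> d' = 0" if "a \<noteq> 0 \<or> d \<noteq> 0"
    using that unfolding x cup_zero_edge_vec
    by (cases "a = 0") (auto intro: exI[of _ E12] exI[of _ E34])
  have pivot13: "\<exists>p. \<forall>a' b' c' d' u' v'. cup_zero x (edge_vec a' b' c' d' u' v') \<longrightarrow>
      edge_vec a' b' c' d' u' v' $ p = 0 \<longrightarrow> b' = 0 \<and> c' = 0" if "b \<noteq> 0 \<or> c \<noteq> 0"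
    using that unfolding x cup_zero_edge_vec
    by (cases "b = 0") (auto intro: exI[of _ E13] exI[of _ E24])
  have pivot23: "\<exists>p. \<forall>a' b' c' d' u' v'. cup_zero x (edge_vec a' b' c' d' u' v') \<longrightarrow>
      edge_vec a' b' c' d' u' v' $ p = 0 \<longrightarrow> u' = 0 \<and> v' = 0" if "u \<noteq> 0 \<or> v \<noteq> 0"
    using that unfolding x cup_zero_edge_vec
    by (cases "u = 0") (auto intro: exI[of _ E23] exI[of _ E14])
  have nonres: "\<not> resonant (edge_vec a b c d u v)" and nz: "\<not> (a = 0 \<and> b = 0 \<and> c = 0 \<and> d = 0 \<and> u = 0 \<and> v = 0)"
    using assms by (simp_all add: x)
  consider (none) "a \<noteq> 0 \<or> d \<noteq> 0" "b \<noteq> 0 \<or> c \<noteq> 0" "u \<noteq> 0 \<or> v \<noteq> 0"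
    | (A) "a = 0" "d = 0" "b \<noteq> 0 \<or> c \<noteq> 0" "u \<noteq> 0 \<or> v \<noteq> 0"
    | (B) "b = 0" "c = 0" "a \<noteq> 0 \<or> d \<noteq> 0" "u \<noteq> 0 \<or> v \<noteq> 0"
    | (C) "u = 0" "v = 0" "a \<noteq> 0 \<or> d \<noteq> 0" "b \<noteq> 0 \<or> c \<noteq> 0"
    | (BC) "b = 0" "c = 0" "u = 0" "v = 0"
    | (AC) "a = 0" "d = 0" "u = 0" "v = 0"
    | (AB) "a = 0" "d = 0" "b = 0" "c = 0" using nz by blast
  then show ?thesis
  proof cases
    case none
    obtain p where p: "\<And>a' b' c' d' u' v'. cup_zero x (edge_vec a' b' c' d' u' v') \<Longrightarrow>
      edge_vec a' b' c' d' u' v' $ p = 0 \<Longrightarrow> a' = 0 \<and> d' = 0" using pivot12[OF none(1)] by blast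
    obtain q where q: "\<And>a' b' c' d' u' v'. cup_zero x (edge_vec a' b' c' d' u' v') \<Longrightarrow>
      edge_vec a' b' c' d' u' v' $ q = 0 \<Longrightarrow> b' = 0 \<and> c' = 0" using pivot13[OF none(2)] by blast
    obtain r where r: "\<And>a' b' c' d' u' v'. cup_zero x (edge_vec a' b' c' d' u' v') \<Longrightarrow>
      edge_vec a' b' c' d' u' v' $ r = 0 \<Longrightarrow> u' = 0 \<and> v' = 0" using pivot23[OF none(3)] by blast
    \<comment> \<open>These are the two columns of the system in \<open>q\<close> and
      \<open>t\<close> from the existence proof. A nonzero column determines the pair that it
      multiplies, so one pivot can be spared.\<close>
    consider (1) "b * (a - u) \<noteq> 0 \<or> c * (a + v) \<noteq> 0 \<or> b * (v + d) \<noteq> 0 \<or> c * (u - d) \<noteq> 0"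
      | (2) "u * (a + b) \<noteq> 0 \<or> v * (a - c) \<noteq> 0 \<or> v * (b - d) \<noteq> 0 \<or> u * (c + d) \<noteq> 0"
      | (3) "b * (a - u) = 0" "c * (a + v) = 0" "b * (v + d) = 0" "c * (u - d) = 0"
        "u * (a + b) = 0" "v * (a - c) = 0" "v * (b - d) = 0" "u * (c + d) = 0" by blast
    then show ?thesis
    proof cases
      case 1
      show ?thesis
      proof (rule two[of p r])
        fix a' b' c' d' u' v'
        assume y: "cup_zero x (edge_vec a' b' c' d' u' v')"
          "edge_vec a' b' c' d' u' v' $ p = 0" "edge_vec a' b' c' d' u' v' $ r = 0"
        note e = y(1)[unfolded x cup_zero_edge_vec]
        have z: "a' = 0" "d' = 0" "u' = 0" "v' = 0" using p[OF y(1,2)] r[OF y(1,3)] by auto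
        have "(a - u) * b' = 0" "(a + v) * c' = 0" "(v + d) * b' = 0" "(u - d) * c' = 0"
          using e z by algebra+
        then show "a' = 0 \<and> b' = 0 \<and> c' = 0 \<and> d' = 0 \<and> u' = 0 \<and> v' = 0"
          using 1 e z by auto
      qed
    next
      case 2
      show ?thesis
      proof (rule two[of p q])
        fix a' b' c' d' u' v'
        assume y: "cup_zero x (edge_vec a' b' c' d' u' v')"
          "edge_vec a' b' c' d' u' v' $ p = 0" "edge_vec a' b' c' d' u' v' $ q = 0"
        note e = y(1)[unfolded x cup_zero_edge_vec]
        have z: "a' = 0" "d' = 0" "b' = 0" "c' = 0" using p[OF y(1,2)] q[OF y(1,3)] by auto
        have "(a + b) * u' = 0" "(a - c) * v' = 0" "(b - d) * v' = 0" "(c + d) * u' = 0"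
          using e z by algebra+
        then show "a' = 0 \<and> b' = 0 \<and> c' = 0 \<and> d' = 0 \<and> u' = 0 \<and> v' = 0"
          using 2 e z by auto
      qed
    next
      case 3
      note zero = 3
      have "resonant (edge_vec a b c d u v)"
      proof -
        \<comment> \<open>Each choice of a nonzero entry in the second and third pair leads to one
          of the four triangle lines.\<close>
        consider "b \<noteq> 0" "u \<noteq> 0" | "b \<noteq> 0" "v \<noteq> 0" | "c \<noteq> 0" "u \<noteq> 0" | "c \<noteq> 0" "v \<noteq> 0"
          using none by blast
        then show ?thesis
        proof cases
          case 1
          then have e: "u = a" "v = - d" "b = - a" "c = - d" "a \<noteq> 0"
            using zero by (auto simp: add_eq_0_iff add_eq_0_iff2)
          have "a * d = 0" using zero(2,6) unfolding e by algebra
          then have "d = 0" using e(5) by simp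
          then show ?thesis using e resonant_edge_vec(7)[of a] by simp
        next
          case 2
          then have e: "u = a" "v = - d" "c = a" "b = d" "d \<noteq> 0"
            using zero by (auto simp: add_eq_0_iff add_eq_0_iff2)
          have "a * d = 0" using zero(2,5) unfolding e by algebra
          then have "a = 0" using e(5) by simp
          then show ?thesis using e resonant_edge_vec(9)[of d] by simp
        next
          case 3
          then have e: "v = - a" "u = d" "b = - a" "c = - d" "d \<noteq> 0"
            using zero by (auto simp: add_eq_0_iff add_eq_0_iff2)
          have "a * d = 0" using zero(1,6) unfolding e by algebra
          then have "a = 0" using e(5) by simp
          then show ?thesis using e resonant_edge_vec(10)[of d] by simp
        next
          case 4
          then have e: "v = - a" "u = d" "c = a" "b = d" "a \<noteq> 0"
            using zero by (auto simp: add_eq_0_iff add_eq_0_iff2)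
          have "a * d = 0" using zero(1,5) unfolding e by algebra
          then have "d = 0" using e(5) by simp
          then show ?thesis using e resonant_edge_vec(8)[of a] by simp
        qed
      qed
      with nonres show ?thesis by blast
    qed
  next
    case A
    obtain q where q: "\<And>a' b' c' d' u' v'. cup_zero x (edge_vec a' b' c' d' u' v') \<Longrightarrow>
      edge_vec a' b' c' d' u' v' $ q = 0 \<Longrightarrow> b' = 0 \<and> c' = 0" using pivot13[OF A(3)] by blast
    obtain r where r: "\<And>a' b' c' d' u' v'. cup_zero x (edge_vec a' b' c' d' u' v') \<Longrightarrow>
      edge_vec a' b' c' d' u' v' $ r = 0 \<Longrightarrow> u' = 0 \<and> v' = 0" using pivot23[OF A(4)] by blast
    \<comment> \<open>The columns now multiply \<open>a'\<close> and \<open>d'\<close>. If exactly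
      one vanishes, its unknown replaces the pivot of \<open>(u, v)\<close>, because setting it to 0
      forces \<open>u' = v' = 0\<close>. If both vanish, \<open>x\<close> lies on a 4-cycle line.
      The cases \<open>B\<close> and \<open>C\<close> run in parallel.\<close>
    consider (1) "b + u \<noteq> 0 \<or> v + c \<noteq> 0" "b + v \<noteq> 0 \<or> u + c \<noteq> 0"
      | (2) "u = - b" "v = - c" "b + v \<noteq> 0 \<or> u + c \<noteq> 0" | (3) "v = - b" "u = - c" "b + u \<noteq> 0 \<or> v + c \<noteq> 0"
      | (4) "u = - b" "v = - b" "c = b" by (fastforce simp: add_eq_0_iff add_eq_0_iff2)
    then show ?thesis
    proof cases
      case 1
      show ?thesis
      proof (rule two[of q r])
        fix a' b' c' d' u' v'
        assume y: "cup_zero x (edge_vec a' b' c' d' u' v')"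
          "edge_vec a' b' c' d' u' v' $ q = 0" "edge_vec a' b' c' d' u' v' $ r = 0"
        note e = y(1)[unfolded x cup_zero_edge_vec]
        have z: "b' = 0" "c' = 0" "u' = 0" "v' = 0" using q[OF y(1,2)] r[OF y(1,3)] by auto
        have "(b + u) * a' = 0" "(v + c) * a' = 0" "(b + v) * d' = 0" "(u + c) * d' = 0"
          using e z A(1,2) by algebra+
        then show "a' = 0 \<and> b' = 0 \<and> c' = 0 \<and> d' = 0 \<and> u' = 0 \<and> v' = 0"
          using 1 z by auto
      qed
    next
      case 2
      show ?thesis
      proof (rule two[of q E12])
        fix a' b' c' d' u' v'
        assume y: "cup_zero x (edge_vec a' b' c' d' u' v')"
          "edge_vec a' b' c' d' u' v' $ q = 0" "edge_vec a' b' c' d' u' v' $ E12 = 0"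
        note e = y(1)[unfolded x cup_zero_edge_vec]
        have z: "b' = 0" "c' = 0" "a' = 0" using q[OF y(1,2)] y(3) by auto
        have "b * u' = 0" "c * v' = 0" "b * v' = c * u'" using e z A(1,2) 2(1,2) by algebra+
        then have z': "u' = 0" "v' = 0" using A(3) by auto
        have "(b + v) * d' = 0" "(u + c) * d' = 0" using e z z' A(1,2) by algebra+
        then show "a' = 0 \<and> b' = 0 \<and> c' = 0 \<and> d' = 0 \<and> u' = 0 \<and> v' = 0"
          using 2(3) z z' by auto
      qed
    next
      case 3
      show ?thesis
      proof (rule two[of q E34])
        fix a' b' c' d' u' v'
        assume y: "cup_zero x (edge_vec a' b' c' d' u' v')"
          "edge_vec a' b' c' d' u' v' $ q = 0" "edge_vec a' b' c' d' u' v' $ E34 = 0"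
        note e = y(1)[unfolded x cup_zero_edge_vec]
        have z: "b' = 0" "c' = 0" "d' = 0" using q[OF y(1,2)] y(3) by auto
        have "b * v' = 0" "c * u' = 0" "b * u' = c * v'" using e z A(1,2) 3(1,2) by algebra+
        then have z': "u' = 0" "v' = 0" using A(3) by auto
        have "(b + u) * a' = 0" "(v + c) * a' = 0" using e z z' A(1,2) by algebra+
        then show "a' = 0 \<and> b' = 0 \<and> c' = 0 \<and> d' = 0 \<and> u' = 0 \<and> v' = 0"
          using 3(3) z z' by auto
      qed
    next
      case 4
      then show ?thesis using nonres A(1,2) resonant_edge_vec(11)[of b] by simp
    qed
  next
    case B
    obtain p where p: "\<And>a' b' c' d' u' v'. cup_zero x (edge_vec a' b' c' d' u' v') \<Longrightarrow>
      edge_vec a' b' c' d' u' v' $ p = 0 \<Longrightarrow> a' = 0 \<and> d' = 0" using pivot12[OF B(3)] by blast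
    obtain r where r: "\<And>a' b' c' d' u' v'. cup_zero x (edge_vec a' b' c' d' u' v') \<Longrightarrow>
      edge_vec a' b' c' d' u' v' $ r = 0 \<Longrightarrow> u' = 0 \<and> v' = 0" using pivot23[OF B(4)] by blast
    consider (1) "a - u \<noteq> 0 \<or> v + d \<noteq> 0" "a + v \<noteq> 0 \<or> u - d \<noteq> 0"
      | (2) "u = a" "v = - d" "a + v \<noteq> 0 \<or> u - d \<noteq> 0" | (3) "v = - a" "u = d" "a - u \<noteq> 0 \<or> v + d \<noteq> 0"
      | (4) "u = a" "d = a" "v = - a" by (fastforce simp: add_eq_0_iff add_eq_0_iff2)
    then show ?thesis
    proof cases
      case 1
      show ?thesis
      proof (rule two[of p r])
        fix a' b' c' d' u' v'
        assume y: "cup_zero x (edge_vec a' b' c' d' u' v')"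
          "edge_vec a' b' c' d' u' v' $ p = 0" "edge_vec a' b' c' d' u' v' $ r = 0"
        note e = y(1)[unfolded x cup_zero_edge_vec]
        have z: "a' = 0" "d' = 0" "u' = 0" "v' = 0" using p[OF y(1,2)] r[OF y(1,3)] by auto
        have "(a - u) * b' = 0" "(v + d) * b' = 0" "(a + v) * c' = 0" "(u - d) * c' = 0"
          using e z B(1,2) by algebra+
        then show "a' = 0 \<and> b' = 0 \<and> c' = 0 \<and> d' = 0 \<and> u' = 0 \<and> v' = 0"
          using 1 z by auto
      qed
    next
      case 2
      show ?thesis
      proof (rule two[of p E13])
        fix a' b' c' d' u' v'
        assume y: "cup_zero x (edge_vec a' b' c' d' u' v')"
          "edge_vec a' b' c' d' u' v' $ p = 0" "edge_vec a' b' c' d' u' v' $ E13 = 0"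
        note e = y(1)[unfolded x cup_zero_edge_vec]
        have z: "a' = 0" "d' = 0" "b' = 0" using p[OF y(1,2)] y(3) by auto
        have "a * u' = 0" "d * v' = 0" "a * v' + d * u' = 0" using e z B(1,2) 2(1,2) by algebra+
        then have z': "u' = 0" "v' = 0" using B(3) by auto
        have "(a + v) * c' = 0" "(u - d) * c' = 0" using e z z' B(1,2) by algebra+
        then show "a' = 0 \<and> b' = 0 \<and> c' = 0 \<and> d' = 0 \<and> u' = 0 \<and> v' = 0"
          using 2(3) z z' by auto
      qed
    next
      case 3
      show ?thesis
      proof (rule two[of p E24])
        fix a' b' c' d' u' v'
        assume y: "cup_zero x (edge_vec a' b' c' d' u' v')"
          "edge_vec a' b' c' d' u' v' $ p = 0" "edge_vec a' b' c' d' u' v' $ E24 = 0"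
        note e = y(1)[unfolded x cup_zero_edge_vec]
        have z: "a' = 0" "d' = 0" "c' = 0" using p[OF y(1,2)] y(3) by auto
        have "a * v' = 0" "d * u' = 0" "d * v' + a * u' = 0" using e z B(1,2) 3(1,2) by algebra+
        then have z': "u' = 0" "v' = 0" using B(3) by auto
        have "(a - u) * b' = 0" "(v + d) * b' = 0" using e z z' B(1,2) by algebra+
        then show "a' = 0 \<and> b' = 0 \<and> c' = 0 \<and> d' = 0 \<and> u' = 0 \<and> v' = 0"
          using 3(3) z z' by auto
      qed
    next
      case 4
      then show ?thesis using nonres B(1,2) resonant_edge_vec(12)[of a] by simp
    qed
  next
    case C
    obtain p where p: "\<And>a' b' c' d' u' v'. cup_zero x (edge_vec a' b' c' d' u' v') \<Longrightarrow>
      edge_vec a' b' c' d' u' v' $ p = 0 \<Longrightarrow> a' = 0 \<and> d' = 0" using pivot12[OF C(3)] by blast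
    obtain q where q: "\<And>a' b' c' d' u' v'. cup_zero x (edge_vec a' b' c' d' u' v') \<Longrightarrow>
      edge_vec a' b' c' d' u' v' $ q = 0 \<Longrightarrow> b' = 0 \<and> c' = 0" using pivot13[OF C(4)] by blast
    consider (1) "a + b \<noteq> 0 \<or> c + d \<noteq> 0" "a - c \<noteq> 0 \<or> b - d \<noteq> 0"
      | (2) "b = - a" "c = - d" "a - c \<noteq> 0 \<or> b - d \<noteq> 0" | (3) "c = a" "b = d" "a + b \<noteq> 0 \<or> c + d \<noteq> 0"
      | (4) "b = - a" "c = a" "d = - a" by (fastforce simp: add_eq_0_iff add_eq_0_iff2)
    then show ?thesis
    proof cases
      case 1
      show ?thesis
      proof (rule two[of p q])
        fix a' b' c' d' u' v'
        assume y: "cup_zero x (edge_vec a' b' c' d' u' v')"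
          "edge_vec a' b' c' d' u' v' $ p = 0" "edge_vec a' b' c' d' u' v' $ q = 0"
        note e = y(1)[unfolded x cup_zero_edge_vec]
        have z: "a' = 0" "d' = 0" "b' = 0" "c' = 0" using p[OF y(1,2)] q[OF y(1,3)] by auto
        have "(a + b) * u' = 0" "(c + d) * u' = 0" "(a - c) * v' = 0" "(b - d) * v' = 0"
          using e z C(1,2) by algebra+
        then show "a' = 0 \<and> b' = 0 \<and> c' = 0 \<and> d' = 0 \<and> u' = 0 \<and> v' = 0"
          using 1 z by auto
      qed
    next
      case 2
      show ?thesis
      proof (rule two[of p E23])
        fix a' b' c' d' u' v'
        assume y: "cup_zero x (edge_vec a' b' c' d' u' v')"
          "edge_vec a' b' c' d' u' v' $ p = 0" "edge_vec a' b' c' d' u' v' $ E23 = 0"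
        note e = y(1)[unfolded x cup_zero_edge_vec]
        have z: "a' = 0" "d' = 0" "u' = 0" using p[OF y(1,2)] y(3) by auto
        have "a * b' = 0" "d * c' = 0" "a * c' = d * b'" using e z C(1,2) 2(1,2) by algebra+
        then have z': "b' = 0" "c' = 0" using C(3) by auto
        have "(a - c) * v' = 0" "(b - d) * v' = 0" using e z z' C(1,2) by algebra+
        then show "a' = 0 \<and> b' = 0 \<and> c' = 0 \<and> d' = 0 \<and> u' = 0 \<and> v' = 0"
          using 2(3) z z' by auto
      qed
    next
      case 3
      show ?thesis
      proof (rule two[of p E14])
        fix a' b' c' d' u' v'
        assume y: "cup_zero x (edge_vec a' b' c' d' u' v')"
          "edge_vec a' b' c' d' u' v' $ p = 0" "edge_vec a' b' c' d' u' v' $ E14 = 0"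
        note e = y(1)[unfolded x cup_zero_edge_vec]
        have z: "a' = 0" "d' = 0" "v' = 0" using p[OF y(1,2)] y(3) by auto
        have "a * c' = 0" "d * b' = 0" "d * c' = a * b'" using e z C(1,2) 3(1,2) by algebra+
        then have z': "b' = 0" "c' = 0" using C(3) by auto
        have "(a + b) * u' = 0" "(c + d) * u' = 0" using e z z' C(1,2) by algebra+
        then show "a' = 0 \<and> b' = 0 \<and> c' = 0 \<and> d' = 0 \<and> u' = 0 \<and> v' = 0"
          using 3(3) z z' by auto
      qed
    next
      case 4
      then show ?thesis using nonres C(1,2) resonant_edge_vec(13)[of a] by simp
    qed
  next
    case BC
    \<comment> \<open>With one of the two entries zero, \<open>x\<close> would be a multiple of a
      single generator.\<close>
    have "a \<noteq> 0" "d \<noteq> 0"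
      using nonres resonant_edge_vec(6)[of d] resonant_edge_vec(1)[of a] by (auto simp: BC)
    then show ?thesis by (intro two[of E12 E13]) (auto simp: x cup_zero_edge_vec BC add_eq_0_iff)
  next
    case AC
    have "b \<noteq> 0" "c \<noteq> 0"
      using nonres resonant_edge_vec(5)[of c] resonant_edge_vec(2)[of b] by (auto simp: AC)
    then show ?thesis by (intro two[of E12 E13]) (auto simp: x cup_zero_edge_vec AC add_eq_0_iff)
  next
    case AB
    have "u \<noteq> 0" "v \<noteq> 0"
      using nonres resonant_edge_vec(4)[of v] resonant_edge_vec(3)[of u] by (auto simp: AB)
    then show ?thesis by (intro two[of E12 E23]) (auto simp: x cup_zero_edge_vec AB add_eq_0_iff)
  qed
qed

text \<open>All resonant vectors are normalized to have first nonzero coordinate \<open>1\<close>, so different ones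
  span different lines.\<close>

definition leading_coordinate :: "complex ^ edge \<Rightarrow> complex" where
  "leading_coordinate x =
     (if x $ E12 \<noteq> 0 then x $ E12 else if x $ E13 \<noteq> 0 then x $ E13 else if x $ E23 \<noteq> 0 then x $ E23
      else if x $ E14 \<noteq> 0 then x $ E14 else if x $ E24 \<noteq> 0 then x $ E24 else x $ E34)"

lemma leading_coordinate_resonant_vector: "w \<in> resonant_vectors \<Longrightarrow> leading_coordinate w = 1"
  unfolding resonant_vectors_eq by (auto simp: leading_coordinate_def)

lemma resonant_vector_nonzero: "w \<in> resonant_vectors \<Longrightarrow> w \<noteq> 0"
  using leading_coordinate_resonant_vector[of w] by (auto simp: leading_coordinate_def)

lemma card_resonant_vectors: "card resonant_vectors = 13"
  unfolding resonant_vectors_eq by (simp add: vec_eq_iff all_edge)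

lemma inj_on_line_resonant_vectors: "inj_on (\<lambda>v. vec.span {v}) resonant_vectors"
proof (rule inj_onI)
  fix v w assume vw: "v \<in> resonant_vectors" "w \<in> resonant_vectors" "vec.span {v} = vec.span {w}"
  then have "v \<in> vec.span {w}" using vec.span_base[of v "{v}"] by simp
  then obtain k where k: "v = k *s w" by (auto simp: vec.span_singleton)
  have "leading_coordinate v = k * leading_coordinate w"
    unfolding k by (simp add: leading_coordinate_def)
  then show "v = w"
    using leading_coordinate_resonant_vector[OF vw(1)] leading_coordinate_resonant_vector[OF vw(2)] k by simp
qed

lemma cup_kernel_scale:
  assumes "k \<noteq> 0"
  shows "cup_kernel (k *s w) = cup_kernel w"
proof -
  have "(\<Sum>(g, h)\<leftarrow>L. k * w $ g * y $ h - k * w $ h * y $ g) = k * (\<Sum>(g, h)\<leftarrow>L. w $ g * y $ h - w $ h * y $ g)" for L y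
    by (induction L) (auto simp: algebra_simps)
  then show ?thesis using assms by (simp add: cup_kernel_def cup_zero_def)
qed

lemma cup_kernel_0: "cup_kernel 0 = UNIV"
  by (simp add: cup_kernel_def cup_zero_iff)

lemma dim_cup_kernel_0: "vec.dim (cup_kernel 0) = 6"
proof -
  have "CARD(edge) = 6" by (simp add: UNIV_edge)
  then show ?thesis unfolding cup_kernel_0 vec_dim_card .
qed

lemma dim_cup_kernel_resonant: "resonant x \<Longrightarrow> x \<noteq> 0 \<Longrightarrow> vec.dim (cup_kernel x) = 3"
  unfolding resonant_def using dim_cup_kernel_resonant_vector cup_kernel_scale by fastforce

section \<open>The resonance varieties\<close>

lemma resonance_coords_1_1: "resonance_coords 1 1 = cubic_cone"
proof (rule set_eqI)
  fix x
  have sub: "vec.span {x} \<subseteq> cup_kernel x"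
    by (rule vec.span_minimal) (simp_all add: self_in_cup_kernel subspace_cup_kernel)
  show "x \<in> resonance_coords 1 1 \<longleftrightarrow> x \<in> cubic_cone"
  proof (cases "x = 0")
    case True
    then show ?thesis by (simp add: resonance_coords_Suc_0 dim_cup_kernel_0 cubic_cone_def)
  next
    case False
    show ?thesis
    proof
      assume "x \<in> resonance_coords 1 1"
      then have "vec.dim (vec.span {x}) < vec.dim (cup_kernel x)"
        using False by (simp add: resonance_coords_Suc_0)
      then have "cup_kernel x \<noteq> vec.span {x}" by auto
      then obtain y where "y \<in> cup_kernel x" "y \<notin> vec.span {x}" using sub by blast
      then show "x \<in> cubic_cone"
        using cubic_cone_if_cup_zero[of x y] False by (auto simp: cup_kernel_def vec.span_singleton)
    next
      assume "x \<in> cubic_cone"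
      then obtain y where "cup_zero x y" "\<And>k. y \<noteq> k *s x" using exists_cup_zero False by blast
      then have "vec.span {x} \<subset> cup_kernel x"
        using sub by (auto simp: cup_kernel_def vec.span_singleton)
      then have "vec.dim (vec.span {x}) < vec.dim (cup_kernel x)"
        using vec.span_eq_iff[THEN iffD2, OF subspace_cup_kernel, of x]
        by (intro vec.dim_psubset) (simp only: vec.span_span)
      then show "x \<in> resonance_coords 1 1"
        using False by (simp add: resonance_coords_Suc_0)
    qed
  qed
qed

lemma resonance_coords_1_2: "resonance_coords 1 2 = {x. resonant x}"
proof (rule set_eqI)
  fix x
  have "resonant 0" unfolding resonant_def resonant_vectors_eq by (auto intro: exI[of _ 0])
  then show "x \<in> resonance_coords 1 2 \<longleftrightarrow> x \<in> {x. resonant x}"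
    using dim_cup_kernel_resonant[of x] dim_cup_kernel_le_2[of x]
    by (cases "x = 0"; cases "resonant x") (auto simp: resonance_coords_Suc_0 dim_cup_kernel_0)
qed

text \<open>Away from the origin the kernel has dimension at most 3 and the coboundaries take away
  1; at the origin the Betti number is the full dimension 6.\<close>

lemma resonance_coords_1_ge_3:
  assumes "3 \<le> d"
  shows "resonance_coords 1 d = (if d \<le> 6 then {0} else {})"
proof (rule set_eqI)
  fix x
  have "vec.dim (cup_kernel x) \<le> 3" if "x \<noteq> 0"
    using dim_cup_kernel_resonant[of x] dim_cup_kernel_le_2[of x] that by fastforce
  then show "x \<in> resonance_coords 1 d \<longleftrightarrow> x \<in> (if d \<le> 6 then {0} else {})"
    using assms by (cases "x = 0") (auto simp: resonance_coords_Suc_0 dim_cup_kernel_0)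
qed

theorem lemma4p6:
  "resonance_coords 1 1 =
      {x.
        x$E12 * x$E24 * (x$E13 + x$E23) + x$E13 * x$E34 * (x$E12 - x$E23)
          - x$E24 * x$E34 * (x$E12 + x$E13) = 0 \<and>
        x$E12 * x$E23 * (x$E14 + x$E24) + x$E12 * x$E34 * (x$E23 - x$E14)
          + x$E14 * x$E34 * (x$E23 + x$E24) = 0 \<and>
        x$E13 * x$E23 * (x$E14 + x$E24) + x$E14 * x$E24 * (x$E13 + x$E23)
          + x$E34 * (x$E13 * x$E23 - x$E14 * x$E24) = 0 \<and>
        x$E12 * (x$E13 * x$E14 - x$E23 * x$E24)
          + x$E34 * (x$E13 * x$E23 - x$E14 * x$E24) = 0} \<and>
   irreducible_variety (resonance_coords 1 1) \<and>
   variety_dim (resonance_coords 1 1) = 4 \<and>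
   cone_degree (resonance_coords 1 1) = 6 \<and>
   (let lines = (\<lambda>v. vec.span {v}) `
          {unit_vec E12, unit_vec E13, unit_vec E23, unit_vec E14, unit_vec E24, unit_vec E34,
           unit_vec E12 - unit_vec E13 + unit_vec E23,
           unit_vec E12 - unit_vec E14 + unit_vec E24,
           unit_vec E13 - unit_vec E14 + unit_vec E34,
           unit_vec E23 - unit_vec E24 + unit_vec E34,
           unit_vec E13 - unit_vec E23 - unit_vec E14 + unit_vec E24,
           unit_vec E12 + unit_vec E23 - unit_vec E14 + unit_vec E34,
           unit_vec E12 - unit_vec E13 + unit_vec E24 - unit_vec E34}
    in card lines = 13 \<and> (\<forall>L\<in>lines. vec.dim L = 1) \<and> resonance_coords 1 2 = \<Union>lines) \<and>
   (\<forall>d. 3 \<le> d \<and> d \<le> 6 \<longrightarrow> resonance_coords 1 d = {0}) \<and>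
   (\<forall>d\<ge>7. resonance_coords 1 d = {})"
proof (intro conjI)
  note cone = resonance_coords_1_1
  show "resonance_coords 1 1 =
      {x.
        x$E12 * x$E24 * (x$E13 + x$E23) + x$E13 * x$E34 * (x$E12 - x$E23)
          - x$E24 * x$E34 * (x$E12 + x$E13) = 0 \<and>
        x$E12 * x$E23 * (x$E14 + x$E24) + x$E12 * x$E34 * (x$E23 - x$E14)
          + x$E14 * x$E34 * (x$E23 + x$E24) = 0 \<and>
        x$E13 * x$E23 * (x$E14 + x$E24) + x$E14 * x$E24 * (x$E13 + x$E23)
          + x$E34 * (x$E13 * x$E23 - x$E14 * x$E24) = 0 \<and>
        x$E12 * (x$E13 * x$E14 - x$E23 * x$E24)
          + x$E34 * (x$E13 * x$E23 - x$E14 * x$E24) = 0}"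
    using cone unfolding cubic_cone_def .
  show "irreducible_variety (resonance_coords 1 1)"
    unfolding cone by (rule irreducible_variety_cubic_cone)
  show "variety_dim (resonance_coords 1 1) = 4"
    unfolding cone by (rule variety_dim_cubic_cone)
  show "cone_degree (resonance_coords 1 1) = 6"
    unfolding cone by (rule cone_degree_cubic_cone)
  have "resonance_coords 1 2 = (\<Union>v\<in>resonant_vectors. vec.span {v})"
    unfolding resonance_coords_1_2 resonant_def vec.span_singleton by blast
  moreover have "card ((\<lambda>v. vec.span {v}) ` resonant_vectors) = 13"
    by (simp add: card_image[OF inj_on_line_resonant_vectors] card_resonant_vectors)
  moreover have "vec.dim (vec.span {v}) = 1" if "v \<in> resonant_vectors" for v
    using resonant_vector_nonzero[OF that] by simp
  ultimately show "let lines = (\<lambda>v. vec.span {v}) `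
          {unit_vec E12, unit_vec E13, unit_vec E23, unit_vec E14, unit_vec E24, unit_vec E34,
           unit_vec E12 - unit_vec E13 + unit_vec E23,
           unit_vec E12 - unit_vec E14 + unit_vec E24,
           unit_vec E13 - unit_vec E14 + unit_vec E34,
           unit_vec E23 - unit_vec E24 + unit_vec E34,
           unit_vec E13 - unit_vec E23 - unit_vec E14 + unit_vec E24,
           unit_vec E12 + unit_vec E23 - unit_vec E14 + unit_vec E34,
           unit_vec E12 - unit_vec E13 + unit_vec E24 - unit_vec E34}
    in card lines = 13 \<and> (\<forall>L\<in>lines. vec.dim L = 1) \<and> resonance_coords 1 2 = \<Union>lines"
    unfolding Let_def resonant_vectors_def[symmetric] by blast
  show "\<forall>d. 3 \<le> d \<and> d \<le> 6 \<longrightarrow> resonance_coords 1 d = {0}"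
    by (simp add: resonance_coords_1_ge_3[unfolded One_nat_def])
  show "\<forall>d\<ge>7. resonance_coords 1 d = {}"
    by (simp add: resonance_coords_1_ge_3[unfolded One_nat_def])
qed

end
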